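(* Let $(M^n,g)$ be a connected Riemannian manifold of dimension $n\geq 2$. Suppose there exist $k\in\{1,\dots,n-1\}$ and a point $p\in M$ such that $M$ has $\mathrm{Ric}_k|_p>0$. Then $$\mathrm{symrank}(M^n,g)\leq\left\lfloor\frac{n+k}{2}\right\rfloor.$$
   Context: For an $n$-dimensional Riemannian manifold $(M^n,g)$ with $n\ge 2$, a point $p\in M$ and $k\in\{1,\dots,n-1\}$, one says $M$ has positive $k^{\mathrm{th}}$-intermediate Ricci curvature at $p$, written $\mathrm{Ric}_k|_p>0$, if $\sum_{i=1}^k\mathrm{sec}(u,e_i)>0$ for all orthonormal vectors $u,e_1,\dots,e_k\in T_pM$, where $\mathrm{sec}(u,v)$ denotes the sectional curvature of the plane spanned by $u,v$. The symmetry rank $\mathrm{symrank}(M,g)$ is the rank of the isometry group of $(M,g)$, i.e. the maximal dimension $r$ of a torus $T^r$ that can act isometrically and effectively on $(M,g)$. The manifold is not assumed to be closed (or complete). *)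

theory Defs
  imports
    "HOL-Analysis.Analysis"
    "HOL-Algebra.Group_Action"
    "HOL-Library.Extended_Nat"
begin

section \<open>Smooth maps between Euclidean spaces\<close>

primrec Ck_on ::
  "nat \<Rightarrow> 'a::real_normed_vector set \<Rightarrow> ('a \<Rightarrow> 'b::real_normed_vector) \<Rightarrow> bool" where
  "Ck_on 0 S f \<longleftrightarrow> continuous_on S f"
| "Ck_on (Suc k) S f \<longleftrightarrow>
    (\<exists>f'. (\<forall>x\<in>S. (f has_derivative f' x) (at x)) \<and> (\<forall>v. Ck_on k S (\<lambda>x. f' x v)))"

definition smooth_on :: "'a::real_normed_vector set \<Rightarrow> ('a \<Rightarrow> 'b::real_normed_vector) \<Rightarrow> bool" where
  "smooth_on S f \<longleftrightarrow> open S \<and> (\<forall>k. Ck_on k S f)"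


section \<open>Smooth manifolds\<close>

text \<open>The manifold is the whole type \<^typ>\<open>'m\<close>; its topology is the one of the type.
  A chart is an open domain together with a coordinate map into \<open>real^'n\<close>, so
  the dimension is \<open>CARD('n)\<close>.\<close>

type_synonym ('m, 'n) chart = "'m set \<times> ('m \<Rightarrow> (real, 'n) vec)"

definition chart_dom :: "('m, 'n::finite) chart \<Rightarrow> 'm set" where
  "chart_dom c = fst c"

definition chart_map :: "('m, 'n::finite) chart \<Rightarrow> 'm \<Rightarrow> real^'n" where
  "chart_map c = snd c"

definition chart_img :: "('m, 'n::finite) chart \<Rightarrow> (real^'n) set" where
  "chart_img c = chart_map c ` chart_dom c"

definition chart_inv :: "('m, 'n::finite) chart \<Rightarrow> real^'n \<Rightarrow> 'm" where
  "chart_inv c = inv_into (chart_dom c) (chart_map c)"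

definition is_chart :: "('m::topological_space, 'n::finite) chart \<Rightarrow> bool" where
  "is_chart c \<longleftrightarrow> open (chart_dom c) \<and> open (chart_img c) \<and>
    homeomorphism (chart_dom c) (chart_img c) (chart_map c) (chart_inv c)"

definition coord_rep ::
  "('m, 'n::finite) chart \<Rightarrow> ('m, 'n) chart \<Rightarrow> ('m \<Rightarrow> 'm) \<Rightarrow> real^'n \<Rightarrow> real^'n" where
  "coord_rep c d f = chart_map d \<circ> f \<circ> chart_inv c"

definition smooth_map ::
  "('m::topological_space, 'n::finite) chart set \<Rightarrow> ('m \<Rightarrow> 'm) \<Rightarrow> bool" where
  "smooth_map A f \<longleftrightarrow> continuous_on UNIV f \<and>
    (\<forall>c\<in>A. \<forall>d\<in>A. smooth_on (chart_map c ` (chart_dom c \<inter> f -` chart_dom d)) (coord_rep c d f))"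

definition smooth_atlas :: "('m::topological_space, 'n::finite) chart set \<Rightarrow> bool" where
  "smooth_atlas A \<longleftrightarrow> (\<forall>c\<in>A. is_chart c) \<and> (\<Union>c\<in>A. chart_dom c) = UNIV \<and>
    (\<forall>c\<in>A. \<forall>d\<in>A. smooth_on (chart_map c ` (chart_dom c \<inter> chart_dom d)) (coord_rep c d id))"


section \<open>Riemannian metrics and isometries\<close>

text \<open>A metric assigns to each chart the matrix \<open>(g\<^sub>i\<^sub>j)\<close> as a function of the coordinates.\<close>

type_synonym ('m, 'n) metric = "('m, 'n) chart \<Rightarrow> (real, 'n) vec \<Rightarrow> ((real, 'n) vec, 'n) vec"

definition bilin :: "real^'n^'n \<Rightarrow> real^'n \<Rightarrow> real^'n \<Rightarrow> real" where
  "bilin G u v = u \<bullet> (G *v v)"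

definition metric_preserving ::
  "('m, 'n::finite) chart set \<Rightarrow> ('m, 'n) metric \<Rightarrow> ('m \<Rightarrow> 'm) \<Rightarrow> bool" where
  "metric_preserving A g f \<longleftrightarrow>
    (\<forall>c\<in>A. \<forall>d\<in>A. \<forall>p \<in> chart_dom c \<inter> f -` chart_dom d.
      let D = frechet_derivative (coord_rep c d f) (at (chart_map c p))
      in \<forall>u v. bilin (g d (chart_map d (f p))) (D u) (D v) = bilin (g c (chart_map c p)) u v)"

text \<open>\<open>metric_preserving A g id\<close> says that the local expressions of the metric transform as a tensor
  under changes of charts.\<close>

definition riemannian_metric ::
  "('m::topological_space, 'n::finite) chart set \<Rightarrow> ('m, 'n) metric \<Rightarrow> bool" where
  "riemannian_metric A g \<longleftrightarrow>
    (\<forall>c\<in>A. smooth_on (chart_img c) (g c) \<and>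
      (\<forall>x\<in>chart_img c. transpose (g c x) = g c x \<and> (\<forall>u. u \<noteq> 0 \<longrightarrow> bilin (g c x) u u > 0))) \<and>
    metric_preserving A g id"

definition riemannian_manifold ::
  "('m::{t2_space, second_countable_topology}, 'n::finite) chart set \<Rightarrow> ('m, 'n) metric \<Rightarrow> bool" where
  "riemannian_manifold A g \<longleftrightarrow> smooth_atlas A \<and> riemannian_metric A g"

definition isometry ::
  "('m::topological_space, 'n::finite) chart set \<Rightarrow> ('m, 'n) metric \<Rightarrow> ('m \<Rightarrow> 'm) \<Rightarrow> bool" where
  "isometry A g f \<longleftrightarrow> bij f \<and> smooth_map A f \<and> smooth_map A (inv_into UNIV f) \<and> metric_preserving A g f"


section \<open>Curvature\<close>

definition partial_deriv ::
  "'n::finite \<Rightarrow> (real^'n \<Rightarrow> real) \<Rightarrow> real^'n \<Rightarrow> real" where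
  "partial_deriv i f x = frechet_derivative f (at x) (axis i 1)"

text \<open>\<open>christoffel G l i j x\<close> is \<open>\<Gamma>\<^sup>l\<^sub>i\<^sub>j\<close> at \<open>x\<close> for the Levi-Civita connection of the local metric \<open>G\<close>.\<close>

definition christoffel ::
  "(real^'n \<Rightarrow> real^'n^'n) \<Rightarrow> 'n::finite \<Rightarrow> 'n \<Rightarrow> 'n \<Rightarrow> real^'n \<Rightarrow> real" where
  "christoffel G l i j x = (1/2) * (\<Sum>m\<in>UNIV. matrix_inv (G x) $ l $ m *
    (partial_deriv i (\<lambda>y. G y $ j $ m) x + partial_deriv j (\<lambda>y. G y $ i $ m) x
      - partial_deriv m (\<lambda>y. G y $ i $ j) x))"

text \<open>Sign convention:
  \<open>R(X,Y)Z = \<nabla>\<^sub>X\<nabla>\<^sub>Y Z - \<nabla>\<^sub>Y\<nabla>\<^sub>X Z - \<nabla>\<^bsub>[X,Y]\<^esub> Z\<close>, and \<open>curv_coeff G l i j k\<close> is the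
  \<open>\<partial>\<^sub>l\<close>-component of \<open>R(\<partial>\<^sub>i,\<partial>\<^sub>j)\<partial>\<^sub>k\<close>.\<close>

definition curv_coeff ::
  "(real^'n \<Rightarrow> real^'n^'n) \<Rightarrow> 'n::finite \<Rightarrow> 'n \<Rightarrow> 'n \<Rightarrow> 'n \<Rightarrow> real^'n \<Rightarrow> real" where
  "curv_coeff G l i j k x =
    partial_deriv i (christoffel G l j k) x - partial_deriv j (christoffel G l i k) x
    + (\<Sum>m\<in>UNIV. christoffel G l i m x * christoffel G m j k x
                - christoffel G l j m x * christoffel G m i k x)"

definition riemann_curv ::
  "(real^'n \<Rightarrow> real^'n^'n) \<Rightarrow> real^'n \<Rightarrow> real^'n \<Rightarrow> real^'n \<Rightarrow> real^'n \<Rightarrow> real^'n::finite" where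
  "riemann_curv G x u v w =
    (\<chi> l. \<Sum>i\<in>UNIV. \<Sum>j\<in>UNIV. \<Sum>k\<in>UNIV. curv_coeff G l i j k x * u $ i * v $ j * w $ k)"

definition sectional_curv ::
  "(real^'n \<Rightarrow> real^'n^'n) \<Rightarrow> real^'n \<Rightarrow> real^'n \<Rightarrow> real^'n::finite \<Rightarrow> real" where
  "sectional_curv G x u v =
    bilin (G x) (riemann_curv G x u v v) u /
      (bilin (G x) u u * bilin (G x) v v - (bilin (G x) u v)\<^sup>2)"

text \<open>\<open>Ric\<^sub>k > 0\<close> at \<open>p\<close>. The tangent space at \<open>p\<close> is identified with \<open>real^'n\<close> by a chart around
  \<open>p\<close>; the condition does not depend on that chart.\<close>

definition Ric_pos_at ::
  "('m, 'n::finite) chart set \<Rightarrow> ('m, 'n) metric \<Rightarrow> nat \<Rightarrow> 'm \<Rightarrow> bool" where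
  "Ric_pos_at A g k p \<longleftrightarrow>
    (\<exists>c\<in>A. p \<in> chart_dom c \<and>
      (let x = chart_map c p; ip = bilin (g c x) in
        \<forall>(u :: real^'n) (e :: nat \<Rightarrow> real^'n).
          ip u u = 1 \<and> (\<forall>i\<in>{1..k}. ip u (e i) = 0) \<and>
          (\<forall>i\<in>{1..k}. \<forall>j\<in>{1..k}. ip (e i) (e j) = (if i = j then 1 else 0))
          \<longrightarrow> (\<Sum>i=1..k. sectional_curv (g c) x u (e i)) > 0))"


section \<open>Torus actions and symmetry rank\<close>

text \<open>To let \<open>r\<close> range over \<^typ>\<open>nat\<close>, \<open>\<real>\<^sup>r\<close> and \<open>T\<^sup>r = (S\<^sup>1)\<^sup>r\<close> are realised as sets of sequences
  that are trivial from index \<open>r\<close> on. The product topology on sequences induces the usual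
  topologies on them, and \<open>t \<mapsto> (\<lambda>i. cis (t i))\<close> is the universal covering
  \<open>\<real>\<^sup>r \<rightarrow> T\<^sup>r\<close>.\<close>

definition Rspace :: "nat \<Rightarrow> (nat \<Rightarrow> real) set" where
  "Rspace r = {t. \<forall>i\<ge>r. t i = 0}"

definition torus :: "nat \<Rightarrow> (nat \<Rightarrow> complex) monoid" where
  "torus r = \<lparr>carrier = {z. (\<forall>i<r. norm (z i) = 1) \<and> (\<forall>i\<ge>r. z i = 1)},
              mult = (\<lambda>z w i. z i * w i), one = (\<lambda>_. 1)\<rparr>"

lemma group_torus: "group (torus r)"
proof (rule groupI)
  fix z assume z: "z \<in> carrier (torus r)"
  have "inverse (z i) * z i = 1" for i
    using z by (cases "i < r") (auto simp: torus_def intro!: left_inverse)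
  then show "\<exists>w\<in>carrier (torus r). w \<otimes>\<^bsub>torus r\<^esub> z = \<one>\<^bsub>torus r\<^esub>"
    using z by (intro bexI[of _ "\<lambda>i. inverse (z i)"]) (auto simp: torus_def norm_inverse)
qed (auto simp: torus_def norm_mult mult.assoc)

definition torus_exp :: "(nat \<Rightarrow> real) \<Rightarrow> nat \<Rightarrow> complex" where
  "torus_exp t = (\<lambda>i. cis (t i))"

text \<open>\<open>C\<^sup>k\<close> maps on relatively open subsets of \<open>\<real>\<^sup>r \<times> \<real>\<^sup>n\<close>: all iterated partial derivatives up to
  order \<open>k\<close> exist and are continuous.\<close>

primrec Ck_param_on ::
  "nat \<Rightarrow> nat \<Rightarrow> ((nat \<Rightarrow> real) \<times> (real^'n::finite)) set \<Rightarrow>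
    ((nat \<Rightarrow> real) \<times> (real^'n) \<Rightarrow> real^'n) \<Rightarrow> bool" where
  "Ck_param_on r 0 S f \<longleftrightarrow> continuous_on S f"
| "Ck_param_on r (Suc k) S f \<longleftrightarrow> continuous_on S f \<and>
    (\<forall>i<r. \<exists>f'. Ck_param_on r k S f' \<and>
      (\<forall>(t, x)\<in>S. ((\<lambda>s. f (t(i := s), x)) has_vector_derivative f' (t, x)) (at (t i)))) \<and>
    (\<forall>j. \<exists>f'. Ck_param_on r k S f' \<and>
      (\<forall>(t, x)\<in>S. ((\<lambda>s. f (t, x + s *\<^sub>R axis j 1)) has_vector_derivative f' (t, x)) (at 0)))"

text \<open>An action is smooth as a map \<open>T\<^sup>r \<times> M \<rightarrow> M\<close>. Since the covering \<open>\<real>\<^sup>r \<times> M \<rightarrow> T\<^sup>r \<times> M\<close>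
  is a surjective local diffeomorphism, this is smoothness of the map \<open>\<real>\<^sup>r \<times> M \<rightarrow> M\<close>.\<close>

definition smooth_torus_map ::
  "('m::topological_space, 'n::finite) chart set \<Rightarrow> nat \<Rightarrow> ((nat \<Rightarrow> complex) \<Rightarrow> 'm \<Rightarrow> 'm) \<Rightarrow> bool" where
  "smooth_torus_map A r a \<longleftrightarrow>
    continuous_on (Rspace r \<times> UNIV) (\<lambda>(t, q). a (torus_exp t) q) \<and>
    (\<forall>c\<in>A. \<forall>d\<in>A. \<forall>k. Ck_param_on r k
      {(t, x). t \<in> Rspace r \<and> x \<in> chart_img c \<and> a (torus_exp t) (chart_inv c x) \<in> chart_dom d}
      (\<lambda>(t, x). coord_rep c d (a (torus_exp t)) x))"

definition effective_isometric_torus_action ::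
  "('m::topological_space, 'n::finite) chart set \<Rightarrow> ('m, 'n) metric \<Rightarrow> nat \<Rightarrow>
    ((nat \<Rightarrow> complex) \<Rightarrow> 'm \<Rightarrow> 'm) \<Rightarrow> bool" where
  "effective_isometric_torus_action A g r a \<longleftrightarrow>
    faithful_action (torus r) UNIV a \<and> smooth_torus_map A r a \<and>
    (\<forall>z\<in>carrier (torus r). isometry A g (a z))"

text \<open>The supremum is taken in \<^typ>\<open>enat\<close>, so that a bound on it is a genuine bound on all \<open>r\<close>.\<close>

definition symrank ::
  "('m::topological_space, 'n::finite) chart set \<Rightarrow> ('m, 'n) metric \<Rightarrow> enat" where
  "symrank A g = (SUP r \<in> {r. \<exists>a. effective_isometric_torus_action A g r a}. enat r)"

end

theory Submission
  imports Defs
begin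

text \<open>
  Suppose \<open>T\<^sup>r\<close> acts with \<open>2r \<ge> n + k + 1\<close>. In a chart around \<open>p\<close> the action yields commuting Killing
  fields \<open>X\<^sub>1, \<dots>, X\<^sub>r\<close>. Points where they are linearly independent are dense: at a point where the
  rank is locally maximal but smaller than \<open>r\<close>, some nonzero combination vanishes to first order,
  so its flow fixes the point with derivative the identity; isometries being rigid, the flow is
  trivial, which contradicts effectiveness.

  At a point \<open>q\<close> of independence, \<open>\<alpha>(X, Y) = \<nabla>\<^sub>X Y\<close> is symmetric and normal to the span \<open>T\<close> of the
  fields, and \<open>\<langle>R(X, Y) Y, X\<rangle> = |\<alpha>(X, Y)|\<^sup>2 - \<langle>\<alpha>(X, X), \<alpha>(Y, Y)\<rangle>\<close>, the Gauss equation of a flat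
  orbit. Let \<open>u\<close> minimize \<open>|\<alpha>(u, u)|\<close> on the unit sphere of \<open>T\<close>. The kernel of \<open>\<alpha>(u, -)\<close> in the
  orthogonal complement of \<open>u\<close> in \<open>T\<close> has dimension at least \<open>(r - 1) - (n - r) \<ge> k\<close>, and the second
  variation at \<open>u\<close> gives \<open>sec(u, v) \<le> 0\<close> for all \<open>v\<close> in it. Letting \<open>q\<close> tend to \<open>p\<close> produces an
  orthonormal frame at \<open>p\<close> that violates \<open>Ric\<^sub>k > 0\<close>.
\<close>

section \<open>Calculus\<close>

text \<open>No geodesics, orbits as submanifolds or integration of vector fields are needed. The
  action supplies the flow of every combination of Killing fields; the price is that in a chart it
  is only a partial action. Rigidity is the step that returns to the manifold. In place of the
  exponential map it uses that the second derivative of an isometry \<open>f\<close> is determined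
  by \<open>f\<close>, \<open>Df\<close> and the Christoffel symbols, so
  \<open>(f - id, Df - 1)\<close> solves a total system with linear bound and stays zero.

  Why a rank drop forces a first-order zero: let a combination vanish at \<open>q\<close>, with
  derivative \<open>L\<close> there. Commutation makes \<open>L\<close> kill the generators at
  \<open>q\<close>, maximality of the rank puts the image of \<open>L\<close> into their span, so
  \<open>L\<close> squared is zero. At a zero a Killing field has skew derivative, hence
  \<open>L = 0\<close>.

  Normality of \<alpha> and the transformation law rest on one fact: a trilinear form symmetric in
  one pair of slots and skew in an overlapping pair vanishes.

  The limit is needed because curvature is controlled only at \<open>p\<close>, whose orbit may have
  dimension below \<open>r\<close>.\<close>

lemma vector_derivative_segment_bound:
  fixes g :: "real \<Rightarrow> 'b::real_normed_vector"
  assumes "\<And>s. s \<in> closed_segment a b \<Longrightarrow> (g has_vector_derivative g' s) (at s)"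
    and "\<And>s. s \<in> closed_segment a b \<Longrightarrow> norm (g' s - c) \<le> e"
  shows "norm (g b - g a - (b - a) *\<^sub>R c) \<le> e * \<bar>b - a\<bar>"
proof -
  define h where "h = (\<lambda>s. g s - s *\<^sub>R c)"
  have "norm (h b - h a) \<le> e * norm (b - a)"
  proof (rule differentiable_bound[where S = "closed_segment a b" and f' = "\<lambda>s t. t *\<^sub>R (g' s - c)"])
    show "(h has_derivative (\<lambda>t. t *\<^sub>R (g' s - c))) (at s within closed_segment a b)"
      if "s \<in> closed_segment a b" for s
    proof -
      have "((\<lambda>s. s *\<^sub>R c) has_vector_derivative c) (at s)"
        by (rule has_vector_derivative_eq_rhs[OF
              has_vector_derivative_scaleR[OF DERIV_ident has_vector_derivative_const]]) simp
      from has_vector_derivative_diff[OF assms(1)[OF that] this]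
      show ?thesis
        unfolding h_def has_vector_derivative_def by (rule has_derivative_at_withinI)
    qed
    show "onorm (\<lambda>t. t *\<^sub>R (g' s - c)) \<le> e" if "s \<in> closed_segment a b" for s
      using mult_left_mono[OF assms(2)[OF that] abs_ge_zero]
      by (intro onorm_le) (simp add: mult.commute)
  qed auto
  then show ?thesis
    by (simp add: h_def scaleR_diff_left algebra_simps)
qed

lemma continuous_on_ballD:
  assumes "continuous_on S f" "open S" "x \<in> S" "e > 0"
  obtains d where "d > 0" "ball x d \<subseteq> S" "\<And>y. y \<in> ball x d \<Longrightarrow> dist (f y) (f x) < e"
proof -
  obtain d1 where d1: "d1 > 0" "ball x d1 \<subseteq> S"
    using openE[OF assms(2,3)] .
  obtain d2 where d2: "d2 > 0" "\<forall>y\<in>S. dist y x < d2 \<longrightarrow> dist (f y) (f x) < e"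
    using assms(1,3,4) unfolding continuous_on_iff by meson
  show thesis
  proof (rule that[of "min d1 d2"])
    show "dist (f y) (f x) < e" if "y \<in> ball x (min d1 d2)" for y
      using that d1(2) d2(2) by (auto simp: dist_commute subset_iff)
  qed (use d1 d2(1) in \<open>auto simp: subset_iff\<close>)
qed

lemma has_vector_derivative_shiftD:
  fixes a b :: real
  assumes "((\<lambda>s. f (a + s)) has_vector_derivative f') (at b)"
  shows "(f has_vector_derivative f') (at (a + b))"
proof -
  have 1: "((\<lambda>u. u - a) has_vector_derivative 1) (at (a + b))"
    by (auto intro!: derivative_eq_intros)
  have 2: "((\<lambda>s. f (a + s)) has_vector_derivative f') (at ((a + b) - a))"
    using assms by simp
  show ?thesis
    using vector_diff_chain_at[OF 1 2] by (simp add: comp_def)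
qed

text \<open>The increment is made one coordinate at a time; each step is compared with the partial
  derivative at \<open>x\<close> by the mean value inequality. This links
  \<open>Ck_param_on\<close>, phrased by partial derivatives, to \<open>Ck_on\<close>, phrased by
  total ones.\<close>

lemma partial_derivs_imp_has_derivative:
  fixes f :: "real^'n::finite \<Rightarrow> 'b::real_normed_vector"
  assumes S: "open S" "x \<in> S"
    and f': "\<And>y j. y \<in> S \<Longrightarrow> ((\<lambda>s. f (y + s *\<^sub>R axis j 1)) has_vector_derivative f' j y) (at 0)"
    and cont: "\<And>j. continuous_on S (f' j)"
  shows "(f has_derivative (\<lambda>h. \<Sum>j\<in>UNIV. h $ j *\<^sub>R f' j x)) (at x)"
proof -
  have main: "\<exists>d>0. \<forall>h. norm h < d \<longrightarrow>
     norm (f (x + (\<Sum>j\<in>J. h $ j *\<^sub>R axis j 1)) - f x - (\<Sum>j\<in>J. h $ j *\<^sub>R f' j x)) \<le> e * norm h"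
    if "e > 0" for e :: real and J
    using finite[of J] that
  proof (induction J arbitrary: e rule: finite_induct)
    case empty
    then show ?case by (intro exI[of _ 1]) auto
  next
    case (insert j J)
    obtain d1 where d1: "d1 > 0" "\<And>h. norm h < d1 \<Longrightarrow>
       norm (f (x + (\<Sum>j\<in>J. h $ j *\<^sub>R axis j 1)) - f x - (\<Sum>j\<in>J. h $ j *\<^sub>R f' j x)) \<le> e/2 * norm h"
      using insert.IH[of "e/2"] insert.prems by auto
    obtain d2 where d2: "d2 > 0" "ball x d2 \<subseteq> S" "\<And>y. y \<in> ball x d2 \<Longrightarrow> dist (f' j y) (f' j x) < e/2"
      using continuous_on_ballD[OF cont S, of "e/2" j] insert.prems by auto
    \<comment> \<open>The coordinates already moved displace the point by at most
      \<open>CARD('n) * norm h\<close>; the extra 1 pays for the segment in direction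
      \<open>j\<close>.\<close>
    define C where "C = real CARD('n) + 1"
    have C: "C > 0" by (simp add: C_def)
    show ?case
    proof (intro exI[of _ "min d1 (d2 / C)"] conjI allI impI)
      show "0 < min d1 (d2 / C)" using d1 d2 C by auto
      fix h :: "real^'n" assume h: "norm h < min d1 (d2 / C)"
      define y where "y = x + (\<Sum>j\<in>J. h $ j *\<^sub>R axis j 1)"
      have nyx: "norm (y - x) \<le> real CARD('n) * norm h"
      proof -
        have "norm (y - x) \<le> (\<Sum>j\<in>J. norm (h $ j *\<^sub>R (axis j 1 :: real^'n)))"
          unfolding y_def by (simp del: norm_scaleR add: norm_sum)
        also have "\<dots> \<le> (\<Sum>j\<in>J. norm h)"
          by (intro sum_mono) (use component_le_norm_cart in auto)
        also have "\<dots> \<le> real CARD('n) * norm h"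
          by (simp add: mult_right_mono card_mono)
        finally show ?thesis .
      qed
      have inb: "y + s *\<^sub>R axis j 1 \<in> ball x d2" if "s \<in> closed_segment 0 (h $ j)" for s
      proof -
        have "\<bar>s\<bar> \<le> norm h"
          using that component_le_norm_cart[of h j] by (auto simp: closed_segment_eq_real_ivl split: if_splits)
        then have "norm (y + s *\<^sub>R axis j 1 - x) \<le> C * norm h"
          using norm_triangle_ineq[of "y - x" "s *\<^sub>R axis j 1"] nyx
          by (simp add: C_def algebra_simps)
        also have "\<dots> < d2" using h C by (simp add: pos_less_divide_eq mult.commute)
        finally show ?thesis by (simp add: dist_norm norm_minus_commute)
      qed
      have "norm (f (y + (h $ j) *\<^sub>R axis j 1) - f (y + 0 *\<^sub>R axis j 1) - (h $ j - 0) *\<^sub>R f' j x)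
          \<le> e/2 * \<bar>h $ j - 0\<bar>"
      proof (rule vector_derivative_segment_bound[where g = "\<lambda>s. f (y + s *\<^sub>R axis j 1)"
            and g' = "\<lambda>s. f' j (y + s *\<^sub>R axis j 1)"])
        fix s assume s: "s \<in> closed_segment 0 (h $ j)"
        have "((\<lambda>t. f ((y + s *\<^sub>R axis j 1) + t *\<^sub>R axis j 1)) has_vector_derivative
            f' j (y + s *\<^sub>R axis j 1)) (at 0)"
          using inb[OF s] d2 by (intro f') auto
        then have "((\<lambda>t. f (y + (s + t) *\<^sub>R axis j 1)) has_vector_derivative
            f' j (y + s *\<^sub>R axis j 1)) (at 0)"
          by (simp add: scaleR_add_left add.assoc)
        then show "((\<lambda>s. f (y + s *\<^sub>R axis j 1)) has_vector_derivative
            f' j (y + s *\<^sub>R axis j 1)) (at s)"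
          using has_vector_derivative_shiftD[of "\<lambda>s. f (y + s *\<^sub>R axis j 1)" s _ 0] by simp
        show "norm (f' j (y + s *\<^sub>R axis j 1) - f' j x) \<le> e/2"
          using d2(3)[OF inb[OF s]] by (simp add: dist_norm)
      qed
      also have "\<dots> \<le> e/2 * norm h"
        using insert.prems component_le_norm_cart[of h j] by (intro mult_left_mono) auto
      finally have 1: "norm (f (y + (h $ j) *\<^sub>R axis j 1) - f y - (h $ j) *\<^sub>R f' j x) \<le> e/2 * norm h"
        by simp
      have 2: "norm (f y - f x - (\<Sum>j\<in>J. h $ j *\<^sub>R f' j x)) \<le> e/2 * norm h"
        using d1(2)[of h] h by (simp add: y_def)
      have "f (x + (\<Sum>j\<in>insert j J. h $ j *\<^sub>R axis j 1)) - f x - (\<Sum>j\<in>insert j J. h $ j *\<^sub>R f' j x)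
        = (f (y + (h $ j) *\<^sub>R axis j 1) - f y - (h $ j) *\<^sub>R f' j x)
          + (f y - f x - (\<Sum>j\<in>J. h $ j *\<^sub>R f' j x))"
        using insert.hyps by (simp add: y_def algebra_simps)
      then show "norm (f (x + (\<Sum>j\<in>insert j J. h $ j *\<^sub>R axis j 1)) - f x
          - (\<Sum>j\<in>insert j J. h $ j *\<^sub>R f' j x)) \<le> e * norm h"
        using norm_triangle_mono[OF 1 2] by (simp only: field_sum_of_halves flip: distrib_right)
    qed
  qed
  have basis: "(\<Sum>j\<in>UNIV. h $ j *\<^sub>R axis j 1) = h" for h :: "real^'n"
    using basis_expansion[of h] by (simp add: scalar_mult_eq_scaleR)
  have bl: "bounded_linear (\<lambda>h::real^'n. \<Sum>j\<in>UNIV. h $ j *\<^sub>R f' j x)"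
    by (intro bounded_linear_sum bounded_linear_scaleR_left[THEN bounded_linear_compose]
        bounded_linear_vec_nth)
  show ?thesis
    unfolding has_derivative_at_alt
  proof (intro conjI bl allI impI)
    fix e :: real assume "0 < e"
    from main[OF this, of UNIV] obtain d where "d > 0"
      "\<And>h. norm h < d \<Longrightarrow> norm (f (x + h) - f x - (\<Sum>j\<in>UNIV. h $ j *\<^sub>R f' j x)) \<le> e * norm h"
      unfolding basis by blast
    from this(1) this(2)[of "y - x" for y]
    show "\<exists>d>0. \<forall>y. norm (y - x) < d \<longrightarrow>
        norm (f y - f x - (\<Sum>j\<in>UNIV. (y - x) $ j *\<^sub>R f' j x)) \<le> e * norm (y - x)"
      by (intro exI[of _ d]) simp
  qed
qed

text \<open>The mean value inequality is applied twice, in \<open>s\<close> to the difference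
  \<open>\<phi>\<close> and then in \<open>h\<close> to \<open>Fs\<close>, each time against the
  constant \<open>Fsh s0 h0\<close>.\<close>

lemma mixed_difference_bound:
  fixes F :: "real \<Rightarrow> real \<Rightarrow> 'b::real_normed_vector"
  assumes S: "open S" "(s0, h0) \<in> S"
    and Fs: "\<And>s h. (s, h) \<in> S \<Longrightarrow> ((\<lambda>s. F s h) has_vector_derivative Fs s h) (at s)"
    and Fsh: "\<And>s h. (s, h) \<in> S \<Longrightarrow> ((\<lambda>h. Fs s h) has_vector_derivative Fsh s h) (at h)"
    and cont: "continuous_on S (\<lambda>(s, h). Fsh s h)" and "e > 0"
  shows "\<forall>\<^sub>F d in at_right 0.
    norm (F (s0 + d) (h0 + d) - F s0 (h0 + d) - F (s0 + d) h0 + F s0 h0 - d\<^sup>2 *\<^sub>R Fsh s0 h0) \<le> e * d\<^sup>2"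
proof -
  obtain d1 where d1: "d1 > 0" "ball (s0, h0) d1 \<subseteq> S"
    "\<And>y. y \<in> ball (s0, h0) d1 \<Longrightarrow> dist ((\<lambda>(s, h). Fsh s h) y) (Fsh s0 h0) < e"
    using continuous_on_ballD[OF cont S \<open>e > 0\<close>] by auto
  have "norm (F (s0 + d) (h0 + d) - F s0 (h0 + d) - F (s0 + d) h0 + F s0 h0 - d\<^sup>2 *\<^sub>R Fsh s0 h0) \<le> e * d\<^sup>2"
    if d: "0 < d" "d < d1 / 2" for d
  proof -
    have inb: "(s, h) \<in> ball (s0, h0) d1"
      if "s \<in> closed_segment s0 (s0 + d)" "h \<in> closed_segment h0 (h0 + d)" for s h
    proof -
      have "norm ((s, h) - (s0, h0)) \<le> norm (s - s0) + norm (h - h0)"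
        using norm_Pair_le[of "s - s0" "h - h0"] by simp
      also have "\<dots> < d1" using that d by (auto simp: closed_segment_eq_real_ivl)
      finally show ?thesis by (simp only: mem_ball dist_norm norm_minus_commute)
    qed
    define \<phi> where "\<phi> = (\<lambda>s. F s (h0 + d) - F s h0)"
    have "norm (\<phi> (s0 + d) - \<phi> s0 - ((s0 + d) - s0) *\<^sub>R (d *\<^sub>R Fsh s0 h0)) \<le> (e * d) * \<bar>(s0 + d) - s0\<bar>"
    proof (rule vector_derivative_segment_bound)
      fix s assume s: "s \<in> closed_segment s0 (s0 + d)"
      show "(\<phi> has_vector_derivative (Fs s (h0 + d) - Fs s h0)) (at s)"
        unfolding \<phi>_def using inb[OF s] d d1
        by (intro has_vector_derivative_diff Fs) auto
      have "norm (Fs s (h0 + d) - Fs s h0 - ((h0 + d) - h0) *\<^sub>R Fsh s0 h0) \<le> e * \<bar>(h0 + d) - h0\<bar>"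
      proof (rule vector_derivative_segment_bound)
        fix h assume h: "h \<in> closed_segment h0 (h0 + d)"
        show "((\<lambda>h. Fs s h) has_vector_derivative Fsh s h) (at h)"
          using inb[OF s h] d1 by (intro Fsh) auto
        show "norm (Fsh s h - Fsh s0 h0) \<le> e"
          using d1(3)[OF inb[OF s h]] by (simp add: dist_norm)
      qed
      then show "norm (Fs s (h0 + d) - Fs s h0 - d *\<^sub>R Fsh s0 h0) \<le> e * d" using d by simp
    qed
    then show ?thesis using d by (simp add: \<phi>_def power2_eq_square algebra_simps)
  qed
  then show ?thesis
    unfolding eventually_at_right_field using d1(1) by (metis half_gt_zero)
qed

text \<open>The second difference does not see the order of the variables, so both mixed derivatives
  approximate it up to \<open>o(d^2)\<close>.\<close>

lemma mixed_partials_commute: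
  fixes F :: "real \<Rightarrow> real \<Rightarrow> 'b::real_normed_vector"
  assumes S: "open S" "(s0, h0) \<in> S"
    and Fs: "\<And>s h. (s, h) \<in> S \<Longrightarrow> ((\<lambda>s. F s h) has_vector_derivative Fs s h) (at s)"
    and Fh: "\<And>s h. (s, h) \<in> S \<Longrightarrow> ((\<lambda>h. F s h) has_vector_derivative Fh s h) (at h)"
    and Fsh: "\<And>s h. (s, h) \<in> S \<Longrightarrow> ((\<lambda>h. Fs s h) has_vector_derivative Fsh s h) (at h)"
    and Fhs: "\<And>s h. (s, h) \<in> S \<Longrightarrow> ((\<lambda>s. Fh s h) has_vector_derivative Fhs s h) (at s)"
    and cont: "continuous_on S (\<lambda>(s, h). Fsh s h)" "continuous_on S (\<lambda>(s, h). Fhs s h)"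
  shows "Fsh s0 h0 = Fhs s0 h0"
proof -
  have "norm (Fsh s0 h0 - Fhs s0 h0) \<le> e" if "e > 0" for e
  proof -
    \<comment> \<open>The domain with its two variables exchanged, so that the same bound serves the
      other order of differentiation.\<close>
    let ?T = "(\<lambda>(h, s). (s, h)) -` S"
    have T: "open ?T" "(h0, s0) \<in> ?T"
      using S by (auto intro!: open_vimage continuous_intros simp: split_beta)
    have cT: "continuous_on ?T (\<lambda>(h, s). Fhs s h)"
    proof -
      have "(\<lambda>x. (snd x, fst x)) ` ?T \<subseteq> S" by auto
      moreover have "continuous_on ?T (\<lambda>x. (snd x, fst x))"
        by (intro continuous_on_Pair continuous_on_fst continuous_on_snd continuous_on_id)
      ultimately show ?thesis
        using continuous_on_compose2[OF cont(2), of ?T "\<lambda>x. (snd x, fst x)"]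
        by (simp add: split_beta)
    qed
    have "\<forall>\<^sub>F d in at_right 0. d > (0::real)" by (simp add: eventually_at_right_less)
    moreover have "\<forall>\<^sub>F d in at_right 0.
      norm (F (s0 + d) (h0 + d) - F s0 (h0 + d) - F (s0 + d) h0 + F s0 h0 - d\<^sup>2 *\<^sub>R Fsh s0 h0) \<le> e/2 * d\<^sup>2"
      using that by (intro mixed_difference_bound[OF S Fs Fsh cont(1)]) auto
    moreover have "\<forall>\<^sub>F d in at_right 0.
      norm (F (s0 + d) (h0 + d) - F (s0 + d) h0 - F s0 (h0 + d) + F s0 h0 - d\<^sup>2 *\<^sub>R Fhs s0 h0) \<le> e/2 * d\<^sup>2"
      using that by (intro mixed_difference_bound[of ?T h0 s0 "\<lambda>h s. F s h" "\<lambda>h s. Fh s h" "\<lambda>h s. Fhs s h",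
        OF T _ _ cT] Fh Fhs) auto
    ultimately have "\<forall>\<^sub>F d in at_right 0. d > 0 \<and>
      norm (F (s0 + d) (h0 + d) - F s0 (h0 + d) - F (s0 + d) h0 + F s0 h0 - d\<^sup>2 *\<^sub>R Fsh s0 h0) \<le> e/2 * d\<^sup>2
      \<and> norm (F (s0 + d) (h0 + d) - F (s0 + d) h0 - F s0 (h0 + d) + F s0 h0 - d\<^sup>2 *\<^sub>R Fhs s0 h0) \<le> e/2 * d\<^sup>2"
      by (simp add: eventually_conj_iff)
    then obtain d where d: "d > 0"
      "norm (F (s0 + d) (h0 + d) - F s0 (h0 + d) - F (s0 + d) h0 + F s0 h0 - d\<^sup>2 *\<^sub>R Fsh s0 h0) \<le> e/2 * d\<^sup>2"
      "norm (F (s0 + d) (h0 + d) - F (s0 + d) h0 - F s0 (h0 + d) + F s0 h0 - d\<^sup>2 *\<^sub>R Fhs s0 h0) \<le> e/2 * d\<^sup>2"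
      using eventually_happens'[OF trivial_limit_at_right_real] by blast
    have "d\<^sup>2 * norm (Fsh s0 h0 - Fhs s0 h0) = norm (d\<^sup>2 *\<^sub>R (Fsh s0 h0 - Fhs s0 h0))"
      by simp
    also have "\<dots> \<le> e * d\<^sup>2"
      using norm_triangle_ineq4[THEN order_trans, OF add_mono[OF d(3) d(2)]]
      by (simp add: algebra_simps)
    finally show ?thesis using d(1) by (simp add: mult.commute)
  qed
  then have "norm (Fsh s0 h0 - Fhs s0 h0) \<le> 0" by (rule field_le_epsilon[of _ 0, simplified])
  then show ?thesis by simp
qed

section \<open>Calculus of maps of class C^k\<close>

lemma Ck_on_cong:
  assumes "Ck_on k S f" "open S" "\<And>x. x \<in> S \<Longrightarrow> f x = g x"
  shows "Ck_on k S g"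
proof (cases k)
  case 0
  then show ?thesis using assms continuous_on_cong by simp
next
  case (Suc m)
  then obtain f' where f': "\<forall>x\<in>S. (f has_derivative f' x) (at x)" "\<forall>v. Ck_on m S (\<lambda>x. f' x v)"
    using assms(1) by auto
  have "\<forall>x\<in>S. (g has_derivative f' x) (at x)"
    using f'(1) assms(2,3) has_derivative_transform_within_open by blast
  then show ?thesis using f'(2) Suc by auto
qed

lemma Ck_on_imp_continuous_on: "Ck_on k S f \<Longrightarrow> continuous_on S f"
  by (cases k) (auto intro!: continuous_at_imp_continuous_on intro: has_derivative_continuous)

lemma Ck_on_Suc_imp: "Ck_on (Suc k) S f \<Longrightarrow> Ck_on k S f"
proof (induction k arbitrary: f)
  case 0
  then show ?case using Ck_on_imp_continuous_on by fastforce
next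
  case (Suc k)
  from Suc.prems obtain f' where f': "\<forall>x\<in>S. (f has_derivative f' x) (at x)"
    "\<forall>v. Ck_on (Suc k) S (\<lambda>x. f' x v)"
    by (subst (asm) Ck_on.simps) blast
  with Suc.IH have "\<forall>v. Ck_on k S (\<lambda>x. f' x v)" by blast
  with f'(1) show ?case by (subst Ck_on.simps) blast
qed

lemma Ck_on_bounded_linear:
  assumes "bounded_linear L" "Ck_on k S f"
  shows "Ck_on k S (\<lambda>x. L (f x))"
  using assms(2)
proof (induction k arbitrary: f)
  case 0
  then show ?case
    by (simp add: bounded_linear.continuous_on[OF assms(1)])
next
  case (Suc k)
  from Suc.prems obtain f' where f': "\<forall>x\<in>S. (f has_derivative f' x) (at x)"
    "\<forall>v. Ck_on k S (\<lambda>x. f' x v)" by auto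
  with Suc.IH show ?case
    by (auto intro!: exI[of _ "\<lambda>x v. L (f' x v)"] bounded_linear.has_derivative[OF assms(1)])
qed

text \<open>Derivatives on \<open>S\<close> are unique, so the existential witness inside
  \<open>Ck_on\<close> may be replaced by \<open>frechet_derivative\<close>, a fixed term that can
  be differentiated again.\<close>

lemma Ck_on_SucD:
  assumes "Ck_on (Suc k) S f"
  shows "x \<in> S \<Longrightarrow> (f has_derivative frechet_derivative f (at x)) (at x)"
    and "open S \<Longrightarrow> Ck_on k S (\<lambda>x. frechet_derivative f (at x) v)"
proof -
  obtain f' where f': "\<forall>x\<in>S. (f has_derivative f' x) (at x)" "\<forall>v. Ck_on k S (\<lambda>x. f' x v)"
    using assms by auto
  then have eq: "f' x = frechet_derivative f (at x)" if "x \<in> S" for x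
    using that by (simp add: frechet_derivative_at)
  show "x \<in> S \<Longrightarrow> (f has_derivative frechet_derivative f (at x)) (at x)"
    using f'(1) eq by metis
  show "Ck_on k S (\<lambda>x. frechet_derivative f (at x) v)" if "open S"
    by (rule Ck_on_cong[OF f'(2)[rule_format, of v] that]) (simp add: eq)
qed

lemma Ck_onI:
  assumes "\<And>x. x \<in> S \<Longrightarrow> (f has_derivative f' x) (at x)" "\<And>v. Ck_on k S (\<lambda>x. f' x v)"
  shows "Ck_on (Suc k) S f"
  using assms by auto

lemma Ck_on_const: "Ck_on k S (\<lambda>x. c)"
proof (induction k arbitrary: c)
  case (Suc k)
  show ?case by (rule Ck_onI[of _ _ "\<lambda>_ _. 0"]) (use Suc in auto)
qed simp

lemma Ck_on_add:
  assumes "Ck_on k S f" "Ck_on k S g"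
  shows "Ck_on k S (\<lambda>x. f x + g x)"
  using assms
proof (induction k arbitrary: f g)
  case 0
  then show ?case by (simp add: continuous_on_add)
next
  case (Suc k)
  then obtain f' g' where "\<forall>x\<in>S. (f has_derivative f' x) (at x)" "\<forall>v. Ck_on k S (\<lambda>x. f' x v)"
    "\<forall>x\<in>S. (g has_derivative g' x) (at x)" "\<forall>v. Ck_on k S (\<lambda>x. g' x v)" by auto
  with Suc.IH show ?case
    by (intro Ck_onI[of _ _ "\<lambda>x v. f' x v + g' x v"]) (auto intro: has_derivative_add)
qed

lemma Ck_on_mult:
  fixes f g :: "'a::real_normed_vector \<Rightarrow> real"
  assumes "Ck_on k S f" "Ck_on k S g"
  shows "Ck_on k S (\<lambda>x. f x * g x)"
  using assms
proof (induction k arbitrary: f g)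
  case 0
  then show ?case by (simp add: continuous_on_mult)
next
  case (Suc k)
  note fg = Suc.prems[THEN Ck_on_Suc_imp]
  from Suc.prems obtain f' g' where "\<forall>x\<in>S. (f has_derivative f' x) (at x)" "\<forall>v. Ck_on k S (\<lambda>x. f' x v)"
    "\<forall>x\<in>S. (g has_derivative g' x) (at x)" "\<forall>v. Ck_on k S (\<lambda>x. g' x v)" by auto
  with Suc.IH fg show ?case
    by (intro Ck_onI[of _ _ "\<lambda>x v. f x * g' x v + f' x v * g x"] Ck_on_add)
      (auto intro: has_derivative_mult)
qed

lemma Ck_on_diff:
  fixes f g :: "'a::real_normed_vector \<Rightarrow> real"
  assumes "Ck_on k S f" "Ck_on k S g"
  shows "Ck_on k S (\<lambda>x. f x - g x)"
  using Ck_on_add[OF assms(1) Ck_on_mult[OF Ck_on_const[of k S "-1"] assms(2)]] by simp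

lemma Ck_on_sum:
  assumes "\<And>i. i \<in> I \<Longrightarrow> Ck_on k S (f i)"
  shows "Ck_on k S (\<lambda>x. \<Sum>i\<in>I. f i x)"
  using assms by (induction I rule: infinite_finite_induct) (auto intro: Ck_on_const Ck_on_add)

lemma Ck_on_prod:
  fixes f :: "'i \<Rightarrow> 'a::real_normed_vector \<Rightarrow> real"
  assumes "\<And>i. i \<in> I \<Longrightarrow> Ck_on k S (f i)"
  shows "Ck_on k S (\<lambda>x. \<Prod>i\<in>I. f i x)"
  using assms by (induction I rule: infinite_finite_induct) (auto intro: Ck_on_const Ck_on_mult)

lemma Ck_on_inverse:
  fixes f :: "'a::real_normed_vector \<Rightarrow> real"
  assumes "Ck_on k S f" "\<And>x. x \<in> S \<Longrightarrow> f x \<noteq> 0"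
  shows "Ck_on k S (\<lambda>x. inverse (f x))"
  using assms
proof (induction k arbitrary: f)
  case 0
  then show ?case by (simp add: continuous_on_inverse)
next
  case (Suc k)
  from Suc.prems obtain f' where f': "\<forall>x\<in>S. (f has_derivative f' x) (at x)" "\<forall>v. Ck_on k S (\<lambda>x. f' x v)"
    by auto
  have inv: "Ck_on k S (\<lambda>x. inverse (f x))"
    using Suc Ck_on_Suc_imp by blast
  show ?case
  proof (rule Ck_onI)
    show "((\<lambda>x. inverse (f x)) has_derivative (\<lambda>h. -1 * (inverse (f x) * f' x h * inverse (f x)))) (at x)"
      if "x \<in> S" for x
      using Deriv.has_derivative_inverse[OF Suc.prems(2)[OF that] f'(1)[rule_format, OF that]] by simp
    show "Ck_on k S (\<lambda>x. -1 * (inverse (f x) * f' x v * inverse (f x)))" for v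
      by (intro Ck_on_mult Ck_on_const inv f'(2)[rule_format])
  qed
qed

section \<open>Second derivatives and their symmetry\<close>

definition second_deriv :: "('a::real_normed_vector \<Rightarrow> 'b::real_normed_vector) \<Rightarrow> 'a \<Rightarrow> 'a \<Rightarrow> 'a \<Rightarrow> 'b" where
  "second_deriv f x a b = frechet_derivative (\<lambda>y. frechet_derivative f (at y) b) (at x) a"

lemma has_derivative_second_deriv:
  assumes "Ck_on 2 S f" "open S" "x \<in> S"
  shows "((\<lambda>y. frechet_derivative f (at y) b) has_derivative (\<lambda>a. second_deriv f x a b)) (at x)"
  unfolding second_deriv_def
  using Ck_on_SucD(1)[OF Ck_on_SucD(2)[of 1, OF _ assms(2), unfolded One_nat_def], of f x] assms(1,3)
  by (simp add: numeral_2_eq_2)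

lemma continuous_on_second_deriv:
  assumes "Ck_on 2 S f" "open S"
  shows "continuous_on S (\<lambda>x. second_deriv f x a b)"
  unfolding second_deriv_def
  using Ck_on_SucD(2)[OF Ck_on_SucD(2)[of 1, OF _ assms(2), unfolded One_nat_def] assms(2), of f] assms(1)
  by (simp add: numeral_2_eq_2)

text \<open>Restriction of \<open>f\<close> to the affine plane \<open>x + s a + h b\<close> reduces
  the symmetry to functions of two real variables.\<close>

lemma second_deriv_commute:
  assumes f: "Ck_on 2 S f" and S: "open S" "x \<in> S"
  shows "second_deriv f x a b = second_deriv f x b a"
proof -
  let ?D = "\<lambda>y. frechet_derivative f (at y)"
  let ?p = "\<lambda>(s::real) (h::real). x + s *\<^sub>R a + h *\<^sub>R b"
  let ?S = "(\<lambda>(s, h). ?p s h) -` S"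
  have f1: "(f has_derivative ?D y) (at y)" if "y \<in> S" for y
    using Ck_on_SucD(1)[of 1 S f y] f that by (simp add: numeral_2_eq_2)
  have cp: "continuous_on T (\<lambda>(s, h). ?p s h)" for T
    by (auto simp: split_beta intro!: continuous_intros)
  have oS: "open ?S" "(0, 0) \<in> ?S"
    using S cp by (auto intro!: open_vimage)
  have ps: "((\<lambda>s. ?p s h) has_derivative (\<lambda>t. t *\<^sub>R a)) (at s)" for s h
    by (auto intro!: derivative_eq_intros)
  have ph: "((\<lambda>h. ?p s h) has_derivative (\<lambda>t. t *\<^sub>R b)) (at h)" for s h
    by (auto intro!: derivative_eq_intros)
  have lin: "?D y (t *\<^sub>R v) = t *\<^sub>R ?D y v" if "y \<in> S" for y t v
    using linear_scale[OF has_derivative_linear[OF f1[OF that]]] .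
  have d2: "((\<lambda>y. ?D y c) has_derivative (\<lambda>a. second_deriv f y a c)) (at y)" if "y \<in> S" for y c
    by (rule has_derivative_second_deriv[OF f S(1) that])
  have lin2: "second_deriv f y (t *\<^sub>R v) c = t *\<^sub>R second_deriv f y v c" if "y \<in> S" for y c t v
    using linear_scale[OF has_derivative_linear[OF d2[OF that]]] .
  have im: "(\<lambda>(s, h). ?p s h) ` ?S \<subseteq> S" by auto
  have "second_deriv f (?p 0 0) b a = second_deriv f (?p 0 0) a b"
  proof (rule mixed_partials_commute[where F = "\<lambda>s h. f (?p s h)" and Fs = "\<lambda>s h. ?D (?p s h) a"
        and Fh = "\<lambda>s h. ?D (?p s h) b" and Fsh = "\<lambda>s h. second_deriv f (?p s h) b a"
        and Fhs = "\<lambda>s h. second_deriv f (?p s h) a b", OF oS])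
    fix s h assume "(s, h) \<in> ?S"
    then have y: "?p s h \<in> S" by simp
    show "((\<lambda>s. f (?p s h)) has_vector_derivative ?D (?p s h) a) (at s)"
      using has_derivative_compose[OF ps f1[OF y]]
      by (simp add: has_vector_derivative_def lin[OF y])
    show "((\<lambda>h. f (?p s h)) has_vector_derivative ?D (?p s h) b) (at h)"
      using has_derivative_compose[OF ph f1[OF y]]
      by (simp add: has_vector_derivative_def lin[OF y])
    show "((\<lambda>h. ?D (?p s h) a) has_vector_derivative second_deriv f (?p s h) b a) (at h)"
      using has_derivative_compose[OF ph d2[OF y]]
      by (simp add: has_vector_derivative_def lin2[OF y])
    show "((\<lambda>s. ?D (?p s h) b) has_vector_derivative second_deriv f (?p s h) a b) (at s)"
      using has_derivative_compose[OF ps d2[OF y]]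
      by (simp add: has_vector_derivative_def lin2[OF y])
  next
    show "continuous_on ?S (\<lambda>(s, h). second_deriv f (?p s h) b a)"
      using continuous_on_compose2[OF continuous_on_second_deriv[OF f S(1)] cp im, of b a]
      by (simp add: split_beta)
    show "continuous_on ?S (\<lambda>(s, h). second_deriv f (?p s h) a b)"
      using continuous_on_compose2[OF continuous_on_second_deriv[OF f S(1)] cp im, of a b]
      by (simp add: split_beta)
  qed
  then show ?thesis by simp
qed

section \<open>Lipschitz bounds and uniqueness for total systems\<close>

lemma linear_expand_axis:
  fixes L :: "real^'n::finite \<Rightarrow> 'b::real_vector"
  assumes "linear L"
  shows "L v = (\<Sum>i\<in>UNIV. v $ i *\<^sub>R L (axis i 1))"
proof -
  have "L v = L (\<Sum>i\<in>UNIV. v $ i *\<^sub>R axis i 1)"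
    using basis_expansion[of v] by (simp add: scalar_mult_eq_scaleR)
  also have "\<dots> = (\<Sum>i\<in>UNIV. v $ i *\<^sub>R L (axis i 1))"
    using assms by (simp add: linear_sum linear_scale)
  finally show ?thesis .
qed

lemma norm_linear_le_axis:
  fixes L :: "real^'n::finite \<Rightarrow> 'b::real_normed_vector"
  assumes "linear L"
  shows "norm (L v) \<le> (\<Sum>i\<in>UNIV. norm (L (axis i 1))) * norm v"
proof -
  have "norm (L v) \<le> (\<Sum>i\<in>UNIV. norm (v $ i *\<^sub>R L (axis i 1)))"
    unfolding linear_expand_axis[OF assms, of v] by (rule norm_sum)
  also have "\<dots> \<le> (\<Sum>i\<in>UNIV. norm (L (axis i 1)) * norm v)"
  proof (rule sum_mono)
    show "norm (v $ i *\<^sub>R L (axis i 1)) \<le> norm (L (axis i 1)) * norm v" for i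
      using mult_left_mono[OF component_le_norm_cart[of v i] norm_ge_zero[of "L (axis i 1)"]]
      by (simp add: mult.commute)
  qed
  finally show ?thesis by (simp add: sum_distrib_right)
qed

text \<open>The operator norm of the derivative is dominated by the sum of the norms of its columns.
  That sum is continuous, hence below its value at \<open>q\<close> plus 1 near
  \<open>q\<close>.\<close>

lemma Ck_on_locally_lipschitz:
  fixes f :: "real^'n::finite \<Rightarrow> 'b::real_normed_vector"
  assumes f: "Ck_on 1 S f" and S: "open S" "q \<in> S"
  obtains d C where "d > 0" "C \<ge> 0" "ball q d \<subseteq> S"
    "\<And>x y. x \<in> ball q d \<Longrightarrow> y \<in> ball q d \<Longrightarrow> norm (f x - f y) \<le> C * norm (x - y)"
proof -
  let ?D = "\<lambda>y. frechet_derivative f (at y)"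
  let ?N = "\<lambda>x. \<Sum>i\<in>UNIV. norm (?D x (axis i 1))"
  have f1: "(f has_derivative ?D y) (at y)" if "y \<in> S" for y
    using Ck_on_SucD(1)[of 0 S f y] f that by simp
  have "continuous_on S (\<lambda>x. ?D x v)" for v
    using Ck_on_SucD(2)[of 0 S f] f S by simp
  then have "continuous_on S ?N" by (intro continuous_intros)
  from continuous_on_ballD[OF this S zero_less_one] obtain d where d: "d > 0" "ball q d \<subseteq> S"
    "\<And>y. y \<in> ball q d \<Longrightarrow> dist (?N y) (?N q) < 1" by blast
  show thesis
  proof (rule that[OF d(1) _ d(2)])
    show "?N q + 1 \<ge> 0" by (simp add: sum_nonneg add_nonneg_nonneg)
    fix x y assume xy: "x \<in> ball q d" "y \<in> ball q d"
    show "norm (f x - f y) \<le> (?N q + 1) * norm (x - y)"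
    proof (rule differentiable_bound[OF convex_ball _ _ xy])
      fix z assume z: "z \<in> ball q d"
      show "(f has_derivative ?D z) (at z within ball q d)"
        using f1 d(2) z by (blast intro: has_derivative_at_withinI)
      have "norm (?D z v) \<le> (?N q + 1) * norm v" for v
      proof -
        have "norm (?D z v) \<le> ?N z * norm v"
          using f1 d(2) z by (blast intro: norm_linear_le_axis has_derivative_linear)
        also have "\<dots> \<le> (?N q + 1) * norm v"
          using d(3)[OF z] by (intro mult_right_mono) (auto simp: dist_real_def)
        finally show ?thesis .
      qed
      then show "onorm (?D z) \<le> ?N q + 1" by (intro onorm_le)
    qed
  qed
qed

text \<open>A Gronwall argument without integration: if \<open>m\<close> maximizes
  \<open>norm (z x)\<close> on a small closed ball, the mean value inequality gives
  \<open>norm (z m) \<le> norm (z m) / 2\<close>.\<close>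

lemma linear_total_system_unique:
  fixes z :: "'a::euclidean_space \<Rightarrow> 'b::real_normed_vector"
  assumes d: "d > 0" and z: "\<And>x. x \<in> ball q d \<Longrightarrow> (z has_derivative z' x) (at x)"
    and bound: "\<And>x v. x \<in> ball q d \<Longrightarrow> norm (z' x v) \<le> C * norm (z x) * norm v"
    and z0: "z q = 0"
  obtains r where "r > 0" "r \<le> d" "\<And>x. x \<in> ball q r \<Longrightarrow> z x = 0"
proof -
  \<comment> \<open>Small enough for \<open>\<bar>C\<bar> * r \<le> 1/2\<close>; the sign of
    \<open>C\<close> is unrestricted, hence the absolute value, and the added 1 covers
    \<open>C = 0\<close>.\<close>
  define r where "r = min (d/2) (1 / (2 * (\<bar>C\<bar> + 1)))"
  have r: "r > 0" "r < d" "\<bar>C\<bar> * r \<le> 1/2"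
  proof -
    have "\<bar>C\<bar> * r \<le> \<bar>C\<bar> * (1 / (2 * (\<bar>C\<bar> + 1)))"
      unfolding r_def by (intro mult_left_mono) auto
    also have "\<dots> \<le> 1/2" by (simp add: field_simps)
    finally show "\<bar>C\<bar> * r \<le> 1/2" .
  qed (use d in \<open>auto simp: r_def min_less_iff_disj\<close>)
  have sub: "cball q r \<subseteq> ball q d" using r by auto
  have "continuous_on (cball q r) (\<lambda>x. norm (z x))"
    using z sub by (intro continuous_on_norm continuous_at_imp_continuous_on ballI)
      (metis has_derivative_continuous subsetD)
  from continuous_attains_sup[OF compact_cball _ this] r(1) obtain m where m: "m \<in> cball q r"
    "\<And>x. x \<in> cball q r \<Longrightarrow> norm (z x) \<le> norm (z m)" by auto
  have "norm (z m - z q) \<le> (\<bar>C\<bar> * norm (z m)) * norm (m - q)"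
  proof (rule differentiable_bound[OF convex_cball _ _ m(1)])
    fix x assume x: "x \<in> cball q r"
    then have xd: "x \<in> ball q d" using sub by blast
    show "(z has_derivative z' x) (at x within cball q r)"
      using z[OF xd] by (rule has_derivative_at_withinI)
    show "onorm (z' x) \<le> \<bar>C\<bar> * norm (z m)"
    proof (rule onorm_le)
      fix v
      have "norm (z' x v) \<le> C * norm (z x) * norm v" by (rule bound[OF xd])
      also have "\<dots> \<le> \<bar>C\<bar> * norm (z m) * norm v"
        using m(2)[OF x] by (intro mult_right_mono mult_mono) auto
      finally show "norm (z' x v) \<le> \<bar>C\<bar> * norm (z m) * norm v" .
    qed
  qed (use r(1) in auto)
  also have "\<dots> \<le> (\<bar>C\<bar> * norm (z m)) * r"
    using m(1) by (intro mult_left_mono) (auto simp: dist_norm norm_minus_commute)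
  also have "\<dots> \<le> 1/2 * norm (z m)"
    using mult_right_mono[OF r(3) norm_ge_zero[of "z m"]] by (simp add: mult_ac)
  finally have "norm (z m) \<le> 0" using z0 by simp
  then have "z x = 0" if "x \<in> ball q r" for x
    using m(2)[of x] that by (auto dest: order_trans)
  then show thesis using that r by fastforce
qed

section \<open>Local Riemannian geometry\<close>

lemma bilin_expand: "bilin A u v = (\<Sum>i\<in>UNIV. \<Sum>j\<in>UNIV. u $ i * A $ i $ j * v $ j)"
  by (simp add: bilin_def inner_vec_def matrix_vector_mult_def sum_distrib_left mult.assoc)

lemma bilin_add_left: "bilin A (u + v) w = bilin A u w + bilin A v w"
  and bilin_diff_left: "bilin A (u - v) w = bilin A u w - bilin A v w"
  and bilin_scaleR_left: "bilin A (c *\<^sub>R u) w = c * bilin A u w"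
  and bilin_minus_left: "bilin A (- u) w = - bilin A u w"
  and bilin_zero_left: "bilin A 0 w = 0"
  by (simp_all add: bilin_def inner_add_left inner_diff_left)

lemma bilin_add_right: "bilin A w (u + v) = bilin A w u + bilin A w v"
  and bilin_diff_right: "bilin A w (u - v) = bilin A w u - bilin A w v"
  and bilin_scaleR_right: "bilin A w (c *\<^sub>R u) = c * bilin A w u"
  and bilin_minus_right: "bilin A w (- u) = - bilin A w u"
  and bilin_zero_right: "bilin A w 0 = 0"
  by (simp_all add: bilin_expand algebra_simps sum.distrib sum_subtractf sum_distrib_left sum_negf)

lemma bilin_sum_right: "bilin A w (\<Sum>i\<in>I. f i) = (\<Sum>i\<in>I. bilin A w (f i))"
  by (induction I rule: infinite_finite_induct) (simp_all add: bilin_zero_right bilin_add_right)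

lemmas bilin_linear = bilin_add_left bilin_diff_left bilin_scaleR_left bilin_minus_left bilin_zero_left
  bilin_add_right bilin_diff_right bilin_scaleR_right bilin_minus_right bilin_zero_right

lemma bilin_commute:
  assumes "transpose A = A"
  shows "bilin A u v = bilin A v u"
proof -
  have "A $ i $ j = A $ j $ i" for i j
    using arg_cong[OF assms, of "\<lambda>B. B $ j $ i"] by (simp add: transpose_def)
  then show ?thesis
    unfolding bilin_expand by (subst sum.swap) (simp add: mult_ac)
qed

lemma bounded_bilinear_matrix_vector_mult:
  "bounded_bilinear (\<lambda>(A::real^'n^'m) v. A *v v)"
  unfolding bilinear_conv_bounded_bilinear[symmetric] bilinear_def
  by (auto intro!: linearI simp: matrix_vector_mult_add_rdistrib matrix_vector_right_distrib
      scaleR_matrix_vector_assoc vec_eq_iff matrix_vector_mult_def sum_distrib_left mult_ac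
      distrib_left distrib_right sum.distrib)

lemma has_derivative_bilin:
  assumes "(M has_derivative M') F" "(a has_derivative a') F" "(b has_derivative b') F"
    and "F = at x within S"
  shows "((\<lambda>x. bilin (M x) (a x) (b x)) has_derivative
    (\<lambda>h. bilin (M' h) (a x) (b x) + bilin (M x) (a' h) (b x) + bilin (M x) (a x) (b' h))) F"
  using has_derivative_inner[OF assms(2)[unfolded assms(4)]
      bounded_bilinear.FDERIV[OF bounded_bilinear_matrix_vector_mult assms(1,3)[unfolded assms(4)]]]
  by (simp add: bilin_def assms(4) inner_add_right add.commute add.left_commute)

lemma tendsto_bilin:
  assumes "(M \<longlongrightarrow> M0) F" "(a \<longlongrightarrow> a0) F" "(b \<longlongrightarrow> b0) F"
  shows "((\<lambda>x. bilin (M x) (a x) (b x)) \<longlongrightarrow> bilin M0 a0 b0) F"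
  unfolding bilin_expand using assms by (intro tendsto_intros)

lemma has_derivative_vec_componentwise:
  fixes f :: "'a::real_normed_vector \<Rightarrow> 'b::euclidean_space^'n::finite"
  assumes "\<And>i. ((\<lambda>x. f x $ i) has_derivative (\<lambda>h. f' h $ i)) (at x within S)"
  shows "(f has_derivative f') (at x within S)"
  unfolding has_derivative_componentwise_within[of f]
  using assms by (auto simp: Basis_vec_def inner_axis intro: has_derivative_inner_left)

lemma matrix_inv_right:
  fixes A :: "real^'n^'n"
  assumes "det A \<noteq> 0"
  shows "A ** matrix_inv A = mat 1"
  using assms unfolding invertible_det_nz[symmetric] invertible_def matrix_inv_def
  by (metis (mono_tags, lifting) someI_ex)

text \<open>Cramer's rule makes each entry of the inverse a quotient of determinants, through which
  C^k regularity passes to the Christoffel symbols.\<close>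

lemma matrix_inv_cramer:
  fixes A :: "real^'n::finite^'n"
  assumes "det A \<noteq> 0"
  shows "matrix_inv A $ l $ m = det (\<chi> i j. if j = l then axis m 1 $ i else A $ i $ j) / det A"
proof -
  have "A *v (matrix_inv A *v axis m 1) = axis m 1"
    by (simp add: matrix_vector_mul_assoc matrix_inv_right[OF assms])
  then have "matrix_inv A *v axis m 1
      = (\<chi> k. det (\<chi> i j. if j = k then axis m 1 $ i else A $ i $ j) / det A)"
    using cramer[OF assms] by blast
  moreover have "(matrix_inv A *v axis m 1) $ l = matrix_inv A $ l $ m"
    by (simp add: matrix_vector_mult_basis column_def)
  ultimately show ?thesis by simp
qed

lemma Ck_on_det:
  fixes M :: "'a::real_normed_vector \<Rightarrow> real^'n::finite^'n"
  assumes "\<And>i j. Ck_on k S (\<lambda>x. M x $ i $ j)"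
  shows "Ck_on k S (\<lambda>x. det (M x))"
  unfolding det_def by (intro Ck_on_sum Ck_on_mult Ck_on_const Ck_on_prod assms)

lemma Ck_on_matrix_inv:
  fixes M :: "'a::real_normed_vector \<Rightarrow> real^'n::finite^'n"
  assumes "\<And>i j. Ck_on k S (\<lambda>x. M x $ i $ j)" "open S" "\<And>x. x \<in> S \<Longrightarrow> det (M x) \<noteq> 0"
  shows "Ck_on k S (\<lambda>x. matrix_inv (M x) $ l $ m)"
proof (rule Ck_on_cong)
  have "Ck_on k S (\<lambda>x. det (\<chi> i j. if j = l then axis m 1 $ i else M x $ i $ j))"
  proof (rule Ck_on_det)
    show "Ck_on k S (\<lambda>x. (\<chi> i j. if j = l then axis m 1 $ i else M x $ i $ j) $ i $ j)" for i j
      by (cases "j = l") (simp_all add: assms(1) Ck_on_const)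
  qed
  then show "Ck_on k S (\<lambda>x. det (\<chi> i j. if j = l then axis m 1 $ i else M x $ i $ j) * inverse (det (M x)))"
    using Ck_on_inverse[OF Ck_on_det[of k S M, OF assms(1)] assms(3)] by (rule Ck_on_mult)
qed (use assms(2,3) in \<open>simp_all add: matrix_inv_cramer divide_inverse\<close>)

text \<open>\<open>gam\<close> is the Christoffel term \<open>\<Gamma>(u, v)\<close>, so that \<open>\<nabla>\<^sub>u Y = DY u + \<Gamma>(u, Y)\<close>; \<open>dgam\<close>
  differentiates only its coefficients, in the direction \<open>w\<close>.\<close>

definition gam :: "(real^'n::finite \<Rightarrow> real^'n^'n) \<Rightarrow> real^'n \<Rightarrow> real^'n \<Rightarrow> real^'n \<Rightarrow> real^'n" where
  "gam G x u v = (\<chi> l. \<Sum>i\<in>UNIV. \<Sum>j\<in>UNIV. christoffel G l i j x * (u $ i * v $ j))"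

definition dgam :: "(real^'n::finite \<Rightarrow> real^'n^'n) \<Rightarrow> real^'n \<Rightarrow> real^'n \<Rightarrow> real^'n \<Rightarrow> real^'n \<Rightarrow> real^'n" where
  "dgam G x w u v = (\<chi> l. \<Sum>i\<in>UNIV. \<Sum>j\<in>UNIV.
    frechet_derivative (christoffel G l i j) (at x) w * (u $ i * v $ j))"

lemma gam_add_left: "gam G x (u + v) w = gam G x u w + gam G x v w"
  and gam_diff_left: "gam G x (u - v) w = gam G x u w - gam G x v w"
  and gam_scaleR_left: "gam G x (c *\<^sub>R u) w = c *\<^sub>R gam G x u w"
  and gam_add_right: "gam G x w (u + v) = gam G x w u + gam G x w v"
  and gam_diff_right: "gam G x w (u - v) = gam G x w u - gam G x w v"
  and gam_scaleR_right: "gam G x w (c *\<^sub>R u) = c *\<^sub>R gam G x w u"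
  by (simp_all add: gam_def vec_eq_iff algebra_simps sum.distrib sum_subtractf sum_distrib_left)

text \<open>The metric as read in a single chart, with \<open>U\<close> the image of the
  chart.\<close>

locale local_metric =
  fixes U :: "(real^'n::finite) set" and G :: "real^'n \<Rightarrow> real^'n^'n"
  assumes open_U: "open U" and G_Ck: "\<And>k. Ck_on k U G"
    and G_transpose: "\<And>x. x \<in> U \<Longrightarrow> transpose (G x) = G x"
    and G_pos: "\<And>x u. x \<in> U \<Longrightarrow> u \<noteq> 0 \<Longrightarrow> bilin (G x) u u > 0"
begin

abbreviation "dG x \<equiv> frechet_derivative G (at x)"

lemma G_sym: "x \<in> U \<Longrightarrow> bilin (G x) u v = bilin (G x) v u"
  using bilin_commute G_transpose by blast

lemma G_nondegenerate: "x \<in> U \<Longrightarrow> (\<And>v. bilin (G x) u v = 0) \<Longrightarrow> u = 0"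
  using G_pos by (metis less_irrefl)

lemma det_G: "x \<in> U \<Longrightarrow> det (G x) \<noteq> 0"
proof -
  assume x: "x \<in> U"
  have "v = 0" if "G x *v v = 0" for v
    using G_pos[OF x, of v] that by (auto simp: bilin_def)
  then show ?thesis
    unfolding invertible_det_nz[symmetric] invertible_left_inverse matrix_left_invertible_ker by blast
qed

lemma has_derivative_G: "x \<in> U \<Longrightarrow> (G has_derivative dG x) (at x)"
  using Ck_on_SucD(1)[OF G_Ck] .

lemma linear_dG: "x \<in> U \<Longrightarrow> linear (dG x)"
  using has_derivative_G has_derivative_linear by blast

lemma has_derivative_G_nth: "x \<in> U \<Longrightarrow> ((\<lambda>y. G y $ i $ j) has_derivative (\<lambda>w. dG x w $ i $ j)) (at x)"
  using has_derivative_G by (auto intro!: bounded_linear.has_derivative[OF bounded_linear_vec_nth])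

lemma partial_deriv_G: "x \<in> U \<Longrightarrow> partial_deriv k (\<lambda>y. G y $ i $ j) x = dG x (axis k 1) $ i $ j"
  unfolding partial_deriv_def by (subst frechet_derivative_at[OF has_derivative_G_nth, symmetric]) auto

lemma dG_sym_nth: "x \<in> U \<Longrightarrow> dG x w $ i $ j = dG x w $ j $ i"
proof -
  assume x: "x \<in> U"
  have eq: "G y $ i $ j = G y $ j $ i" if "y \<in> U" for y
    using arg_cong[OF G_transpose[OF that], of "\<lambda>B. B $ j $ i"] by (simp add: transpose_def)
  have "((\<lambda>y. G y $ j $ i) has_derivative (\<lambda>w. dG x w $ i $ j)) (at x)"
    by (rule has_derivative_transform_within_open[OF has_derivative_G_nth[OF x] open_U x eq])
  then show ?thesis
    using has_derivative_unique[OF _ has_derivative_G_nth[OF x, of j i]] by meson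
qed

lemma dG_sym: "x \<in> U \<Longrightarrow> bilin (dG x w) u v = bilin (dG x w) v u"
  by (intro bilin_commute) (simp add: vec_eq_iff transpose_def dG_sym_nth)

lemma dG_expand: "x \<in> U \<Longrightarrow> dG x w $ i $ j = (\<Sum>k\<in>UNIV. w $ k * dG x (axis k 1) $ i $ j)"
  using linear_expand_axis[OF linear_dG, of x w] by simp

lemma gam_commute: "x \<in> U \<Longrightarrow> gam G x u v = gam G x v u"
proof -
  assume x: "x \<in> U"
  have "christoffel G l i j x = christoffel G l j i x" for l i j
    unfolding christoffel_def using x by (simp add: partial_deriv_G dG_sym_nth[OF x, of _ i j] add.commute)
  then show ?thesis
    unfolding gam_def vec_eq_iff vec_lambda_beta
    by (subst sum.swap) (simp add: mult.commute[of "u $ _"])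
qed

text \<open>Multiplication by \<open>G x\<close> removes \<open>matrix_inv\<close> from the
  Christoffel symbols and leaves an identity free of coordinates, from which metric compatibility is
  read off.\<close>

lemma koszul:
  assumes x: "x \<in> U"
  shows "2 * bilin (G x) w (gam G x u v) = bilin (dG x u) v w + bilin (dG x v) u w - bilin (dG x w) u v"
proof -
  \<comment> \<open>The Christoffel symbols of the first kind, contracted with \<open>u\<close> and
    \<open>v\<close>: the covector that \<open>G x\<close> makes out of
    \<open>gam G x u v\<close>.\<close>
  define K where "K = (\<chi> m. (1/2) * (bilin (dG x u) v (axis m 1) + bilin (dG x v) u (axis m 1)
      - bilin (dG x (axis m 1)) u v))"
  have e1: "bilin (dG x a) b (axis m 1) = (\<Sum>i\<in>UNIV. \<Sum>j\<in>UNIV. dG x (axis i 1) $ j $ m * (a $ i * b $ j))" for a b m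
  proof -
    have "bilin (dG x a) b (axis m 1) = (\<Sum>j\<in>UNIV. b $ j * dG x a $ j $ m)"
      by (simp add: bilin_expand axis_def if_distrib cong: if_cong)
    also have "\<dots> = (\<Sum>j\<in>UNIV. \<Sum>i\<in>UNIV. dG x (axis i 1) $ j $ m * (a $ i * b $ j))"
      by (subst dG_expand[OF x]) (simp add: sum_distrib_left mult_ac)
    also have "\<dots> = (\<Sum>i\<in>UNIV. \<Sum>j\<in>UNIV. dG x (axis i 1) $ j $ m * (a $ i * b $ j))"
      by (rule sum.swap)
    finally show ?thesis .
  qed
  have K: "K $ m = (\<Sum>i\<in>UNIV. \<Sum>j\<in>UNIV. (1/2) * (dG x (axis i 1) $ j $ m + dG x (axis j 1) $ i $ m
      - dG x (axis m 1) $ i $ j) * (u $ i * v $ j))" for m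
  proof -
    have e2: "bilin (dG x v) u (axis m 1) = (\<Sum>i\<in>UNIV. \<Sum>j\<in>UNIV. dG x (axis j 1) $ i $ m * (u $ i * v $ j))"
      unfolding e1 by (subst sum.swap) (simp add: mult_ac)
    have e3: "bilin (dG x (axis m 1)) u v = (\<Sum>i\<in>UNIV. \<Sum>j\<in>UNIV. dG x (axis m 1) $ i $ j * (u $ i * v $ j))"
      unfolding bilin_expand by (simp add: mult_ac)
    show ?thesis
      unfolding K_def vec_lambda_beta e1[of u v] e2 e3 sum.distrib[symmetric] sum_subtractf[symmetric]
        sum_distrib_left by (intro sum.cong refl) (simp add: algebra_simps)
  qed
  have "gam G x u v = matrix_inv (G x) *v K"
  proof (rule vec_eq_iff[THEN iffD2], rule allI)
    fix l
    have "(matrix_inv (G x) *v K) $ l = (\<Sum>m\<in>UNIV. \<Sum>i\<in>UNIV. \<Sum>j\<in>UNIV. matrix_inv (G x) $ l $ m *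
      ((1/2) * (dG x (axis i 1) $ j $ m + dG x (axis j 1) $ i $ m - dG x (axis m 1) $ i $ j) * (u $ i * v $ j)))"
      by (simp add: matrix_vector_mult_def K sum_distrib_left)
    also have "\<dots> = (\<Sum>i\<in>UNIV. \<Sum>j\<in>UNIV. \<Sum>m\<in>UNIV. matrix_inv (G x) $ l $ m *
      ((1/2) * (dG x (axis i 1) $ j $ m + dG x (axis j 1) $ i $ m - dG x (axis m 1) $ i $ j) * (u $ i * v $ j)))"
      by (subst sum.swap, rule sum.cong[OF refl], rule sum.swap)
    also have "\<dots> = gam G x u v $ l"
      unfolding gam_def christoffel_def vec_lambda_beta sum_distrib_left sum_distrib_right
      by (intro sum.cong refl) (simp add: partial_deriv_G[OF x])
    finally show "gam G x u v $ l = (matrix_inv (G x) *v K) $ l" by simp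
  qed
  then have "G x *v gam G x u v = K"
    by (simp add: matrix_vector_mul_assoc matrix_inv_right[OF det_G[OF x]])
  then have "2 * bilin (G x) w (gam G x u v) = 2 * (\<Sum>m\<in>UNIV. w $ m * K $ m)"
    by (simp add: bilin_def inner_vec_def)
  also have "\<dots> = (\<Sum>m\<in>UNIV. w $ m * bilin (dG x u) v (axis m 1)) + (\<Sum>m\<in>UNIV. w $ m * bilin (dG x v) u (axis m 1))
      - (\<Sum>m\<in>UNIV. w $ m * bilin (dG x (axis m 1)) u v)"
    unfolding K_def vec_lambda_beta sum_distrib_left sum.distrib[symmetric] sum_subtractf[symmetric]
    by (intro sum.cong refl) (simp add: algebra_simps)
  also have "(\<Sum>m\<in>UNIV. w $ m * bilin (dG x u) v (axis m 1)) = bilin (dG x u) v w"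
    by (simp add: bilin_scaleR_right[symmetric] bilin_sum_right[symmetric] basis_expansion[of w, unfolded scalar_mult_eq_scaleR])
  also have "(\<Sum>m\<in>UNIV. w $ m * bilin (dG x v) u (axis m 1)) = bilin (dG x v) u w"
    by (simp add: bilin_scaleR_right[symmetric] bilin_sum_right[symmetric] basis_expansion[of w, unfolded scalar_mult_eq_scaleR])
  also have "(\<Sum>m\<in>UNIV. w $ m * bilin (dG x (axis m 1)) u v) = bilin (dG x w) u v"
  proof -
    have "bilin (dG x w) u v = (\<Sum>i\<in>UNIV. \<Sum>j\<in>UNIV. \<Sum>m\<in>UNIV. w $ m * (u $ i * dG x (axis m 1) $ i $ j * v $ j))"
      unfolding bilin_expand dG_expand[OF x, of w] sum_distrib_left sum_distrib_right
      by (intro sum.cong refl) (simp add: mult_ac)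
    also have "\<dots> = (\<Sum>i\<in>UNIV. \<Sum>m\<in>UNIV. \<Sum>j\<in>UNIV. w $ m * (u $ i * dG x (axis m 1) $ i $ j * v $ j))"
      by (rule sum.cong[OF refl], rule sum.swap)
    also have "\<dots> = (\<Sum>m\<in>UNIV. \<Sum>i\<in>UNIV. \<Sum>j\<in>UNIV. w $ m * (u $ i * dG x (axis m 1) $ i $ j * v $ j))"
      by (rule sum.swap)
    finally show ?thesis by (simp add: bilin_expand sum_distrib_left)
  qed
  finally show ?thesis .
qed

lemma metric_compatible:
  assumes x: "x \<in> U"
  shows "bilin (dG x w) u v = bilin (G x) (gam G x w u) v + bilin (G x) u (gam G x w v)"
proof -
  have "2 * bilin (G x) (gam G x w u) v + 2 * bilin (G x) u (gam G x w v) = 2 * bilin (dG x w) u v"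
    unfolding G_sym[OF x, of _ v] koszul[OF x] using dG_sym[OF x] by (simp add: algebra_simps)
  then show ?thesis by simp
qed

lemma Ck_on_dG: "Ck_on k U (\<lambda>x. dG x w)"
  using Ck_on_SucD(2)[OF G_Ck open_U] .

lemma Ck_on_nth: "Ck_on k S (f :: _ \<Rightarrow> 'b::real_normed_vector^'n) \<Longrightarrow> Ck_on k S (\<lambda>x. f x $ i)"
  by (rule Ck_on_bounded_linear[OF bounded_linear_vec_nth])

lemma Ck_on_christoffel: "Ck_on k U (christoffel G l i j)"
proof (rule Ck_on_cong[OF _ open_U])
  show "Ck_on k U (\<lambda>x. (1/2) * (\<Sum>m\<in>UNIV. matrix_inv (G x) $ l $ m *
    (dG x (axis i 1) $ j $ m + dG x (axis j 1) $ i $ m - dG x (axis m 1) $ i $ j)))"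
    by (intro Ck_on_mult Ck_on_sum Ck_on_add Ck_on_diff Ck_on_const Ck_on_nth Ck_on_dG
        Ck_on_matrix_inv open_U det_G G_Ck)
qed (simp add: christoffel_def partial_deriv_G)

lemma has_derivative_christoffel:
  "x \<in> U \<Longrightarrow> (christoffel G l i j has_derivative frechet_derivative (christoffel G l i j) (at x)) (at x)"
  using Ck_on_SucD(1)[OF Ck_on_christoffel] .

lemma continuous_on_partial_christoffel: "continuous_on U (\<lambda>x. partial_deriv m (christoffel G l i j) x)"
  unfolding partial_deriv_def
  by (rule Ck_on_imp_continuous_on, rule Ck_on_SucD(2)[OF Ck_on_christoffel open_U])

lemma has_derivative_gam:
  assumes x: "x \<in> U" and a: "(a has_derivative a') (at x)" and b: "(b has_derivative b') (at x)"
  shows "((\<lambda>y. gam G y (a y) (b y)) has_derivative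
    (\<lambda>w. dgam G x w (a x) (b x) + gam G x (a' w) (b x) + gam G x (a x) (b' w))) (at x)"
proof (rule has_derivative_vec_componentwise)
  fix l
  have nth: "((\<lambda>x. a x $ i) has_derivative (\<lambda>h. a' h $ i)) (at x)"
    "((\<lambda>x. b x $ i) has_derivative (\<lambda>h. b' h $ i)) (at x)" for i
    using a b by (auto intro: bounded_linear.has_derivative[OF bounded_linear_vec_nth])
  have "((\<lambda>y. \<Sum>i\<in>UNIV. \<Sum>j\<in>UNIV. christoffel G l i j y * (a y $ i * b y $ j)) has_derivative
     (\<lambda>w. \<Sum>i\<in>UNIV. \<Sum>j\<in>UNIV. christoffel G l i j x * (a x $ i * b' w $ j + a' w $ i * b x $ j)
        + frechet_derivative (christoffel G l i j) (at x) w * (a x $ i * b x $ j))) (at x)"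
    by (intro has_derivative_sum has_derivative_mult has_derivative_christoffel x nth)
  then show "((\<lambda>y. gam G y (a y) (b y) $ l) has_derivative
     (\<lambda>w. (dgam G x w (a x) (b x) + gam G x (a' w) (b x) + gam G x (a x) (b' w)) $ l)) (at x)"
    unfolding gam_def dgam_def by (simp add: sum.distrib algebra_simps)
qed

text \<open>This is the shape in which curvature comes out when covariant derivatives are
  differentiated again. The work lies in bringing the nested sums into one order of indices.\<close>

lemma riemann_curv_eq:
  assumes x: "x \<in> U"
  shows "riemann_curv G x u v w = dgam G x u v w - dgam G x v u w
    + gam G x u (gam G x v w) - gam G x v (gam G x u w)"
proof (rule vec_eq_iff[THEN iffD2], rule allI)
  fix l
  let ?\<Gamma> = "\<lambda>l i j. christoffel G l i j x"
  have dexp: "frechet_derivative (christoffel G l j k) (at x) w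
      = (\<Sum>i\<in>UNIV. w $ i * partial_deriv i (christoffel G l j k) x)" for l j k w
  proof -
    let ?D = "frechet_derivative (christoffel G l j k) (at x)"
    have lin: "linear ?D"
      using has_derivative_christoffel[OF x] has_derivative_linear by blast
    show ?thesis
      using linear_expand_axis[OF lin, of w] by (simp add: partial_deriv_def)
  qed
  have d1: "dgam G x u v w $ l = (\<Sum>i\<in>UNIV. \<Sum>j\<in>UNIV. \<Sum>k\<in>UNIV.
      partial_deriv i (christoffel G l j k) x * (u $ i * v $ j * w $ k))" for u v w
  proof -
    have "dgam G x u v w $ l = (\<Sum>j\<in>UNIV. \<Sum>k\<in>UNIV. \<Sum>i\<in>UNIV.
      partial_deriv i (christoffel G l j k) x * (u $ i * v $ j * w $ k))"
      unfolding dgam_def by (simp add: dexp sum_distrib_left sum_distrib_right mult_ac)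
    also have "\<dots> = (\<Sum>j\<in>UNIV. \<Sum>i\<in>UNIV. \<Sum>k\<in>UNIV.
      partial_deriv i (christoffel G l j k) x * (u $ i * v $ j * w $ k))"
      by (rule sum.cong[OF refl], rule sum.swap)
    also have "\<dots> = (\<Sum>i\<in>UNIV. \<Sum>j\<in>UNIV. \<Sum>k\<in>UNIV.
      partial_deriv i (christoffel G l j k) x * (u $ i * v $ j * w $ k))"
      by (rule sum.swap)
    finally show ?thesis .
  qed
  have d2: "dgam G x v u w $ l = (\<Sum>i\<in>UNIV. \<Sum>j\<in>UNIV. \<Sum>k\<in>UNIV.
      partial_deriv j (christoffel G l i k) x * (u $ i * v $ j * w $ k))"
    unfolding d1 by (subst sum.swap) (simp add: mult_ac)
  have g1: "gam G x u (gam G x v w) $ l = (\<Sum>i\<in>UNIV. \<Sum>j\<in>UNIV. \<Sum>k\<in>UNIV. \<Sum>m\<in>UNIV.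
      ?\<Gamma> l i m * ?\<Gamma> m j k * (u $ i * v $ j * w $ k))" for u v w
  proof -
    have "gam G x u (gam G x v w) $ l = (\<Sum>i\<in>UNIV. \<Sum>m\<in>UNIV. \<Sum>j\<in>UNIV. \<Sum>k\<in>UNIV.
      ?\<Gamma> l i m * ?\<Gamma> m j k * (u $ i * v $ j * w $ k))"
      unfolding gam_def by (simp add: sum_distrib_left mult_ac)
    also have "\<dots> = (\<Sum>i\<in>UNIV. \<Sum>j\<in>UNIV. \<Sum>m\<in>UNIV. \<Sum>k\<in>UNIV.
      ?\<Gamma> l i m * ?\<Gamma> m j k * (u $ i * v $ j * w $ k))"
      by (rule sum.cong[OF refl], rule sum.swap)
    also have "\<dots> = (\<Sum>i\<in>UNIV. \<Sum>j\<in>UNIV. \<Sum>k\<in>UNIV. \<Sum>m\<in>UNIV.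
      ?\<Gamma> l i m * ?\<Gamma> m j k * (u $ i * v $ j * w $ k))"
      by (rule sum.cong[OF refl], rule sum.cong[OF refl], rule sum.swap)
    finally show ?thesis .
  qed
  have g2: "gam G x v (gam G x u w) $ l = (\<Sum>i\<in>UNIV. \<Sum>j\<in>UNIV. \<Sum>k\<in>UNIV. \<Sum>m\<in>UNIV.
      ?\<Gamma> l j m * ?\<Gamma> m i k * (u $ i * v $ j * w $ k))"
    unfolding g1 by (subst sum.swap) (simp add: mult_ac)
  show "riemann_curv G x u v w $ l = (dgam G x u v w - dgam G x v u w
    + gam G x u (gam G x v w) - gam G x v (gam G x u w)) $ l"
    unfolding vector_add_component vector_minus_component d1[of u v w] d2 g1[of u v w] g2
      riemann_curv_def curv_coeff_def vec_lambda_beta sum.distrib[symmetric] sum_subtractf[symmetric]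
  proof (intro sum.cong refl, goal_cases)
    case (1 i j k)
    have "(a - b + (\<Sum>m\<in>UNIV. p m - q m)) * c * d * e = a * (c * d * e) - b * (c * d * e)
      + (\<Sum>m\<in>UNIV. p m * (c * d * e)) - (\<Sum>m\<in>UNIV. q m * (c * d * e))" for p q :: "'n \<Rightarrow> real" and a b c d e
      unfolding sum_subtractf sum_distrib_right[of p UNIV "c * d * e", symmetric]
        sum_distrib_right[of q UNIV "c * d * e", symmetric] by (simp add: algebra_simps)
    then show ?case .
  qed
qed

text \<open>The hypothesis \<open>nz\<close> says that the limit vectors span a nondegenerate plane,
  so the denominator stays away from zero.\<close>

lemma tendsto_sectional_curv:
  assumes "x \<in> U" "(X \<longlongrightarrow> x) F" "(a \<longlongrightarrow> u) F" "(b \<longlongrightarrow> v) F"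
    and nz: "bilin (G x) u u * bilin (G x) v v - (bilin (G x) u v)\<^sup>2 \<noteq> 0"
  shows "((\<lambda>n. sectional_curv G (X n) (a n) (b n)) \<longlongrightarrow> sectional_curv G x u v) F"
proof -
  have iC: "isCont f x" if "continuous_on U f" for f :: "real^'n \<Rightarrow> 'b::topological_space"
    using that open_U assms(1) continuous_on_eq_continuous_at by blast
  have G: "((\<lambda>n. G (X n)) \<longlongrightarrow> G x) F"
    using isCont_tendsto_compose[OF iC assms(2)] Ck_on_imp_continuous_on[OF G_Ck] by blast
  have c: "((\<lambda>n. christoffel G l i j (X n)) \<longlongrightarrow> christoffel G l i j x) F" for l i j
    using isCont_tendsto_compose[OF iC assms(2)] Ck_on_imp_continuous_on[OF Ck_on_christoffel] by blast
  have p: "((\<lambda>n. partial_deriv m (christoffel G l i j) (X n)) \<longlongrightarrow> partial_deriv m (christoffel G l i j) x) F" for m l i j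
    using isCont_tendsto_compose[OF iC[OF continuous_on_partial_christoffel] assms(2)] .
  have "((\<lambda>n. riemann_curv G (X n) (a n) (b n) (b n)) \<longlongrightarrow> riemann_curv G x u v v) F"
    unfolding riemann_curv_def curv_coeff_def by (intro tendsto_intros c p assms)
  then show ?thesis
    unfolding sectional_curv_def using nz by (intro tendsto_intros tendsto_bilin assms G)
qed

end

section \<open>Rigidity of isometries\<close>

lemma norm_bilinear_coeffs_le:
  fixes c :: "'n::finite \<Rightarrow> 'n \<Rightarrow> 'n \<Rightarrow> real"
  shows "norm (\<chi> l. \<Sum>i\<in>UNIV. \<Sum>j\<in>UNIV. c l i j * (a $ i * b $ j))
    \<le> (\<Sum>l\<in>UNIV. \<Sum>i\<in>UNIV. \<Sum>j\<in>UNIV. \<bar>c l i j\<bar>) * norm a * norm b" (is "norm ?v \<le> _")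
proof -
  have "norm ?v \<le> (\<Sum>l\<in>UNIV. \<bar>?v $ l\<bar>)" by (rule norm_le_l1_cart)
  also have "\<dots> \<le> (\<Sum>l\<in>UNIV. \<Sum>i\<in>UNIV. \<Sum>j\<in>UNIV. \<bar>c l i j\<bar> * (norm a * norm b))"
  proof (rule sum_mono)
    fix l
    have "\<bar>?v $ l\<bar> \<le> (\<Sum>i\<in>UNIV. \<bar>\<Sum>j\<in>UNIV. c l i j * (a $ i * b $ j)\<bar>)"
      by (simp add: sum_abs)
    also have "\<dots> \<le> (\<Sum>i\<in>UNIV. \<Sum>j\<in>UNIV. \<bar>c l i j * (a $ i * b $ j)\<bar>)"
      by (intro sum_mono sum_abs)
    also have "\<dots> \<le> (\<Sum>i\<in>UNIV. \<Sum>j\<in>UNIV. \<bar>c l i j\<bar> * (norm a * norm b))"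
      unfolding abs_mult
      by (intro sum_mono mult_left_mono mult_mono component_le_norm_cart) auto
    finally show "\<bar>?v $ l\<bar> \<le> (\<Sum>i\<in>UNIV. \<Sum>j\<in>UNIV. \<bar>c l i j\<bar> * (norm a * norm b))" .
  qed
  finally show ?thesis by (simp add: sum_distrib_right mult.assoc)
qed

context local_metric
begin

text \<open>There are finitely many Christoffel symbols, each C^1, so one radius and one constant
  can serve for all. \<open>C1\<close> collects the Lipschitz constants, \<open>C2\<close> the
  bounds on the values.\<close>

lemma gam_locally_lipschitz:
  assumes q: "q \<in> U"
  obtains d C where "d > 0" "C \<ge> 0" "ball q d \<subseteq> U"
    "\<And>x a b. x \<in> ball q d \<Longrightarrow> norm (gam G x a b) \<le> C * norm a * norm b"
    "\<And>x y a b. x \<in> ball q d \<Longrightarrow> y \<in> ball q d \<Longrightarrow>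
      norm (gam G x a b - gam G y a b) \<le> C * norm (x - y) * norm a * norm b"
proof -
  have "\<exists>d C. d > 0 \<and> C \<ge> 0 \<and> ball q d \<subseteq> U \<and> (\<forall>x\<in>ball q d. \<forall>y\<in>ball q d.
      \<bar>christoffel G l i j x - christoffel G l i j y\<bar> \<le> C * norm (x - y))" for l i j
    using Ck_on_locally_lipschitz[OF Ck_on_christoffel open_U q, of l i j] unfolding real_norm_def by metis
  then obtain d C where dC: "d l i j > 0" "C l i j \<ge> 0" "ball q (d l i j) \<subseteq> U"
    "\<And>x y. x \<in> ball q (d l i j) \<Longrightarrow> y \<in> ball q (d l i j) \<Longrightarrow>
      \<bar>christoffel G l i j x - christoffel G l i j y\<bar> \<le> C l i j * norm (x - y)" for l i j
    by metis
  define d0 where "d0 = Min (range (\<lambda>(l, i, j). d l i j))"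
  define C1 where "C1 = (\<Sum>l\<in>UNIV. \<Sum>i\<in>UNIV. \<Sum>j\<in>UNIV. C l i j)"
  define C2 where "C2 = (\<Sum>l\<in>UNIV. \<Sum>i\<in>UNIV. \<Sum>j\<in>UNIV. \<bar>christoffel G l i j q\<bar> + C l i j * d0)"
  have d0: "d0 > 0" "d0 \<le> d l i j" for l i j
  proof -
    show "d0 > 0" unfolding d0_def by (subst Min_gr_iff) (auto simp: dC(1))
    show "d0 \<le> d l i j" unfolding d0_def by (rule Min_le) (auto intro!: image_eqI[of _ _ "(l, i, j)"])
  qed
  have sub: "x \<in> ball q (d l i j)" if "x \<in> ball q d0" for x l i j
    using that d0(2)[of l i j] by auto
  have C1: "C1 \<ge> 0" unfolding C1_def by (intro sum_nonneg dC)
  have C2: "C2 \<ge> 0" unfolding C2_def using d0(1) dC(2) by (intro sum_nonneg add_nonneg_nonneg mult_nonneg_nonneg) auto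
  show thesis
  proof (rule that[OF d0(1), of "C1 + C2"])
    show "C1 + C2 \<ge> 0" using C1 C2 by simp
    show "ball q d0 \<subseteq> U" using sub dC(3) by blast
  next
    fix x a b :: "real^'n" assume x: "x \<in> ball q d0"
    have "(\<Sum>l\<in>UNIV. \<Sum>i\<in>UNIV. \<Sum>j\<in>UNIV. \<bar>christoffel G l i j x\<bar>) \<le> C2"
      unfolding C2_def
    proof (intro sum_mono)
      fix l i j
      have "\<bar>christoffel G l i j x\<bar> \<le> \<bar>christoffel G l i j q\<bar> + C l i j * norm (x - q)"
        using dC(4)[OF sub[OF x] , of q l i j] dC(1) by auto
      also have "\<dots> \<le> \<bar>christoffel G l i j q\<bar> + C l i j * d0"
        using x dC(2) by (intro add_left_mono mult_left_mono) (auto simp: dist_norm norm_minus_commute)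
      finally show "\<bar>christoffel G l i j x\<bar> \<le> \<bar>christoffel G l i j q\<bar> + C l i j * d0" .
    qed
    then have "(\<Sum>l\<in>UNIV. \<Sum>i\<in>UNIV. \<Sum>j\<in>UNIV. \<bar>christoffel G l i j x\<bar>) * norm a * norm b \<le> (C1 + C2) * norm a * norm b"
      using C1 by (intro mult_right_mono) auto
    then show "norm (gam G x a b) \<le> (C1 + C2) * norm a * norm b"
      using norm_bilinear_coeffs_le[of "\<lambda>l i j. christoffel G l i j x" a b] unfolding gam_def by linarith
  next
    fix x y a b :: "real^'n" assume xy: "x \<in> ball q d0" "y \<in> ball q d0"
    let ?c = "\<lambda>l i j. christoffel G l i j x - christoffel G l i j y"
    have "(\<Sum>l\<in>UNIV. \<Sum>i\<in>UNIV. \<Sum>j\<in>UNIV. \<bar>?c l i j\<bar>) \<le> C1 * norm (x - y)"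
      unfolding C1_def sum_distrib_right by (intro sum_mono dC(4) sub xy)
    also have "\<dots> \<le> (C1 + C2) * norm (x - y)" using C2 by (intro mult_right_mono) auto
    finally have "(\<Sum>l\<in>UNIV. \<Sum>i\<in>UNIV. \<Sum>j\<in>UNIV. \<bar>?c l i j\<bar>) * norm a * norm b \<le> (C1 + C2) * norm (x - y) * norm a * norm b"
      by (intro mult_right_mono) auto
    moreover have "gam G x a b - gam G y a b = (\<chi> l. \<Sum>i\<in>UNIV. \<Sum>j\<in>UNIV. ?c l i j * (a $ i * b $ j))"
      unfolding gam_def by (simp add: vec_eq_iff left_diff_distrib sum_subtractf)
    ultimately show "norm (gam G x a b - gam G y a b) \<le> (C1 + C2) * norm (x - y) * norm a * norm b"
      using norm_bilinear_coeffs_le[of ?c a b] by simp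
  qed
qed

text \<open>An isometry satisfies a closed second-order system, the transformation law of the Christoffel
  symbols: its defect \<open>B\<close> makes \<open>G(B w u, D v)\<close> symmetric in \<open>w, u\<close> and skew in \<open>u, v\<close>.\<close>

lemma isometry_second_deriv:
  assumes V: "open V" "V \<subseteq> U" and f: "\<And>k. Ck_on k V f" "f ` V \<subseteq> U" and x: "x \<in> V"
    and iso: "\<And>x u v. x \<in> V \<Longrightarrow> bilin (G (f x)) (frechet_derivative f (at x) u) (frechet_derivative f (at x) v)
      = bilin (G x) u v"
  shows "second_deriv f x w u = frechet_derivative f (at x) (gam G x w u)
    - gam G (f x) (frechet_derivative f (at x) w) (frechet_derivative f (at x) u)"
proof -
  let ?D = "\<lambda>x. frechet_derivative f (at x)"
  have f1: "(f has_derivative ?D x) (at x)"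
    using Ck_on_SucD(1)[OF f(1) x] .
  have d2: "((\<lambda>y. ?D y b) has_derivative (\<lambda>a. second_deriv f x a b)) (at x)" for b
    by (rule has_derivative_second_deriv[OF f(1) V(1) x])
  have sym: "second_deriv f x a b = second_deriv f x b a" for a b
    by (rule second_deriv_commute[OF f(1) V(1) x])
  have xU: "x \<in> U" and fU: "f x \<in> U" using V f x by auto
  define B where "B = (\<lambda>w u. second_deriv f x w u + gam G (f x) (?D x w) (?D x u) - ?D x (gam G x w u))"
  have B_sym: "B w u = B u w" for w u
    unfolding B_def using sym[of w u] gam_commute[OF fU, of "?D x w"] gam_commute[OF xU, of w] by simp
  define T where "T = (\<lambda>w u v. bilin (G (f x)) (B w u) (?D x v))"
  have T_sym: "T w u v = T u w v" for w u v by (simp add: T_def B_sym)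
  \<comment> \<open>The isometry equation is differentiated along \<open>w\<close>; metric
    compatibility at \<open>x\<close> and at \<open>f x\<close> then absorbs the derivatives of
    \<open>G\<close> into \<open>B\<close>.\<close>
  have T_skew: "T w u v + T w v u = 0" for w u v
  proof -
    have "((\<lambda>y. bilin (G (f y)) (?D y u) (?D y v)) has_derivative
      (\<lambda>w. bilin (dG (f x) (?D x w)) (?D x u) (?D x v) + bilin (G (f x)) (second_deriv f x w u) (?D x v)
        + bilin (G (f x)) (?D x u) (second_deriv f x w v))) (at x)"
      by (rule has_derivative_bilin[OF has_derivative_compose[OF f1 has_derivative_G[OF fU]] d2 d2 refl])
    moreover have "((\<lambda>y. bilin (G (f y)) (?D y u) (?D y v)) has_derivative
      (\<lambda>w. bilin (dG x w) u v + bilin (G x) 0 v + bilin (G x) u 0)) (at x)"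
      by (rule has_derivative_transform_within_open[OF has_derivative_bilin[OF has_derivative_G[OF xU]
            has_derivative_const has_derivative_const refl] V(1) x]) (simp add: iso)
    ultimately have "bilin (dG (f x) (?D x w)) (?D x u) (?D x v) + bilin (G (f x)) (second_deriv f x w u) (?D x v)
        + bilin (G (f x)) (?D x u) (second_deriv f x w v) = bilin (dG x w) u v"
      using has_derivative_unique by (fastforce simp: bilin_linear dest: fun_cong[of _ _ w])
    then show ?thesis
      unfolding T_def B_def metric_compatible[OF fU] metric_compatible[OF xU]
      by (simp add: bilin_linear iso[OF x, symmetric] G_sym[OF fU, of "?D x u"])
  qed
  \<comment> \<open>Alternating the skew and the symmetric exchange three times returns to the same
    arguments with the opposite sign.\<close>
  have T0: "T w u v = 0" for w u v
  proof -
    have "T w u v = - T w v u" using T_skew[of w u v] by simp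
    also have "\<dots> = - T v w u" by (simp add: T_sym)
    also have "\<dots> = T v u w" using T_skew[of v u w] by simp
    also have "\<dots> = T u v w" by (simp add: T_sym)
    also have "\<dots> = - T u w v" using T_skew[of u v w] by simp
    also have "\<dots> = - T w u v" by (simp add: T_sym)
    finally show ?thesis by simp
  qed
  have lin: "linear (?D x)" using f1 has_derivative_linear by blast
  \<comment> \<open>An isometric derivative is injective, hence surjective by dimension, so its
    values exhaust the test vectors for the nondegenerate form at \<open>f x\<close>.\<close>
  have "inj (?D x)"
  proof (subst linear_injective_0[OF lin], intro allI impI)
    fix v assume "?D x v = 0"
    then have "bilin (G x) v v = 0" using iso[OF x, of v v] by (simp add: bilin_linear)
    then show "v = 0" using G_pos[OF xU, of v] by force
  qed
  then have "surj (?D x)" using linear_injective_imp_surjective[OF lin] by simp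
  then have "bilin (G (f x)) (B w u) v = 0" for v
    using T0[of w u] unfolding T_def by (metis surjD)
  then have "B w u = 0" by (rule G_nondegenerate[OF fU])
  then show ?thesis unfolding B_def by (simp add: algebra_simps eq_diff_eq)
qed

text \<open>The pair \<open>z = (f - id, Df - 1)\<close> vanishes at \<open>q\<close>. Its
  derivative consists of \<open>Df - 1\<close> and of the second derivative of \<open>f\<close>, and
  the transformation law bounds both linearly by \<open>z\<close>, so uniqueness for total systems
  applies.\<close>

lemma isometry_local_rigidity:
  assumes V: "open V" "V \<subseteq> U" and f: "\<And>k. Ck_on k V f" "f ` V \<subseteq> U" and q: "q \<in> V"
    and iso: "\<And>x u v. x \<in> V \<Longrightarrow> bilin (G (f x)) (frechet_derivative f (at x) u) (frechet_derivative f (at x) v)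
      = bilin (G x) u v"
    and fq: "f q = q" "frechet_derivative f (at q) = (\<lambda>u. u)"
  obtains r where "r > 0" "ball q r \<subseteq> V" "\<And>x. x \<in> ball q r \<Longrightarrow> f x = x"
proof -
  let ?D = "\<lambda>x. frechet_derivative f (at x)"
  let ?n = "real CARD('n)"
  have f1: "(f has_derivative ?D x) (at x)" if "x \<in> V" for x
    using Ck_on_SucD(1)[OF f(1) that] .
  have d2: "((\<lambda>y. ?D y b) has_derivative (\<lambda>a. second_deriv f x a b)) (at x)" if "x \<in> V" for x b
    by (rule has_derivative_second_deriv[OF f(1) V(1) that])
  have lin: "linear (?D x)" if "x \<in> V" for x using f1[OF that] has_derivative_linear by blast
  have qU: "q \<in> U" using q V by auto
  define z where "z = (\<lambda>x. (f x - x, \<chi> j. ?D x (axis j 1) - axis j 1 :: real^'n^'n))"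
  define z' where "z' = (\<lambda>x v. (?D x v - v, \<chi> j. second_deriv f x v (axis j 1) :: real^'n^'n))"
  have dz: "(z has_derivative z' x) (at x)" if "x \<in> V" for x
  proof -
    have "((\<lambda>x. \<chi> j. ?D x (axis j 1) - axis j 1 :: real^'n^'n) has_derivative
        (\<lambda>v. \<chi> j. second_deriv f x v (axis j 1))) (at x)"
      using has_derivative_diff[OF d2[OF that] has_derivative_const]
      by - (rule has_derivative_vec_componentwise, simp)
    then show ?thesis
      unfolding z_def z'_def
      by (intro has_derivative_Pair has_derivative_diff f1[OF that] has_derivative_ident)
  qed
  obtain d C where dC: "d > 0" "C \<ge> 0" "ball q d \<subseteq> U"
    "\<And>x a b. x \<in> ball q d \<Longrightarrow> norm (gam G x a b) \<le> C * norm a * norm b"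
    "\<And>x y a b. x \<in> ball q d \<Longrightarrow> y \<in> ball q d \<Longrightarrow>
      norm (gam G x a b - gam G y a b) \<le> C * norm (x - y) * norm a * norm b"
    using gam_locally_lipschitz[OF qU] by metis
  obtain d1 where d1: "d1 > 0" "ball q d1 \<subseteq> V" "\<And>x. x \<in> ball q d1 \<Longrightarrow> dist (f x) (f q) < d"
    using continuous_on_ballD[OF Ck_on_imp_continuous_on[OF f(1)] V(1) q dC(1)] by metis
  have "continuous_on V z"
    using dz by (intro continuous_at_imp_continuous_on) (auto intro: has_derivative_continuous)
  from continuous_on_ballD[OF this V(1) q zero_less_one]
  obtain d3 where d3: "d3 > 0" "\<And>x. x \<in> ball q d3 \<Longrightarrow> dist (z x) (z q) < 1" by metis
  have zq: "z q = 0" by (simp add: z_def fq zero_prod_def vec_eq_iff)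
  \<comment> \<open>The three radii serve the Christoffel bounds, the inclusion of
    \<open>f x\<close> in the ball where these bounds hold, and
    \<open>norm (z x) \<le> 1\<close>.\<close>
  define \<rho> where "\<rho> = min d (min d1 d3)"
  have \<rho>: "\<rho> > 0" "ball q \<rho> \<subseteq> V" using dC d1 d3 by (auto simp: \<rho>_def)
  \<comment> \<open>The first \<open>?n\<close> comes from \<open>Df - 1\<close>; the bracket adds
    the four estimates of \<open>H\<close>, and its factor \<open>?n\<close> counts the
    columns.\<close>
  have bound: "norm (z' x v) \<le> (?n + ?n * (?n * C + C + C * ?n * (1 + ?n) + C * ?n)) * norm (z x) * norm v"
    if x: "x \<in> ball q \<rho>" for x v
  proof -
    have xV: "x \<in> V" and xd: "x \<in> ball q d" and fxd: "f x \<in> ball q d" and z1: "norm (z x) \<le> 1"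
      using x \<rho> d1(3)[of x] d3(2)[of x] by (auto simp: \<rho>_def fq zq dist_commute dist_norm norm_minus_commute)
    have h: "norm (f x - x) \<le> norm (z x)" unfolding z_def by (rule norm_fst_le)
    have E: "norm (?D x u - u) \<le> ?n * norm (z x) * norm u" for u
    proof -
      have "linear (\<lambda>u. ?D x u - u)" using lin[OF xV] by (intro linear_compose_sub linear_id[unfolded id_def])
      from norm_linear_le_axis[OF this, of u]
      have "norm (?D x u - u) \<le> (\<Sum>j\<in>UNIV. norm (?D x (axis j 1) - axis j 1)) * norm u" .
      also have "\<dots> \<le> (\<Sum>j\<in>(UNIV::'n set). norm (z x)) * norm u"
      proof (intro mult_right_mono sum_mono norm_ge_zero)
        fix j
        have "norm (?D x (axis j 1) - axis j 1) \<le> norm (snd (z x))"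
          using Finite_Cartesian_Product.norm_nth_le[of "snd (z x)" j] by (simp add: z_def)
        also have "\<dots> \<le> norm (z x)" using norm_snd_le[of "snd (z x)" "fst (z x)"] by simp
        finally show "norm (?D x (axis j 1) - axis j 1) \<le> norm (z x)" .
      qed
      finally show ?thesis by simp
    qed
    \<comment> \<open>Since \<open>norm (z x) \<le> 1\<close>, the derivative is bounded outright;
      this keeps the term quadratic in the defect linear in \<open>z\<close>.\<close>
    have Db: "norm (?D x u) \<le> (1 + ?n) * norm u" for u
    proof -
      have "norm (?D x u) \<le> norm u + norm (?D x u - u)" using norm_triangle_ineq[of u "?D x u - u"] by simp
      also have "\<dots> \<le> norm u + ?n * 1 * norm u"
        using E[of u] z1 by (intro add_left_mono) (meson mult_left_mono mult_right_mono norm_ge_zero of_nat_0_le_iff order_trans)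
      finally show ?thesis by (simp add: algebra_simps)
    qed
    have H: "norm (second_deriv f x v (axis j 1)) \<le> (?n * C + C + C * ?n * (1 + ?n) + C * ?n) * (norm (z x) * norm v)" for j
    proof -
      let ?u = "axis j 1 :: real^'n"
      \<comment> \<open>The transformation law is telescoped so that each of the four summands has a
        factor vanishing with \<open>z\<close>: \<open>Df - 1\<close> in three of them,
        \<open>f x - x\<close> in the second.\<close>
      have eq: "second_deriv f x v ?u = (?D x (gam G x v ?u) - gam G x v ?u) + (gam G x v ?u - gam G (f x) v ?u)
         - gam G (f x) (?D x v - v) (?D x ?u) - gam G (f x) v (?D x ?u - ?u)"
        by (subst isometry_second_deriv[OF V f xV]) (simp_all add: iso gam_diff_left gam_diff_right)
      have 1: "norm (?D x (gam G x v ?u) - gam G x v ?u) \<le> ?n * C * (norm (z x) * norm v)"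
        using order_trans[OF E mult_left_mono[OF dC(4)[OF xd, of v ?u]]] by (simp add: mult_ac)
      have 2: "norm (gam G x v ?u - gam G (f x) v ?u) \<le> C * (norm (z x) * norm v)"
      proof -
        have "norm (gam G x v ?u - gam G (f x) v ?u) \<le> C * norm (x - f x) * norm v * norm ?u"
          by (rule dC(5)[OF xd fxd])
        also have "\<dots> \<le> C * norm (z x) * norm v * norm ?u"
          using h dC(2) by (intro mult_right_mono mult_left_mono) (auto simp: norm_minus_commute)
        finally show ?thesis by simp
      qed
      have 3: "norm (gam G (f x) (?D x v - v) (?D x ?u)) \<le> C * ?n * (1 + ?n) * (norm (z x) * norm v)"
      proof -
        have "norm (gam G (f x) (?D x v - v) (?D x ?u)) \<le> C * norm (?D x v - v) * norm (?D x ?u)"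
          by (rule dC(4)[OF fxd])
        also have "\<dots> \<le> C * (?n * norm (z x) * norm v) * ((1 + ?n) * norm ?u)"
          using dC(2) by (intro mult_mono mult_left_mono E Db) auto
        finally show ?thesis by (simp add: mult_ac)
      qed
      have 4: "norm (gam G (f x) v (?D x ?u - ?u)) \<le> C * ?n * (norm (z x) * norm v)"
      proof -
        have "norm (gam G (f x) v (?D x ?u - ?u)) \<le> C * norm v * norm (?D x ?u - ?u)"
          by (rule dC(4)[OF fxd])
        also have "\<dots> \<le> C * norm v * (?n * norm (z x) * norm ?u)"
          using dC(2) by (intro mult_left_mono E) auto
        finally show ?thesis by (simp add: mult_ac)
      qed
      show ?thesis
        unfolding eq using norm_triangle_mono[OF norm_triangle_mono[OF norm_triangle_mono[OF 1 2]
          3[folded norm_minus_cancel[of "gam G (f x) (?D x v - v) (?D x ?u)"]]]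
          4[folded norm_minus_cancel[of "gam G (f x) v (?D x ?u - ?u)"]]]
        by (simp add: algebra_simps)
    qed
    have "norm (z' x v) \<le> norm (?D x v - v) + norm (\<chi> j. second_deriv f x v (axis j 1) :: real^'n^'n)"
      unfolding z'_def by (rule norm_Pair_le)
    also have "\<dots> \<le> norm (?D x v - v) + (\<Sum>j\<in>UNIV. norm (second_deriv f x v (axis j 1)))"
      unfolding norm_vec_def[where x = "\<chi> j. second_deriv f x v (axis j 1)"]
      by (intro add_left_mono order_trans[OF L2_set_le_sum]) auto
    also have "\<dots> \<le> ?n * norm (z x) * norm v
        + (\<Sum>j\<in>(UNIV::'n set). (?n * C + C + C * ?n * (1 + ?n) + C * ?n) * (norm (z x) * norm v))"
      by (intro add_mono E sum_mono H)
    also have "\<dots> = (?n + ?n * (?n * C + C + C * ?n * (1 + ?n) + C * ?n)) * norm (z x) * norm v"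
      by (simp add: algebra_simps)
    finally show ?thesis .
  qed
  obtain r where r: "r > 0" "r \<le> \<rho>" "\<And>x. x \<in> ball q r \<Longrightarrow> z x = 0"
    using linear_total_system_unique[OF \<rho>(1) dz[OF subsetD[OF \<rho>(2)]] bound zq] by metis
  show thesis
  proof (rule that[OF r(1)])
    show "ball q r \<subseteq> V" using r(2) \<rho>(2) by auto
    show "f x = x" if "x \<in> ball q r" for x
      using r(3)[OF that] by (simp add: z_def zero_prod_def)
  qed
qed

end

section \<open>Isometries in charts and rigidity on the manifold\<close>

lemma is_chartD:
  assumes "is_chart c"
  shows "open (chart_dom c)" "open (chart_img c)" "continuous_on (chart_dom c) (chart_map c)"
    "continuous_on (chart_img c) (chart_inv c)" "inj_on (chart_map c) (chart_dom c)"
    and "\<And>x. x \<in> chart_dom c \<Longrightarrow> chart_inv c (chart_map c x) = x"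
    and "\<And>x. x \<in> chart_img c \<Longrightarrow> chart_map c (chart_inv c x) = x"
    and "\<And>x. x \<in> chart_dom c \<Longrightarrow> chart_map c x \<in> chart_img c"
    and "\<And>x. x \<in> chart_img c \<Longrightarrow> chart_inv c x \<in> chart_dom c"
  using assms unfolding is_chart_def homeomorphism_def chart_img_def
  by (auto intro: inj_on_inverseI)

lemma riemannian_manifold_chart:
  assumes "riemannian_manifold A g" "c \<in> A"
  shows "is_chart c" "local_metric (chart_img c) (g c)"
  using assms unfolding riemannian_manifold_def smooth_atlas_def riemannian_metric_def local_metric_def smooth_on_def
  by auto

text \<open>The set \<open>V\<close> consists of the coordinates of points that \<open>f\<close>
  keeps inside the chart. Only there does the representative describe \<open>f\<close>, so all local
  facts are stated on it.\<close>

lemma isometry_coord_rep: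
  assumes M: "riemannian_manifold A g" and c: "c \<in> A" and f: "isometry A g f"
  defines "V \<equiv> chart_map c ` (chart_dom c \<inter> f -` chart_dom c)" and "F \<equiv> coord_rep c c f"
  shows "open V" "V \<subseteq> chart_img c" "\<And>k. Ck_on k V F" "F ` V \<subseteq> chart_img c"
    and "\<And>x u v. x \<in> V \<Longrightarrow> bilin (g c (F x)) (frechet_derivative F (at x) u) (frechet_derivative F (at x) v)
      = bilin (g c x) u v"
    and "\<And>y. y \<in> chart_dom c \<Longrightarrow> F (chart_map c y) = chart_map c (f y)"
    and "V = {x \<in> chart_img c. f (chart_inv c x) \<in> chart_dom c}"
proof -
  note ch = is_chartD[OF riemannian_manifold_chart(1)[OF M c]]
  have "smooth_on V F"
    using f c unfolding isometry_def smooth_map_def V_def F_def by blast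
  then show "open V" "\<And>k. Ck_on k V F" by (auto simp: smooth_on_def)
  show F: "F (chart_map c y) = chart_map c (f y)" if "y \<in> chart_dom c" for y
    using ch that by (simp add: F_def coord_rep_def)
  show "V \<subseteq> chart_img c" "F ` V \<subseteq> chart_img c"
    using F ch(8) by (auto simp: V_def)
  show "V = {x \<in> chart_img c. f (chart_inv c x) \<in> chart_dom c}"
    using ch(6,8) by (auto simp: V_def chart_img_def)
  fix x u v assume "x \<in> V"
  then obtain y where y: "y \<in> chart_dom c \<inter> f -` chart_dom c" "x = chart_map c y" by (auto simp: V_def)
  have "metric_preserving A g f" using f by (simp add: isometry_def)
  then show "bilin (g c (F x)) (frechet_derivative F (at x) u) (frechet_derivative F (at x) v) = bilin (g c x) u v"
    using y c F unfolding metric_preserving_def Let_def F_def by auto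
qed

lemma isometry_rigidity_nhds:
  assumes M: "riemannian_manifold A g" and c: "c \<in> A" and f: "isometry A g f"
    and q: "q \<in> chart_dom c" "f q = q"
    and D: "frechet_derivative (coord_rep c c f) (at (chart_map c q)) = (\<lambda>u. u)"
  shows "q \<in> interior {y. f y = y}"
proof -
  interpret local_metric "chart_img c" "g c" by (rule riemannian_manifold_chart[OF M c])
  note ch = is_chartD[OF riemannian_manifold_chart(1)[OF M c]]
  note F = isometry_coord_rep[OF M c f]
  let ?V = "chart_map c ` (chart_dom c \<inter> f -` chart_dom c)"
  obtain r where r: "r > 0" "ball (chart_map c q) r \<subseteq> ?V"
    "\<And>x. x \<in> ball (chart_map c q) r \<Longrightarrow> coord_rep c c f x = x"
    by (rule isometry_local_rigidity[OF F(1-4) _ F(5) _ D]) (use q F(6) in auto)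
  let ?N = "chart_dom c \<inter> chart_map c -` ball (chart_map c q) r"
  have "open ?N" using continuous_on_open_vimage[OF ch(1)] ch(3) by (metis Int_commute open_ball)
  moreover have "q \<in> ?N" using q r by auto
  moreover have "?N \<subseteq> {y. f y = y}"
  proof safe
    fix y assume y: "y \<in> chart_dom c" "chart_map c y \<in> ball (chart_map c q) r"
    \<comment> \<open>Equal coordinates identify \<open>f y\<close> with \<open>y\<close> only if
      \<open>f y\<close> lies in the chart. This follows because the ball lies in \<open>?V\<close>
      and the chart is injective.\<close>
    then obtain y' where y': "y' \<in> chart_dom c" "f y' \<in> chart_dom c" "chart_map c y = chart_map c y'"
      using r(2) by blast
    then have "y' = y" using ch(5) y(1) by (metis inj_onD)
    with y' have fy: "f y \<in> chart_dom c" by simp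
    have "chart_map c (f y) = chart_map c y" using F(6)[OF y(1)] r(3)[OF y(2)] by simp
    then show "f y = y" using ch(5) fy y(1) by (metis inj_onD)
  qed
  ultimately show ?thesis by (rule interiorI)
qed

text \<open>The interior of the fixed point set is open, nonempty by the local result, and closed: a
  limit point is fixed, its derivative is the identity by continuity, and the local result applies
  again there.\<close>

lemma isometry_rigidity:
  fixes A :: "('m::{t2_space, second_countable_topology}, 'n::finite) chart set"
  assumes M: "riemannian_manifold A g" and conn: "connected (UNIV :: 'm set)"
    and c: "c \<in> A" and f: "isometry A g f"
    and q: "q \<in> chart_dom c" "f q = q"
    and D: "frechet_derivative (coord_rep c c f) (at (chart_map c q)) = (\<lambda>u. u)"
  shows "f = (\<lambda>y. y)"
proof -
  let ?Z = "interior {y. f y = y}"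
  have contf: "continuous_on UNIV f" using f by (simp add: isometry_def smooth_map_def)
  have "closed ?Z"
  proof -
    have "y \<in> ?Z" if y: "y \<in> closure ?Z" for y
    proof -
      have "closed {y. f y = y}" using closed_Collect_eq[OF contf continuous_on_id] .
      then have fy: "f y = y"
        using y closure_minimal[OF interior_subset] by blast
      have "\<Union> (chart_dom ` A) = UNIV"
        using M by (simp add: riemannian_manifold_def smooth_atlas_def)
      then obtain d where d: "d \<in> A" "y \<in> chart_dom d" by blast
      note ch = is_chartD[OF riemannian_manifold_chart(1)[OF M d(1)]]
      note F = isometry_coord_rep[OF M d(1) f]
      let ?F = "coord_rep d d f" let ?V = "chart_map d ` (chart_dom d \<inter> f -` chart_dom d)"
      have "frechet_derivative ?F (at (chart_map d y)) u = u" for u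
      \<comment> \<open>If the derivative at \<open>y\<close> moved \<open>u\<close>, it would do so
        on a whole neighbourhood. That neighbourhood meets \<open>?Z\<close>, where \<open>f\<close>
        is locally the identity.\<close>
      proof (rule ccontr)
        assume ne: "frechet_derivative ?F (at (chart_map d y)) u \<noteq> u"
        have "continuous_on ?V (\<lambda>x. frechet_derivative ?F (at x) u)"
          using Ck_on_SucD(2)[OF F(3) F(1), of 0] by simp
        then have "open (?V \<inter> (\<lambda>x. frechet_derivative ?F (at x) u) -` (- {u}))"
          using continuous_on_open_vimage[OF F(1)] by (metis Int_commute open_Compl closed_singleton)
        moreover define N where "N = ?V \<inter> (\<lambda>x. frechet_derivative ?F (at x) u) -` (- {u})"
        ultimately have N: "open N" by simp
        have "open (chart_map d -` N \<inter> chart_dom d)"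
          using continuous_on_open_vimage[OF ch(1)] ch(3) N by blast
        moreover have "y \<in> chart_map d -` N \<inter> chart_dom d"
          using d(2) fy ne by (auto simp: N_def)
        ultimately obtain w where w: "w \<in> ?Z" "w \<in> chart_dom d" "chart_map d w \<in> N"
          using y unfolding closure_iff_nhds_not_empty by blast
        have "open (chart_img d \<inter> chart_inv d -` ?Z)"
          using continuous_on_open_vimage[OF ch(2)] ch(4) by (metis Int_commute open_interior)
        moreover have "chart_map d w \<in> chart_img d \<inter> chart_inv d -` ?Z"
          using w ch(6,8) by auto
        moreover have "x = ?F x" if "x \<in> chart_img d \<inter> chart_inv d -` ?Z" for x
          using that interior_subset[of "{y. f y = y}"] ch(7) by (auto simp: coord_rep_def)
        ultimately have "(?F has_derivative (\<lambda>v. v)) (at (chart_map d w))"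
          using has_derivative_transform_within_open[OF has_derivative_ident] by blast
        then have "frechet_derivative ?F (at (chart_map d w)) u = u"
          by (metis frechet_derivative_at)
        then show False using w(3) by (simp add: N_def)
      qed
      then show ?thesis
        by (intro isometry_rigidity_nhds[OF M d(1) f d(2) fy]) auto
    qed
    then show ?thesis using closure_subset_eq by blast
  qed
  moreover have "?Z \<noteq> {}" using isometry_rigidity_nhds[OF M c f q D] by blast
  ultimately have "?Z = UNIV"
    using connectedD[OF conn, of ?Z "- ?Z"] by (auto simp: open_Compl)
  then show ?thesis using interior_subset[of "{y. f y = y}"] by auto
qed

section \<open>Commuting Killing fields\<close>

text \<open>\<open>Ck_on\<close> differentiates the derivative of \<open>f\<close> only in fixed
  directions, so the moving direction \<open>b y\<close> is first expanded over the axes.\<close>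

lemma has_derivative_frechet_derivative_apply:
  fixes f :: "real^'n::finite \<Rightarrow> 'b::real_normed_vector"
  assumes f: "Ck_on 2 S f" and S: "open S" "x \<in> S" and b: "(b has_derivative b') (at x)"
  shows "((\<lambda>y. frechet_derivative f (at y) (b y)) has_derivative
    (\<lambda>w. second_deriv f x w (b x) + frechet_derivative f (at x) (b' w))) (at x)"
proof -
  let ?D = "\<lambda>y. frechet_derivative f (at y)"
  have f1: "linear (?D y)" if "y \<in> S" for y
    using Ck_on_SucD(1)[of 1 S f y] f that has_derivative_linear by (auto simp: numeral_2_eq_2)
  have lin2: "linear (\<lambda>c. second_deriv f x w c)" for w
    using has_derivative_linear[OF has_derivative_second_deriv[OF f S, of w]]
    by (simp add: second_deriv_commute[OF f S, of w])
  have nth: "((\<lambda>y. b y $ i) has_derivative (\<lambda>w. b' w $ i)) (at x)" for i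
    using b by (rule bounded_linear.has_derivative[OF bounded_linear_vec_nth])
  have "((\<lambda>y. \<Sum>i\<in>UNIV. b y $ i *\<^sub>R ?D y (axis i 1)) has_derivative
    (\<lambda>w. \<Sum>i\<in>UNIV. b x $ i *\<^sub>R second_deriv f x w (axis i 1) + b' w $ i *\<^sub>R ?D x (axis i 1))) (at x)"
    by (intro has_derivative_sum has_derivative_scaleR nth has_derivative_second_deriv[OF f S])
  then have "((\<lambda>y. \<Sum>i\<in>UNIV. b y $ i *\<^sub>R ?D y (axis i 1)) has_derivative
    (\<lambda>w. second_deriv f x w (b x) + ?D x (b' w))) (at x)"
    by (simp add: sum.distrib linear_expand_axis[OF lin2, symmetric] linear_expand_axis[OF f1[OF S(2)], symmetric])
  then show ?thesis
    by (rule has_derivative_transform_within_open[OF _ S]) (simp add: linear_expand_axis[OF f1, symmetric])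
qed

context local_metric
begin

text \<open>The equation is the vanishing Lie derivative of the metric along \<open>X\<close>,
  written in coordinates.\<close>

definition killing_field :: "(real^'n \<Rightarrow> real^'n) \<Rightarrow> bool" where
  "killing_field X \<longleftrightarrow> Ck_on 2 U X \<and> (\<forall>x\<in>U. \<forall>u v. bilin (dG x (X x)) u v
    + bilin (G x) (frechet_derivative X (at x) u) v + bilin (G x) u (frechet_derivative X (at x) v) = 0)"

text \<open>The coordinate form of a vanishing Lie bracket.\<close>

definition commuting_fields :: "(real^'n \<Rightarrow> real^'n) \<Rightarrow> (real^'n \<Rightarrow> real^'n) \<Rightarrow> bool" where
  "commuting_fields X Y \<longleftrightarrow> (\<forall>x\<in>U. frechet_derivative X (at x) (Y x) = frechet_derivative Y (at x) (X x))"

text \<open>The field comes first and the direction last: \<open>nabla X x u\<close> is the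
  covariant derivative of \<open>X\<close> along \<open>u\<close> at \<open>x\<close>.\<close>

definition nabla :: "(real^'n \<Rightarrow> real^'n) \<Rightarrow> real^'n \<Rightarrow> real^'n \<Rightarrow> real^'n" where
  "nabla X x u = frechet_derivative X (at x) u + gam G x u (X x)"

text \<open>Metric compatibility rewrites the derivative of the metric by Christoffel terms; their
  symmetry completes both derivatives of \<open>X\<close> to covariant ones.\<close>

lemma killing_field_skew:
  assumes "killing_field X" "x \<in> U"
  shows "bilin (G x) (nabla X x u) v = - bilin (G x) u (nabla X x v)"
proof -
  have "bilin (dG x (X x)) u v + bilin (G x) (frechet_derivative X (at x) u) v
      + bilin (G x) u (frechet_derivative X (at x) v) = 0"
    using assms by (simp add: killing_field_def)
  then show ?thesis
    unfolding nabla_def metric_compatible[OF assms(2)] gam_commute[OF assms(2), of "X x"]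
    by (simp add: bilin_linear)
qed

lemma commuting_fields_nabla:
  "commuting_fields X Y \<Longrightarrow> x \<in> U \<Longrightarrow> nabla X x (Y x) = nabla Y x (X x)"
  unfolding nabla_def commuting_fields_def using gam_commute by simp

text \<open>Skewness of each Killing field and the exchange
  \<open>\<nabla>\<^sub>X Y = \<nabla>\<^sub>Y X\<close> of commuting fields, used three times each,
  carry the expression to its own negative.\<close>

lemma commuting_killing_orthogonal:
  assumes K: "killing_field X" "killing_field Y" "killing_field Z"
    and C: "commuting_fields X Y" "commuting_fields Y Z" "commuting_fields X Z" and x: "x \<in> U"
  shows "bilin (G x) (nabla Y x (X x)) (Z x) = 0"
proof -
  note c = C[THEN commuting_fields_nabla[OF _ x]]
  have "bilin (G x) (nabla Y x (X x)) (Z x) = - bilin (G x) (X x) (nabla Y x (Z x))"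
    by (rule killing_field_skew[OF K(2) x])
  also have "\<dots> = - bilin (G x) (X x) (nabla Z x (Y x))" using c(2) by simp
  also have "\<dots> = bilin (G x) (nabla Z x (X x)) (Y x)" using killing_field_skew[OF K(3) x] by simp
  also have "\<dots> = bilin (G x) (nabla X x (Z x)) (Y x)" using c(3) by simp
  also have "\<dots> = - bilin (G x) (Z x) (nabla X x (Y x))" by (rule killing_field_skew[OF K(1) x])
  also have "\<dots> = - bilin (G x) (nabla Y x (X x)) (Z x)" using c(1) G_sym[OF x] by simp
  finally show ?thesis by simp
qed

text \<open>The Gauss equation of the flat orbit: \<open>\<nabla>\<^sub>Y Y\<close> and \<open>\<nabla>\<^sub>X Y\<close> are orthogonal to \<open>X\<close> everywhere, and
  these two identities are differentiated along \<open>X\<close> and \<open>Y\<close>.\<close>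

lemma commuting_killing_curvature:
  assumes K: "killing_field X" "killing_field Y" and C: "commuting_fields X Y" and x: "x \<in> U"
  shows "bilin (G x) (riemann_curv G x (X x) (Y x) (Y x)) (X x)
    = bilin (G x) (nabla Y x (X x)) (nabla Y x (X x)) - bilin (G x) (nabla X x (X x)) (nabla Y x (Y x))"
proof -
  have Ck: "Ck_on 2 U X" "Ck_on 2 U Y" using K by (auto simp: killing_field_def)
  let ?DX = "frechet_derivative X (at x)" and ?DY = "frechet_derivative Y (at x)"
  have dX: "(X has_derivative ?DX) (at x)" and dY: "(Y has_derivative ?DY) (at x)"
    using Ck_on_SucD(1)[of 1 U _ x] Ck x by (auto simp: numeral_2_eq_2)
  have lY: "linear ?DY" using dY has_derivative_linear by blast
  have CXX: "commuting_fields X X" "commuting_fields Y Y" "commuting_fields Y X"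
    using C by (auto simp: commuting_fields_def)
  have cXY: "?DX (Y x) = ?DY (X x)" using C x by (simp add: commuting_fields_def)
  \<comment> \<open>\<open>P\<close> is \<open>\<nabla>\<^sub>Y Y\<close> and \<open>Q\<close> is
    \<open>\<nabla>\<^sub>X Y\<close>, as fields near \<open>x\<close>; \<open>dP\<close> and
    \<open>dQ\<close> are their coordinate derivatives by the product rule.\<close>
  define P where "P = (\<lambda>y. nabla Y y (Y y))"
  define Q where "Q = (\<lambda>y. nabla Y y (X y))"
  define dP where "dP = (\<lambda>w. (second_deriv Y x w (Y x) + ?DY (?DY w))
      + (dgam G x w (Y x) (Y x) + gam G x (?DY w) (Y x) + gam G x (Y x) (?DY w)))"
  define dQ where "dQ = (\<lambda>w. (second_deriv Y x w (X x) + ?DY (?DX w))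
      + (dgam G x w (X x) (Y x) + gam G x (?DX w) (Y x) + gam G x (X x) (?DY w)))"
  have P: "(P has_derivative dP) (at x)" and Q: "(Q has_derivative dQ) (at x)"
    unfolding P_def Q_def dP_def dQ_def nabla_def
    by (intro has_derivative_add has_derivative_frechet_derivative_apply[OF Ck(2) open_U x]
        has_derivative_gam[OF x] dX dY)+
  have zero: "bilin (dG x w) (F x) (X x) + bilin (G x) (dF w) (X x) + bilin (G x) (F x) (?DX w) = 0"
    if F: "(F has_derivative dF) (at x)" and 0: "\<And>y. y \<in> U \<Longrightarrow> bilin (G y) (F y) (X y) = 0" for F dF w
  proof -
    have "((\<lambda>y. 0) has_derivative (\<lambda>w. bilin (dG x w) (F x) (X x) + bilin (G x) (dF w) (X x)
        + bilin (G x) (F x) (?DX w))) (at x)"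
      by (rule has_derivative_transform_within_open[OF has_derivative_bilin[OF has_derivative_G[OF x] F dX refl]
            open_U x]) (simp add: 0)
    from fun_cong[OF has_derivative_unique[OF this has_derivative_const], of w] show ?thesis .
  qed
  have PX: "bilin (G y) (P y) (X y) = 0" if "y \<in> U" for y
    unfolding P_def by (rule commuting_killing_orthogonal[OF K(2,2,1) CXX(2,3,3) that])
  have QX: "bilin (G y) (Q y) (X y) = 0" if "y \<in> U" for y
    unfolding Q_def by (rule commuting_killing_orthogonal[OF K(1,2,1) C CXX(3,1) that])
  have 1: "bilin (G x) (gam G x (X x) (P x) + dP (X x)) (X x) = - bilin (G x) (P x) (nabla X x (X x))"
    using zero[OF P PX, of "X x"] unfolding metric_compatible[OF x] by (simp add: bilin_linear nabla_def)
  have nQ: "nabla X x (Y x) = Q x" unfolding Q_def by (rule commuting_fields_nabla[OF C x])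
  have 2: "bilin (G x) (gam G x (Y x) (Q x) + dQ (Y x)) (X x) = - bilin (G x) (Q x) (Q x)"
    using zero[OF Q QX, of "Y x"] unfolding metric_compatible[OF x] nQ[symmetric] by (simp add: bilin_linear nabla_def)
  \<comment> \<open>This is \<open>\<nabla>\<^sub>X P - \<nabla>\<^sub>Y Q\<close>. The bracket term
    is absent because the fields commute, and the second derivatives of \<open>Y\<close> cancel by
    symmetry.\<close>
  have "riemann_curv G x (X x) (Y x) (Y x)
      = (gam G x (X x) (P x) + dP (X x)) - (gam G x (Y x) (Q x) + dQ (Y x))"
    unfolding riemann_curv_eq[OF x] P_def Q_def dP_def dQ_def nabla_def cXY
      second_deriv_commute[OF Ck(2) open_U x, of "Y x" "X x"]
    by (simp add: gam_add_right gam_commute[OF x, of "?DY (X x)"])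
  then show ?thesis
    using 1 2 G_sym[OF x] by (simp add: bilin_linear P_def Q_def)
qed

end

section \<open>An extremal vector of a second fundamental form\<close>

text \<open>Rank and nullity on a subspace: \<open>F\<close> is injective on the orthogonal
  complement \<open>?C\<close> of the kernel within \<open>N\<close>.\<close>

lemma dim_le_dim_kernel_plus_image:
  fixes F :: "real^'n::finite \<Rightarrow> real^'n"
  assumes N: "subspace N" and F: "linear F"
  shows "dim N \<le> dim {v \<in> N. F v = 0} + dim (F ` N)"
proof -
  let ?K = "{v \<in> N. F v = 0}"
  let ?C = "{y \<in> N. \<forall>x\<in>?K. orthogonal x y}"
  have K: "subspace ?K"
    using N F by (auto simp: subspace_def linear_add linear_scale linear_0)
  have C: "subspace ?C"
    using N by (auto simp: subspace_def orthogonal_def inner_add_right)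
  have "dim ?C + dim ?K = dim N"
    by (rule dim_subspace_orthogonal_to_vectors[OF K N]) auto
  moreover have "dim (F ` ?C) = dim ?C"
  proof (rule dim_image_eq[OF F])
    have "inj_on F ?C"
      unfolding linear_inj_on_iff_eq_0[OF F C] by (auto simp: orthogonal_def)
    then show "inj_on F (span ?C)" by (simp only: span_eq_iff[THEN iffD2, OF C])
  qed
  moreover have "dim (F ` ?C) \<le> dim (F ` N)" by (rule dim_subset) auto
  ultimately show ?thesis by simp
qed

lemma dim_functional_kernel:
  fixes l :: "real^'n::finite \<Rightarrow> real"
  assumes "subspace N" "linear l"
  shows "dim N \<le> dim {v \<in> N. l v = 0} + 1"
proof -
  \<comment> \<open>Any nonzero vector would do; placing the values of \<open>l\<close> along it
    makes an endomorphism, to which the previous count applies.\<close>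
  let ?a = "axis (SOME i. True) 1 :: real^'n"
  have a: "?a \<noteq> 0" by simp
  have "linear (\<lambda>v. l v *\<^sub>R ?a)"
    using assms(2) by (auto intro!: linearI simp: linear_add linear_scale scaleR_add_left)
  from dim_le_dim_kernel_plus_image[OF assms(1) this]
  have "dim N \<le> dim {v \<in> N. l v = 0} + dim ((\<lambda>v. l v *\<^sub>R ?a) ` N)" by simp
  moreover have "dim ((\<lambda>v. l v *\<^sub>R ?a) ` N) \<le> card {?a}"
    by (rule dim_le_card) (auto intro: span_mul span_base)
  ultimately show ?thesis by simp
qed

text \<open>Pure linear algebra in one tangent space; \<open>M\<close> will be the metric at a
  point.\<close>

locale inner_matrix =
  fixes M :: "real^'n::finite^'n"
  assumes M_sym: "\<And>u v. bilin M u v = bilin M v u" and M_pos: "\<And>u. u \<noteq> 0 \<Longrightarrow> bilin M u u > 0"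
begin

lemma linear_bilin: "linear (\<lambda>v. bilin M v u)"
  by (auto intro!: linearI simp: bilin_linear)

lemma M_nonneg: "bilin M u u \<ge> 0"
  using M_pos[of u] by (cases "u = 0") (auto simp: bilin_linear)

lemma normalize_bilin:
  assumes "u \<noteq> 0"
  shows "bilin M ((1 / sqrt (bilin M u u)) *\<^sub>R u) ((1 / sqrt (bilin M u u)) *\<^sub>R u) = 1"
  using M_pos[OF assms] by (simp add: bilin_linear)

text \<open>By positivity, \<open>T\<close> and its complement with respect to \<open>M\<close> meet
  only in 0.\<close>

lemma dim_orthogonal_le:
  assumes T: "subspace T"
  shows "dim T + dim {w. \<forall>v\<in>T. bilin M w v = 0} \<le> CARD('n)"
proof -
  let ?W = "{w. \<forall>v\<in>T. bilin M w v = 0}"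
  have W: "subspace ?W" by (auto simp: subspace_def bilin_linear)
  have "T \<inter> ?W \<subseteq> {0}" using M_pos by force
  then have "dim (T \<inter> ?W) = 0" by (simp add: dim_eq_0)
  then have "dim T + dim ?W = dim {x + y |x y. x \<in> T \<and> y \<in> ?W}"
    using dim_sums_Int[OF T W] by linarith
  also have "\<dots> \<le> DIM(real^'n)" by (rule dim_subset_UNIV)
  finally show ?thesis by simp
qed

text \<open>A unit vector is split off and the rest is found in its complement within
  \<open>N\<close>, which costs one dimension.\<close>

lemma exists_orthonormal:
  assumes "subspace N" "dim N \<ge> k"
  shows "\<exists>e :: nat \<Rightarrow> real^'n. (\<forall>i\<in>{1..k}. e i \<in> N) \<and>
    (\<forall>i\<in>{1..k}. \<forall>j\<in>{1..k}. bilin M (e i) (e j) = (if i = j then 1 else 0))"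
  using assms
proof (induction k arbitrary: N)
  case (Suc k)
  have "\<not> N \<subseteq> {0}"
    using Suc.prems(2) unfolding dim_eq_0[of N, symmetric] by linarith
  then obtain w where w: "w \<in> N" "w \<noteq> 0" by auto
  define e0 where "e0 = (1 / sqrt (bilin M w w)) *\<^sub>R w"
  have e0: "e0 \<in> N" "bilin M e0 e0 = 1"
    using w Suc.prems(1) normalize_bilin by (auto simp: e0_def subspace_scale)
  let ?N = "{v \<in> N. bilin M v e0 = 0}"
  have "subspace ?N" using Suc.prems(1) by (auto simp: subspace_def bilin_linear)
  moreover have "dim ?N \<ge> k"
    using dim_functional_kernel[OF Suc.prems(1) linear_bilin, of e0] Suc.prems(2) by simp
  ultimately have "\<exists>e :: nat \<Rightarrow> real^'n. (\<forall>i\<in>{1..k}. e i \<in> ?N) \<and>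
    (\<forall>i\<in>{1..k}. \<forall>j\<in>{1..k}. bilin M (e i) (e j) = (if i = j then 1 else 0))"
    by (rule Suc.IH)
  then obtain e where e: "\<And>i. i \<in> {1..k} \<Longrightarrow> e i \<in> N \<and> bilin M (e i) e0 = 0"
    "\<And>i j. i \<in> {1..k} \<Longrightarrow> j \<in> {1..k} \<Longrightarrow> bilin M (e i) (e j) = (if i = j then 1 else 0)"
    by (elim exE conjE) blast
  show ?case
  proof (intro exI[of _ "e(Suc k := e0)"] conjI ballI)
    fix i j assume ij: "i \<in> {1..Suc k}" "j \<in> {1..Suc k}"
    have ij': "i \<in> {1..k} \<or> i = Suc k" "j \<in> {1..k} \<or> j = Suc k" "Suc k \<notin> {1..k}" using ij by auto
    show "(e(Suc k := e0)) i \<in> N" using e(1)[of i] e0(1) ij' by auto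
    show "bilin M ((e(Suc k := e0)) i) ((e(Suc k := e0)) j) = (if i = j then 1 else 0)"
    proof (cases "i = Suc k \<or> j = Suc k")
      case True
      have "bilin M (e a) e0 = 0" "bilin M e0 (e a) = 0" if "a \<in> {1..k}" for a
        using e(1)[OF that] M_sym[of e0 "e a"] by simp_all
      with True show ?thesis using ij' e0(2) by (metis fun_upd_apply)
    next
      case False
      then show ?thesis using ij' e(2)[of i j] by simp
    qed
  qed
qed simp

text \<open>The extremal vector \<open>u\<close> minimizes \<open>|\<beta>(u, u)|\<close> on the unit sphere of \<open>T\<close>; the frame is taken in
  the kernel of \<open>\<beta>(u, -)\<close>, where the second variation reads \<open>\<langle>\<beta>(u, u), \<beta>(v, v)\<rangle> \<ge> |\<beta>(u, u)|\<^sup>2\<close>.\<close>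

lemma exists_extremal_frame:
  assumes T: "subspace T" and r: "2 * dim T \<ge> CARD('n) + k + 1"
    and \<beta>: "bilinear \<beta>" "\<And>x y. x \<in> T \<Longrightarrow> y \<in> T \<Longrightarrow> \<beta> x y = \<beta> y x"
    and orth: "\<And>x y z. x \<in> T \<Longrightarrow> y \<in> T \<Longrightarrow> z \<in> T \<Longrightarrow> bilin M (\<beta> x y) z = 0"
  shows "\<exists>u e. u \<in> T \<and> bilin M u u = 1 \<and> (\<forall>i\<in>{1..k}. e i \<in> T \<and> bilin M u (e i) = 0 \<and> \<beta> u (e i) = 0 \<and>
      bilin M (\<beta> u u) (\<beta> (e i) (e i)) \<ge> 0) \<and>
    (\<forall>i\<in>{1..k}. \<forall>j\<in>{1..k}. bilin M (e i) (e j) = (if i = j then 1 else 0))"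
proof -
  have bb: "bounded_bilinear \<beta>" using \<beta>(1) bilinear_conv_bounded_bilinear by blast
  note b = bilinear_ladd[OF \<beta>(1)] bilinear_radd[OF \<beta>(1)] bilinear_lmul[OF \<beta>(1)] bilinear_rmul[OF \<beta>(1)]
  have dT: "dim T \<le> CARD('n)" using dim_subset_UNIV[of T] by simp
  define S where "S = T \<inter> sphere 0 1"
  \<comment> \<open>Numerator and denominator both have degree 4, so \<open>h\<close> is invariant
    under scaling. It can be minimized on the compact Euclidean sphere and the minimizer normalized
    for \<open>M\<close> afterwards.\<close>
  define h where "h = (\<lambda>u. bilin M (\<beta> u u) (\<beta> u u) / (bilin M u u)\<^sup>2)"
  have nz: "u \<noteq> 0" if "u \<in> S" for u using that by (auto simp: S_def)
  have "compact S" unfolding S_def by (intro closed_Int_compact closed_subspace[OF T] compact_sphere)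
  moreover have "S \<noteq> {}"
  proof -
    have "\<not> T \<subseteq> {0}" using r dT unfolding dim_eq_0[of T, symmetric] by linarith
    then obtain w where w: "w \<in> T" "w \<noteq> 0" by auto
    then have "(1 / norm w) *\<^sub>R w \<in> S" using T by (auto simp: S_def subspace_scale)
    then show ?thesis by blast
  qed
  moreover have "continuous_on S h"
    unfolding h_def continuous_on_def
  proof (intro ballI tendsto_intros tendsto_bilin bounded_bilinear.tendsto[OF bb])
    show "(bilin M x x)\<^sup>2 \<noteq> 0" if "x \<in> S" for x using M_pos[OF nz[OF that]] by simp
  qed
  ultimately obtain u0 where u0: "u0 \<in> S" "\<And>v. v \<in> S \<Longrightarrow> h u0 \<le> h v"
    using continuous_attains_inf by metis
  define u where "u = (1 / sqrt (bilin M u0 u0)) *\<^sub>R u0"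
  have u: "u \<in> T" "bilin M u u = 1"
    using u0(1) T normalize_bilin[OF nz[OF u0(1)]] by (auto simp: u_def S_def subspace_scale)
  have h_scale: "h (c *\<^sub>R v) = h v" if "c \<noteq> 0" for c v
    using that by (simp add: h_def b bilin_linear power2_eq_square)
  have min: "bilin M (\<beta> u u) (\<beta> u u) * (bilin M v v)\<^sup>2 \<le> bilin M (\<beta> v v) (\<beta> v v)" if "v \<in> T" "v \<noteq> 0" for v
  proof -
    have "(1 / norm v) *\<^sub>R v \<in> S" using that T by (auto simp: S_def subspace_scale)
    from u0(2)[OF this] have "h u0 \<le> h v" using that by (simp add: h_scale)
    moreover have "h u0 = h u"
      unfolding u_def using M_pos[OF nz[OF u0(1)]] by (intro h_scale[symmetric]) simp
    ultimately have "bilin M (\<beta> u u) (\<beta> u u) \<le> h v" by (simp add: h_def u)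
    then show ?thesis using M_pos[OF that(2)] by (simp add: h_def pos_le_divide_eq)
  qed
  define N1 where "N1 = {v \<in> T. bilin M v u = 0}"
  define N where "N = {v \<in> N1. \<beta> u v = 0}"
  have N1: "subspace N1" using T by (auto simp: N1_def subspace_def bilin_linear)
  have lin: "linear (\<beta> u)" using \<beta>(1) by (simp add: bilinear_def)
  have N: "subspace N" using N1 lin by (auto simp: N_def subspace_def linear_add linear_scale linear_0)
  \<comment> \<open>Normality bounds the rank of \<open>\<beta> u\<close> on \<open>N1\<close> by
    the codimension of \<open>T\<close>; \<open>N1\<close> itself loses only one dimension.\<close>
  have "\<beta> u ` N1 \<subseteq> {w. \<forall>v\<in>T. bilin M w v = 0}" using orth[OF u(1)] unfolding N1_def by blast
  then have "dim (\<beta> u ` N1) \<le> dim {w. \<forall>v\<in>T. bilin M w v = 0}" by (rule dim_subset)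
  then have "k \<le> dim N"
    using dim_le_dim_kernel_plus_image[OF N1 lin] dim_functional_kernel[OF T linear_bilin, of u]
      dim_orthogonal_le[OF T] r unfolding N_def[symmetric] N1_def[symmetric] by linarith
  then obtain e where e: "\<forall>i\<in>{1..k}. e i \<in> N"
    "\<forall>i\<in>{1..k}. \<forall>j\<in>{1..k}. bilin M (e i) (e j) = (if i = j then 1 else 0)"
    using exists_orthonormal[OF N] by blast
  \<comment> \<open>Instead of a second derivative, the finite perturbation \<open>u + s v\<close>
    is compared with \<open>u\<close>. As \<open>\<beta> u v = 0\<close>, only even powers of
    \<open>s\<close> appear. Dropping the factor \<open>(1 + s\<^sup>2)\<^sup>2 \<ge> 1\<close>
    gives up the sharper bound; nonnegativity suffices later.\<close>
  have main: "bilin M (\<beta> u u) (\<beta> v v) \<ge> 0" if v: "v \<in> N" "bilin M v v = 1" for v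
  proof (rule ccontr)
    let ?a = "bilin M (\<beta> u u) (\<beta> u u)" and ?p = "bilin M (\<beta> u u) (\<beta> v v)" and ?d = "bilin M (\<beta> v v) (\<beta> v v)"
    assume "\<not> ?p \<ge> 0"
    then have p: "?p < 0" by simp
    have vT: "v \<in> T" "bilin M v u = 0" "\<beta> u v = 0" using v by (auto simp: N_def N1_def)
    \<comment> \<open>Chosen so that \<open>s\<^sup>2 * ?d \<le> - ?p\<close>, which makes
      \<open>2 * ?p + s\<^sup>2 * ?d\<close> negative; the added 1 covers
      \<open>?d = 0\<close>.\<close>
    define s where "s = sqrt (- ?p / (?d + 1))"
    have d: "?d \<ge> 0" "?a \<ge> 0" by (rule M_nonneg)+
    then have "- ?p / (?d + 1) > 0" using p by (intro divide_pos_pos) auto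
    then have s2: "s\<^sup>2 = - ?p / (?d + 1)" "s\<^sup>2 > 0" by (simp_all add: s_def)
    let ?w = "u + s *\<^sub>R v"
    have ww: "bilin M ?w ?w = 1 + s\<^sup>2"
      using vT(2) M_sym[of u v] u(2) v(2) by (simp add: bilin_linear power2_eq_square)
    then have w0: "?w \<noteq> 0" using s2(2) by (metis add_pos_pos bilin_zero_left less_irrefl zero_less_one)
    have wT: "?w \<in> T" using T u(1) vT(1) by (simp add: subspace_add subspace_scale)
    have bw: "\<beta> ?w ?w = \<beta> u u + s\<^sup>2 *\<^sub>R \<beta> v v"
      using vT(3) \<beta>(2)[OF vT(1) u(1)] by (simp add: b power2_eq_square)
    have "bilin M (\<beta> ?w ?w) (\<beta> ?w ?w) = ?a + 2 * (s\<^sup>2 * ?p) + s\<^sup>2 * (s\<^sup>2 * ?d)"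
      unfolding bw bilin_add_left bilin_add_right bilin_scaleR_left bilin_scaleR_right
        M_sym[of "\<beta> v v" "\<beta> u u"] by (simp add: algebra_simps)
    with min[OF wT w0] ww have "?a * (1 + s\<^sup>2)\<^sup>2 \<le> ?a + 2 * (s\<^sup>2 * ?p) + s\<^sup>2 * (s\<^sup>2 * ?d)"
      by simp
    moreover have "?a * 1 \<le> ?a * (1 + s\<^sup>2)\<^sup>2"
      using d(2) by (intro mult_left_mono) (simp_all add: one_le_power)
    ultimately have "0 \<le> 2 * (s\<^sup>2 * ?p) + s\<^sup>2 * (s\<^sup>2 * ?d)" by linarith
    also have "\<dots> = s\<^sup>2 * (2 * ?p + s\<^sup>2 * ?d)" by (simp only: distrib_left mult.left_commute)
    finally have "0 \<le> 2 * ?p + s\<^sup>2 * ?d" using s2(2) by (simp add: zero_le_mult_iff)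
    moreover have "s\<^sup>2 * ?d \<le> - ?p"
    proof -
      have "s\<^sup>2 * ?d \<le> s\<^sup>2 * (?d + 1)" using s2(2) by (intro mult_left_mono) auto
      also have "\<dots> = - ?p"
      proof -
        have "x / y * y = x" if "y > 0" for x y :: real using that by simp
        then show ?thesis unfolding s2(1) using d(1) by (metis add_nonneg_pos zero_less_one)
      qed
      finally show ?thesis .
    qed
    ultimately show False using p by simp
  qed
  have "\<forall>i\<in>{1..k}. e i \<in> T \<and> bilin M u (e i) = 0 \<and> \<beta> u (e i) = 0 \<and> bilin M (\<beta> u u) (\<beta> (e i) (e i)) \<ge> 0"
    using e main M_sym[of u] by (auto simp: N_def N1_def)
  then show ?thesis using u e(2) by blast
qed

end

section \<open>Maps with parameters in the covering space of a torus\<close>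

lemma Ck_param_on_continuous: "Ck_param_on r k S F \<Longrightarrow> continuous_on S F"
  by (cases k) auto

text \<open>\<open>Rspace r\<close> is not open among the sequences, so \<open>S\<close> is open
  only relatively. Pulled back along a family that stays in \<open>Rspace r\<close>, it becomes an
  open set, on which ordinary calculus works.\<close>

lemma open_param_pullback:
  fixes \<sigma> :: "'a::topological_space \<Rightarrow> nat \<Rightarrow> real" and y :: "'a \<Rightarrow> real^'n::finite"
  assumes S: "open W" "S = W \<inter> Rspace r \<times> UNIV"
    and \<sigma>: "\<And>i. continuous_on UNIV (\<lambda>z. \<sigma> z i)" "\<And>z. \<sigma> z \<in> Rspace r" and y: "continuous_on UNIV y"
  shows "open {z. (\<sigma> z, y z) \<in> S}"
    and "continuous_on S F \<Longrightarrow> continuous_on {z. (\<sigma> z, y z) \<in> S} (\<lambda>z. F (\<sigma> z, y z))"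
proof -
  have c: "continuous_on UNIV (\<lambda>z. (\<sigma> z, y z))"
    by (intro continuous_on_Pair continuous_on_coordinatewise_then_product \<sigma> y)
  have "{z. (\<sigma> z, y z) \<in> S} = (\<lambda>z. (\<sigma> z, y z)) -` W" using S(2) \<sigma>(2) by auto
  then show "open {z. (\<sigma> z, y z) \<in> S}" using open_vimage[OF S(1) c] by simp
  show "continuous_on {z. (\<sigma> z, y z) \<in> S} (\<lambda>z. F (\<sigma> z, y z))" if "continuous_on S F"
    by (rule continuous_on_compose2[OF that continuous_on_subset[OF c]]) auto
qed

lemma Ck_param_on_slice:
  fixes F :: "(nat \<Rightarrow> real) \<times> (real^'n::finite) \<Rightarrow> real^'n"
  assumes S: "open W" "S = W \<inter> Rspace r \<times> UNIV" and t: "t \<in> Rspace r"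
  shows "Ck_param_on r k S F \<Longrightarrow> Ck_on k {x. (t, x) \<in> S} (\<lambda>x. F (t, x))"
proof (induction k arbitrary: F)
  case 0
  then show ?case using open_param_pullback(2)[OF S, of "\<lambda>_. t" "\<lambda>x. x"] t by simp
next
  case (Suc k)
  let ?U = "{x. (t, x) \<in> S}"
  have U: "open ?U" using open_param_pullback(1)[OF S, of "\<lambda>_. t" "\<lambda>x. x"] t by simp
  from Suc.prems have "\<forall>j. \<exists>f'. Ck_param_on r k S f' \<and>
      (\<forall>(t, x)\<in>S. ((\<lambda>s. F (t, x + s *\<^sub>R axis j 1)) has_vector_derivative f' (t, x)) (at 0))" by simp
  then obtain F' where F': "\<And>j. Ck_param_on r k S (F' j)"
    "\<And>j t x. (t, x) \<in> S \<Longrightarrow> ((\<lambda>s. F (t, x + s *\<^sub>R axis j 1)) has_vector_derivative F' j (t, x)) (at 0)"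
    unfolding choice_iff by fast
  note IH = Suc.IH[OF F'(1)]
  show ?case
  proof (rule Ck_onI)
    show "((\<lambda>x. F (t, x)) has_derivative (\<lambda>h. \<Sum>j\<in>UNIV. h $ j *\<^sub>R F' j (t, x))) (at x)" if "x \<in> ?U" for x
      by (rule partial_derivs_imp_has_derivative[OF U that])
        (use F'(2) IH[THEN Ck_on_imp_continuous_on] in auto)
    show "Ck_on k ?U (\<lambda>x. \<Sum>j\<in>UNIV. v $ j *\<^sub>R F' j (t, x))" for v
      by (intro Ck_on_sum Ck_on_bounded_linear[OF bounded_linear_scaleR_right] IH)
  qed
qed

text \<open>A chain rule along \<open>\<tau> a\<close>: the coordinates are switched on one after
  the other, \<open>?\<sigma> m \<tau>\<close> having only the first \<open>m\<close> of them, and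
  every increment is estimated by its continuous partial derivative.\<close>

lemma has_vector_derivative_param_line:
  fixes F :: "(nat \<Rightarrow> real) \<times> (real^'n::finite) \<Rightarrow> real^'n"
  assumes S: "open W" "S = W \<inter> Rspace r \<times> UNIV" and x: "((\<lambda>i. 0), x) \<in> S" and a: "a \<in> Rspace r"
    and F': "\<And>i t x. i < r \<Longrightarrow> (t, x) \<in> S \<Longrightarrow> ((\<lambda>s. F (t(i := s), x)) has_vector_derivative F' i (t, x)) (at (t i))"
    and cont: "\<And>i. i < r \<Longrightarrow> continuous_on S (F' i)"
  shows "((\<lambda>\<tau>. F ((\<lambda>i. \<tau> * a i), x)) has_vector_derivative (\<Sum>i<r. a i *\<^sub>R F' i ((\<lambda>i. 0), x))) (at 0)"
proof -
  let ?\<sigma> = "\<lambda>m \<tau> i. if i < m then \<tau> * a i else 0 :: real"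
  have "((\<lambda>\<tau>. F (?\<sigma> m \<tau>, x)) has_vector_derivative (\<Sum>i<m. a i *\<^sub>R F' i ((\<lambda>i. 0), x))) (at 0)" if "m \<le> r" for m
    using that
  proof (induction m)
    case (Suc m)
    then have m: "m < r" by simp
    \<comment> \<open>Letting \<open>s\<close> run from 0 to \<open>\<tau> * a m\<close> leads from
      \<open>?\<sigma> m \<tau>\<close> to \<open>?\<sigma> (Suc m) \<tau>\<close>.\<close>
    let ?\<rho> = "\<lambda>(\<tau>, s). (?\<sigma> m \<tau>)(m := s)"
    let ?N = "{z. (?\<rho> z, x) \<in> S}"
    have c\<rho>: "continuous_on UNIV (\<lambda>z. ?\<rho> z i)" for i
      by (cases "i = m"; cases "i < m") (auto simp: split_beta intro!: continuous_intros)
    have R\<rho>: "?\<rho> z \<in> Rspace r" for z using m by (auto simp: Rspace_def split_beta)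
    note N = open_param_pullback[OF S c\<rho> R\<rho> continuous_on_const[of _ x]]
    have 00: "?\<rho> (0, 0) = (\<lambda>i. 0)" by auto
    have in0: "(0, 0) \<in> ?N" unfolding mem_Collect_eq 00 by (rule x)
    have "((\<lambda>\<tau>. F (?\<sigma> (Suc m) \<tau>, x) - F (?\<sigma> m \<tau>, x)) has_derivative
        (\<lambda>\<tau>. \<tau> *\<^sub>R (a m *\<^sub>R F' m ((\<lambda>i. 0), x)))) (at 0)"
      unfolding has_derivative_at_alt
    proof (intro conjI allI impI)
      show "bounded_linear (\<lambda>\<tau>. \<tau> *\<^sub>R (a m *\<^sub>R F' m ((\<lambda>i. 0), x)))"
        by (rule bounded_linear_scaleR_left)
      fix e :: real assume e: "e > 0"
      then have e': "e / (\<bar>a m\<bar> + 1) > 0" by simp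
      from continuous_on_ballD[OF N(2)[OF cont[OF m]] N(1) in0 e'] obtain d where d: "d > 0"
        "ball (0, 0) d \<subseteq> ?N"
        "\<And>z. z \<in> ball (0, 0) d \<Longrightarrow> dist (F' m (?\<rho> z, x)) (F' m (?\<rho> (0, 0), x)) < e / (\<bar>a m\<bar> + 1)"
        by blast
      show "\<exists>d>0. \<forall>\<tau>. norm (\<tau> - 0) < d \<longrightarrow>
        norm (F (?\<sigma> (Suc m) \<tau>, x) - F (?\<sigma> m \<tau>, x) - (F (?\<sigma> (Suc m) 0, x) - F (?\<sigma> m 0, x))
          - (\<tau> - 0) *\<^sub>R (a m *\<^sub>R F' m ((\<lambda>i. 0), x))) \<le> e * norm (\<tau> - 0)"
      proof (intro exI[of _ "d / (\<bar>a m\<bar> + 1)"] conjI allI impI)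
        show "d / (\<bar>a m\<bar> + 1) > 0" using d(1) by simp
        fix \<tau> :: real assume "norm (\<tau> - 0) < d / (\<bar>a m\<bar> + 1)"
        then have \<tau>: "\<bar>\<tau>\<bar> * (\<bar>a m\<bar> + 1) < d" by (simp add: pos_less_divide_eq)
        have inb: "(\<tau>, s) \<in> ball (0, 0) d" if "s \<in> closed_segment 0 (\<tau> * a m)" for s
        proof -
          have "\<bar>s\<bar> \<le> \<bar>\<tau> * a m\<bar>"
            using that by (auto simp: closed_segment_eq_real_ivl split: if_splits)
          then have "norm (\<tau>, s) < d"
            using norm_Pair_le[of \<tau> s] \<tau> by (simp add: abs_mult algebra_simps)
          then show ?thesis by (metis mem_ball_0 zero_prod_def)
        qed
        have "norm (F (?\<rho> (\<tau>, \<tau> * a m), x) - F (?\<rho> (\<tau>, 0), x) - (\<tau> * a m - 0) *\<^sub>R F' m ((\<lambda>i. 0), x))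
            \<le> e / (\<bar>a m\<bar> + 1) * \<bar>\<tau> * a m - 0\<bar>"
        proof (rule vector_derivative_segment_bound[where g = "\<lambda>s. F (?\<rho> (\<tau>, s), x)"
              and g' = "\<lambda>s. F' m (?\<rho> (\<tau>, s), x)"])
          fix s assume s: "s \<in> closed_segment 0 (\<tau> * a m)"
          have "(?\<rho> (\<tau>, s), x) \<in> S" using inb[OF s] d(2) by auto
          from F'[OF m this] show "((\<lambda>s. F (?\<rho> (\<tau>, s), x)) has_vector_derivative F' m (?\<rho> (\<tau>, s), x)) (at s)"
            by simp
          show "norm (F' m (?\<rho> (\<tau>, s), x) - F' m ((\<lambda>i. 0), x)) \<le> e / (\<bar>a m\<bar> + 1)"
            using d(3)[OF inb[OF s]] unfolding 00 by (simp add: dist_norm)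
        qed
        also have "\<dots> \<le> e * \<bar>\<tau>\<bar>"
        proof -
          have "\<bar>a m\<bar> / (\<bar>a m\<bar> + 1) \<le> 1" by simp
          from mult_left_mono[OF this, of "e * \<bar>\<tau>\<bar>"] e show ?thesis by (simp add: abs_mult mult_ac)
        qed
        moreover have "?\<rho> (\<tau>, \<tau> * a m) = ?\<sigma> (Suc m) \<tau>" "?\<rho> (\<tau>, 0) = ?\<sigma> m \<tau>" "?\<sigma> (Suc m) 0 = ?\<sigma> m 0"
          by (auto simp: fun_eq_iff less_Suc_eq)
        ultimately show "norm (F (?\<sigma> (Suc m) \<tau>, x) - F (?\<sigma> m \<tau>, x) - (F (?\<sigma> (Suc m) 0, x) - F (?\<sigma> m 0, x))
          - (\<tau> - 0) *\<^sub>R (a m *\<^sub>R F' m ((\<lambda>i. 0), x))) \<le> e * norm (\<tau> - 0)"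
          by simp
      qed
    qed
    then have "((\<lambda>\<tau>. F (?\<sigma> (Suc m) \<tau>, x) - F (?\<sigma> m \<tau>, x)) has_vector_derivative
        a m *\<^sub>R F' m ((\<lambda>i. 0), x)) (at 0)" by (simp add: has_vector_derivative_def)
    from has_vector_derivative_add[OF this Suc.IH] Suc.prems show ?case by (simp add: add.commute)
  qed simp
  moreover have "?\<sigma> r \<tau> = (\<lambda>i. \<tau> * a i)" for \<tau> using a by (auto simp: Rspace_def fun_eq_iff)
  ultimately show ?thesis by force
qed

text \<open>The last clause rests on interchanging the derivatives in \<open>t\<close> and \<open>x\<close>.\<close>

lemma infinitesimal_generators:
  fixes F :: "(nat \<Rightarrow> real) \<times> (real^'n::finite) \<Rightarrow> real^'n"
  assumes S: "open W" "S = W \<inter> Rspace r \<times> UNIV" and F: "Ck_param_on r 3 S F"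
  obtains X where "\<And>i. i < r \<Longrightarrow> Ck_on 2 {x. ((\<lambda>i. 0), x) \<in> S} (X i)"
    and "\<And>a x. a \<in> Rspace r \<Longrightarrow> ((\<lambda>i. 0), x) \<in> S \<Longrightarrow>
      ((\<lambda>\<tau>. F ((\<lambda>i. \<tau> * a i), x)) has_vector_derivative (\<Sum>i<r. a i *\<^sub>R X i x)) (at 0)"
    and "\<And>a x h. a \<in> Rspace r \<Longrightarrow> ((\<lambda>i. 0), x) \<in> S \<Longrightarrow>
      ((\<lambda>\<tau>. frechet_derivative (\<lambda>y. F ((\<lambda>i. \<tau> * a i), y)) (at x) h) has_vector_derivative
        (\<Sum>i<r. a i *\<^sub>R frechet_derivative (X i) (at x) h)) (at 0)"
proof -
  let ?z = "\<lambda>i::nat. 0::real"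
  have z: "?z \<in> Rspace r" by (simp add: Rspace_def)
  have part: "(\<forall>i. \<exists>f'. i < r \<longrightarrow> Ck_param_on r k S f' \<and>
      (\<forall>(t, x)\<in>S. ((\<lambda>s. f (t(i := s), x)) has_vector_derivative f' (t, x)) (at (t i))))"
    "(\<forall>j. \<exists>f'. Ck_param_on r k S f' \<and>
      (\<forall>(t, x)\<in>S. ((\<lambda>s. f (t, x + s *\<^sub>R axis j 1)) has_vector_derivative f' (t, x)) (at 0)))"
    if "Ck_param_on r (Suc k) S f" for k f
    using that by auto
  \<comment> \<open>One order is spent on the derivative in \<open>t\<close> that defines the
    generators; the other two are what Killing fields require.\<close>
  have F3: "Ck_param_on r (Suc 2) S F" using F by (simp add: eval_nat_numeral)
  obtain Ft where Ft: "\<And>i. i < r \<Longrightarrow> Ck_param_on r 2 S (Ft i)"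
    "\<And>i t x. i < r \<Longrightarrow> (t, x) \<in> S \<Longrightarrow> ((\<lambda>s. F (t(i := s), x)) has_vector_derivative Ft i (t, x)) (at (t i))"
    using part(1)[OF F3] unfolding choice_iff by fast
  obtain Fx where Fx: "\<And>j. Ck_param_on r 2 S (Fx j)"
    "\<And>j t x. (t, x) \<in> S \<Longrightarrow> ((\<lambda>s. F (t, x + s *\<^sub>R axis j 1)) has_vector_derivative Fx j (t, x)) (at 0)"
    using part(2)[OF F3] unfolding choice_iff by fast
  have two: "(2::nat) = Suc 1" by simp
  have "\<forall>i. \<forall>j. \<exists>f'. i < r \<longrightarrow> Ck_param_on r 1 S f' \<and>
      (\<forall>(t, x)\<in>S. ((\<lambda>s. Ft i (t, x + s *\<^sub>R axis j 1)) has_vector_derivative f' (t, x)) (at 0))"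
    using part(2)[OF Ft(1)[unfolded two]] by blast
  then obtain Ftx where Ftx: "\<And>i j. i < r \<Longrightarrow> Ck_param_on r 1 S (Ftx i j)"
    "\<And>i j t x. i < r \<Longrightarrow> (t, x) \<in> S \<Longrightarrow> ((\<lambda>s. Ft i (t, x + s *\<^sub>R axis j 1)) has_vector_derivative Ftx i j (t, x)) (at 0)"
    unfolding choice_iff by fast
  have "\<forall>j. \<forall>i. \<exists>f'. i < r \<longrightarrow> Ck_param_on r 1 S f' \<and>
      (\<forall>(t, x)\<in>S. ((\<lambda>s. Fx j (t(i := s), x)) has_vector_derivative f' (t, x)) (at (t i)))"
    using part(1)[OF Fx(1)[unfolded two]] by blast
  then obtain Fxt where Fxt: "\<And>i j. i < r \<Longrightarrow> Ck_param_on r 1 S (Fxt j i)"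
    "\<And>i j t x. i < r \<Longrightarrow> (t, x) \<in> S \<Longrightarrow> ((\<lambda>s. Fx j (t(i := s), x)) has_vector_derivative Fxt j i (t, x)) (at (t i))"
    unfolding choice_iff by fast
  define X where "X = (\<lambda>i x. Ft i (?z, x))"
  have slice: "open {x. (t, x) \<in> S}" if "t \<in> Rspace r" for t
    using open_param_pullback(1)[OF S, of "\<lambda>_. t" "\<lambda>x. x"] that by simp
  have X: "Ck_on 2 {x. (?z, x) \<in> S} (X i)" if "i < r" for i
    unfolding X_def by (rule Ck_param_on_slice[OF S z Ft(1)[OF that]])
  have axis_deriv: "frechet_derivative f (at x) (axis j 1) = D"
    if "(f has_derivative f') (at x)" "((\<lambda>s. f (x + s *\<^sub>R axis j 1)) has_vector_derivative D) (at 0)"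
    for f :: "real^'n \<Rightarrow> real^'n" and f' x j D
  proof -
    have "((\<lambda>s. x + s *\<^sub>R axis j 1) has_derivative (\<lambda>s. s *\<^sub>R axis j 1)) (at 0)"
      by (auto intro!: derivative_eq_intros)
    from has_derivative_compose[OF this, of f f'] that(1)
    have "((\<lambda>s. f (x + s *\<^sub>R axis j 1)) has_vector_derivative f' (axis j 1)) (at 0)"
      using linear_scale[OF has_derivative_linear[OF that(1)]] by (simp add: has_vector_derivative_def)
    then have "f' (axis j 1) = D" using that(2) vector_derivative_unique_at by blast
    then show ?thesis using frechet_derivative_at[OF that(1)] by simp
  qed
  \<comment> \<open>Only \<open>t i\<close> and the coordinate \<open>j\<close> of \<open>x\<close>
    vary, which reduces the interchange to two real variables.\<close>
  have comm: "Ftx i j (?z, x) = Fxt j i (?z, x)" if i: "i < r" and x: "(?z, x) \<in> S" for i j x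
  proof -
    let ?\<sigma> = "\<lambda>z::real \<times> real. ?z(i := fst z)" and ?y = "\<lambda>z::real \<times> real. x + snd z *\<^sub>R axis j 1"
    have c\<sigma>: "continuous_on UNIV (\<lambda>z::real\<times>real. ?\<sigma> z l)" for l
      by (cases "l = i") (auto intro!: continuous_intros)
    have R\<sigma>: "?\<sigma> z \<in> Rspace r" for z :: "real \<times> real" using i by (auto simp: Rspace_def)
    have cy: "continuous_on UNIV (?y :: real \<times> real \<Rightarrow> real^'n)" by (intro continuous_intros)
    note N = open_param_pullback[OF S c\<sigma> R\<sigma> cy]
    have sh: "((\<lambda>h. f (t, x + h *\<^sub>R axis j 1)) has_vector_derivative f' (t, x + h *\<^sub>R axis j 1)) (at h)"
      if "((\<lambda>s. f (t, (x + h *\<^sub>R axis j 1) + s *\<^sub>R axis j 1)) has_vector_derivative f' (t, x + h *\<^sub>R axis j 1)) (at 0)"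
      for f f' :: "(nat \<Rightarrow> real) \<times> (real^'n) \<Rightarrow> real^'n" and t h
      using has_vector_derivative_shiftD[of "\<lambda>s. f (t, x + s *\<^sub>R axis j 1)" h _ 0] that
      by (simp add: scaleR_add_left add.assoc)
    have "Ftx i j (?\<sigma> (0, 0), ?y (0, 0)) = Fxt j i (?\<sigma> (0, 0), ?y (0, 0))"
    proof (rule mixed_partials_commute[OF N(1), of 0 0 "\<lambda>s h. F (?\<sigma> (s, h), ?y (s, h))"
          "\<lambda>s h. Ft i (?\<sigma> (s, h), ?y (s, h))" "\<lambda>s h. Fx j (?\<sigma> (s, h), ?y (s, h))"
          "\<lambda>s h. Ftx i j (?\<sigma> (s, h), ?y (s, h))" "\<lambda>s h. Fxt j i (?\<sigma> (s, h), ?y (s, h))"])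
      show "(0, 0) \<in> {z. (?\<sigma> z, ?y z) \<in> S}" using x by (simp add: fun_upd_idem)
      show "continuous_on {z. (?\<sigma> z, ?y z) \<in> S} (\<lambda>(s, h). Ftx i j (?\<sigma> (s, h), ?y (s, h)))"
        using N(2)[OF Ck_param_on_continuous[OF Ftx(1)[OF i]]] by (simp add: split_beta)
      show "continuous_on {z. (?\<sigma> z, ?y z) \<in> S} (\<lambda>(s, h). Fxt j i (?\<sigma> (s, h), ?y (s, h)))"
        using N(2)[OF Ck_param_on_continuous[OF Fxt(1)[OF i]]] by (simp add: split_beta)
    next
      fix s h assume "(s, h) \<in> {z. (?\<sigma> z, ?y z) \<in> S}"
      then have m: "(?z(i := s), x + h *\<^sub>R axis j 1) \<in> S" by simp
      show "((\<lambda>s. F (?\<sigma> (s, h), ?y (s, h))) has_vector_derivative Ft i (?\<sigma> (s, h), ?y (s, h))) (at s)"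
        using Ft(2)[OF i m] by simp
      show "((\<lambda>s. Fx j (?\<sigma> (s, h), ?y (s, h))) has_vector_derivative Fxt j i (?\<sigma> (s, h), ?y (s, h))) (at s)"
        using Fxt(2)[OF i m] by simp
      show "((\<lambda>h. F (?\<sigma> (s, h), ?y (s, h))) has_vector_derivative Fx j (?\<sigma> (s, h), ?y (s, h))) (at h)"
        using sh[where f = F and f' = "Fx j" and t = "?z(i := s)" and h = h, OF Fx(2)[OF m]] by simp
      show "((\<lambda>h. Ft i (?\<sigma> (s, h), ?y (s, h))) has_vector_derivative Ftx i j (?\<sigma> (s, h), ?y (s, h))) (at h)"
        using sh[where f = "Ft i" and f' = "Ftx i j" and t = "?z(i := s)" and h = h, OF Ftx(2)[OF i m]] by simp
    qed
    then show ?thesis by (simp add: fun_upd_idem)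
  qed
  show thesis
  proof (rule that[OF X])
    fix a x assume a: "a \<in> Rspace r" and x: "(?z, x) \<in> S"
    show "((\<lambda>\<tau>. F ((\<lambda>i. \<tau> * a i), x)) has_vector_derivative (\<Sum>i<r. a i *\<^sub>R X i x)) (at 0)"
      unfolding X_def
      by (rule has_vector_derivative_param_line[OF S x a Ft(2)]) (auto intro: Ck_param_on_continuous Ft(1))
    fix h
    have DX: "frechet_derivative (X i) (at x) h = (\<Sum>j\<in>UNIV. h $ j *\<^sub>R Fxt j i (?z, x))" if i: "i < r" for i
    proof -
      have d: "(X i has_derivative frechet_derivative (X i) (at x)) (at x)"
        using Ck_on_SucD(1)[OF X[OF i, unfolded two]] x by blast
      have "frechet_derivative (X i) (at x) (axis j 1) = Fxt j i (?z, x)" for j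
        using axis_deriv[OF d, of j "Ftx i j (?z, x)"] Ftx(2)[OF i x] comm[OF i x] by (simp add: X_def)
      then show ?thesis
        using linear_expand_axis[OF has_derivative_linear[OF d], of h] by simp
    qed
    have c\<sigma>: "continuous_on UNIV (\<lambda>\<tau>. \<tau> * a i)" for i by (intro continuous_intros)
    have R: "(\<lambda>i. \<tau> * a i) \<in> Rspace r" for \<tau> using a by (auto simp: Rspace_def)
    let ?N = "{\<tau>. ((\<lambda>i. \<tau> * a i), x) \<in> S}"
    have N: "open ?N" "0 \<in> ?N"
      using open_param_pullback(1)[OF S c\<sigma> R continuous_on_const[of _ x]] x by auto
    have Dt: "frechet_derivative (\<lambda>y. F ((\<lambda>i. \<tau> * a i), y)) (at x) h
        = (\<Sum>j\<in>UNIV. h $ j *\<^sub>R Fx j ((\<lambda>i. \<tau> * a i), x))" if "\<tau> \<in> ?N" for \<tau>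
    proof -
      let ?U = "{y. ((\<lambda>i. \<tau> * a i), y) \<in> S}"
      have "((\<lambda>y. F ((\<lambda>i. \<tau> * a i), y)) has_derivative
          (\<lambda>h. \<Sum>j\<in>UNIV. h $ j *\<^sub>R Fx j ((\<lambda>i. \<tau> * a i), x))) (at x)"
        by (rule partial_derivs_imp_has_derivative[OF slice[OF R]])
          (use that Fx(2) Ck_on_imp_continuous_on[OF Ck_param_on_slice[OF S R Fx(1)]] in auto)
      from fun_cong[OF frechet_derivative_at[OF this], of h] show ?thesis by simp
    qed
    have "((\<lambda>\<tau>. \<Sum>j\<in>UNIV. h $ j *\<^sub>R Fx j ((\<lambda>i. \<tau> * a i), x)) has_vector_derivative
        (\<Sum>j\<in>UNIV. h $ j *\<^sub>R (\<Sum>i<r. a i *\<^sub>R Fxt j i (?z, x)))) (at 0)"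
      by (intro has_vector_derivative_sum bounded_linear.has_vector_derivative[OF bounded_linear_scaleR_right]
          has_vector_derivative_param_line[OF S x a Fxt(2)])
        (use Ck_param_on_continuous[OF Fxt(1)] in blast)+
    moreover have "(\<Sum>j\<in>UNIV. h $ j *\<^sub>R (\<Sum>i<r. a i *\<^sub>R Fxt j i (?z, x)))
        = (\<Sum>i<r. a i *\<^sub>R frechet_derivative (X i) (at x) h)"
      unfolding scaleR_sum_right by (subst sum.swap) (simp add: DX scaleR_sum_right mult.commute)
    ultimately have "((\<lambda>\<tau>. \<Sum>j\<in>UNIV. h $ j *\<^sub>R Fx j ((\<lambda>i. \<tau> * a i), x)) has_vector_derivative
        (\<Sum>i<r. a i *\<^sub>R frechet_derivative (X i) (at x) h)) (at 0)" by simp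
    then show "((\<lambda>\<tau>. frechet_derivative (\<lambda>y. F ((\<lambda>i. \<tau> * a i), y)) (at x) h) has_vector_derivative
        (\<Sum>i<r. a i *\<^sub>R frechet_derivative (X i) (at x) h)) (at 0)"
      by (rule has_vector_derivative_transform_within_open[OF _ N]) (simp add: Dt)
  qed
qed

section \<open>Infinitesimal torus actions\<close>

lemma has_vector_derivative_eventually_cong:
  assumes "(f has_vector_derivative D) (at x)" "\<forall>\<^sub>F s in nhds x. f s = g s"
  shows "(g has_vector_derivative D) (at x)"
proof -
  have "\<forall>\<^sub>F s in at x. f s = g s" using assms(2) by (auto simp: eventually_at_filter elim: eventually_mono)
  then show ?thesis
    using assms(1) eventually_nhds_x_imp_x[OF assms(2)]
    unfolding has_vector_derivative_def by (auto intro: has_derivative_transform_eventually)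
qed

lemma eventually_in_open_of_has_vector_derivative:
  assumes "(c has_vector_derivative D) (at x)" "open S" "c x \<in> S"
  shows "\<forall>\<^sub>F s in nhds x. c s \<in> S"
proof -
  have "(c \<longlongrightarrow> c x) (at x)"
    using has_vector_derivative_continuous[OF assms(1)] by (simp add: continuous_at)
  then have "(c \<longlongrightarrow> c x) (nhds x)" by (simp add: tendsto_at_iff_tendsto_nhds)
  then show ?thesis using assms(2,3) by (rule topological_tendstoD)
qed

text \<open>The hypothesis is shifted to 0 because the group law yields derivatives in exactly this
  form.\<close>

lemma has_vector_derivative_zero_imp_const:
  fixes y :: "real \<Rightarrow> 'b::real_normed_vector"
  assumes "\<And>\<tau>. \<bar>\<tau>\<bar> < d \<Longrightarrow> ((\<lambda>s. y (\<tau> + s)) has_vector_derivative 0) (at 0)" "\<bar>\<tau>\<bar> < d"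
  shows "y \<tau> = y 0"
proof -
  have "(y has_derivative (\<lambda>h. 0)) (at t within ball 0 d)" if "t \<in> ball 0 d" for t
    using has_vector_derivative_shiftD[OF assms(1), of t] that
    by (auto simp: has_vector_derivative_def intro: has_derivative_at_withinI)
  from has_derivative_zero_constant[OF convex_ball this]
  obtain c where "\<forall>t\<in>ball 0 d. y t = c" by blast
  then show ?thesis using assms(2) by auto
qed

text \<open>Independence of an indexed family is more than independence of its range: it includes
  injectivity, which is extracted first.\<close>

lemma dual_functionals:
  fixes v :: "'i \<Rightarrow> 'a::euclidean_space"
  assumes K: "finite K" and indep: "\<And>b. (\<Sum>j\<in>K. b j *\<^sub>R v j) = 0 \<Longrightarrow> \<forall>j\<in>K. b j = 0"
  obtains \<kappa> where "\<And>j. linear (\<kappa> j :: 'a \<Rightarrow> real)"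
    "\<And>i j. i \<in> K \<Longrightarrow> j \<in> K \<Longrightarrow> \<kappa> j (v i) = (if i = j then 1 else 0)"
    "dim (span (v ` K)) = card K"
proof -
  have inj: "inj_on v K"
  proof (rule inj_onI, rule ccontr)
    fix i j assume ij: "i \<in> K" "j \<in> K" "v i = v j" "i \<noteq> j"
    let ?b = "\<lambda>l. (if l = i then 1 else 0) - (if l = j then 1 else 0) :: real"
    have "(\<Sum>l\<in>K. ?b l *\<^sub>R v l) = v i - v j"
      using ij K by (simp add: scaleR_diff_left sum_subtractf if_distrib[of "\<lambda>c. c *\<^sub>R _"] cong: if_cong)
    then have "?b i = 0" using indep[of ?b] ij by auto
    then show False using ij(4) by simp
  qed
  have ind: "independent (v ` K)"
    unfolding dependent_finite[OF finite_imageI[OF K]]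
  proof clarify
    fix u j assume "(\<Sum>w\<in>v ` K. u w *\<^sub>R w) = 0" and j: "j \<in> K" "u (v j) \<noteq> 0"
    then have "(\<Sum>j\<in>K. u (v j) *\<^sub>R v j) = 0" by (simp add: sum.reindex[OF inj])
    then show False using indep[of "\<lambda>j. u (v j)"] j by auto
  qed
  from ind have "\<exists>g. linear g \<and> (\<forall>x\<in>v ` K. g x = (if x = v j then 1 else 0 :: real))" for j
    by (rule linear_independent_extend)
  then obtain \<kappa> where "\<And>j. linear (\<kappa> j :: 'a \<Rightarrow> real)"
    "\<And>j x. x \<in> v ` K \<Longrightarrow> \<kappa> j x = (if x = v j then 1 else 0)" by metis
  moreover have "dim (span (v ` K)) = card K"
    using dim_span_eq_card_independent[OF ind] card_image[OF inj] by simp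
  ultimately show thesis using that[of \<kappa>] inj by (simp add: inj_on_eq_iff)
qed

text \<open>Dual functionals give the quantitative bound \<open>low\<close>. Moving each vector by
  less than \<open>1 / (2 * D)\<close> can use up at most half of it, so independence is an open
  condition.\<close>

lemma eventually_independent:
  fixes v :: "'i \<Rightarrow> 'a::euclidean_space"
  assumes K: "finite K" and indep: "\<And>b. (\<Sum>j\<in>K. b j *\<^sub>R v j) = 0 \<Longrightarrow> \<forall>j\<in>K. b j = 0"
    and lim: "\<And>j. j \<in> K \<Longrightarrow> ((\<lambda>s. F s j) \<longlongrightarrow> v j) A"
  shows "\<forall>\<^sub>F s in A. \<forall>b. (\<Sum>j\<in>K. b j *\<^sub>R F s j) = 0 \<longrightarrow> (\<forall>j\<in>K. b j = 0)"
proof -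
  obtain \<kappa> where \<kappa>: "\<And>j. linear (\<kappa> j :: 'a \<Rightarrow> real)"
    "\<And>i j. i \<in> K \<Longrightarrow> j \<in> K \<Longrightarrow> \<kappa> j (v i) = (if i = j then 1 else 0)"
    using dual_functionals[OF K indep] by metis
  have "\<exists>C. \<forall>x. \<bar>\<kappa> j x\<bar> \<le> norm x * C" for j
    using bounded_linear.bounded[OF linear_conv_bounded_linear[THEN iffD1, OF \<kappa>(1)], of j] by simp
  then obtain C where C: "\<And>j x. \<bar>\<kappa> j x\<bar> \<le> norm x * C j" by metis
  define D where "D = (\<Sum>j\<in>K. \<bar>C j\<bar>) + 1"
  have D: "D > 0" unfolding D_def by (simp add: add_nonneg_pos sum_nonneg)
  have low: "(\<Sum>j\<in>K. \<bar>b j\<bar>) \<le> D * norm (\<Sum>j\<in>K. b j *\<^sub>R v j)" for b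
  proof -
    have "\<bar>b j\<bar> \<le> \<bar>C j\<bar> * norm (\<Sum>j\<in>K. b j *\<^sub>R v j)" if j: "j \<in> K" for j
    proof -
      have "\<kappa> j (\<Sum>i\<in>K. b i *\<^sub>R v i) = (\<Sum>i\<in>K. b i * (if i = j then 1 else 0))"
        using \<kappa>(1)[of j] \<kappa>(2) j by (simp add: linear_sum linear_scale)
      also have "\<dots> = b j" using j K by (simp add: if_distrib[of "\<lambda>c. b _ * c"] cong: if_cong)
      finally have "\<bar>b j\<bar> \<le> norm (\<Sum>i\<in>K. b i *\<^sub>R v i) * C j" using C by metis
      also have "\<dots> \<le> norm (\<Sum>i\<in>K. b i *\<^sub>R v i) * \<bar>C j\<bar>" by (intro mult_left_mono) auto
      finally show ?thesis by (simp add: mult.commute)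
    qed
    then have "(\<Sum>j\<in>K. \<bar>b j\<bar>) \<le> (\<Sum>j\<in>K. \<bar>C j\<bar>) * norm (\<Sum>j\<in>K. b j *\<^sub>R v j)"
      unfolding sum_distrib_right by (rule sum_mono)
    also have "\<dots> \<le> D * norm (\<Sum>j\<in>K. b j *\<^sub>R v j)" unfolding D_def by (intro mult_right_mono) auto
    finally show ?thesis .
  qed
  have "\<forall>j\<in>K. \<forall>\<^sub>F s in A. dist (F s j) (v j) < 1 / (2 * D)"
    using lim D by (auto intro: tendstoD)
  then have "\<forall>\<^sub>F s in A. \<forall>j\<in>K. dist (F s j) (v j) < 1 / (2 * D)"
    using K by (simp add: eventually_ball_finite_distrib)
  then show ?thesis
  proof (rule eventually_mono, intro allI impI)
    fix s b assume close: "\<forall>j\<in>K. dist (F s j) (v j) < 1 / (2 * D)" and 0: "(\<Sum>j\<in>K. b j *\<^sub>R F s j) = 0"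
    have "norm (\<Sum>j\<in>K. b j *\<^sub>R v j) = norm (\<Sum>j\<in>K. b j *\<^sub>R (F s j - v j))"
      using 0 by (simp add: scaleR_diff_right sum_subtractf)
    also have "\<dots> \<le> (\<Sum>j\<in>K. \<bar>b j\<bar> * norm (F s j - v j))" by (rule order_trans[OF norm_sum]) simp
    also have "\<dots> \<le> (\<Sum>j\<in>K. \<bar>b j\<bar> * (1 / (2 * D)))"
      using close by (intro sum_mono mult_left_mono) (auto simp: dist_norm less_imp_le)
    also have "\<dots> = (\<Sum>j\<in>K. \<bar>b j\<bar>) * (1 / (2 * D))" by (simp only: sum_distrib_right)
    finally have "D * norm (\<Sum>j\<in>K. b j *\<^sub>R v j) \<le> D * ((\<Sum>j\<in>K. \<bar>b j\<bar>) * (1 / (2 * D)))"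
      using D by (intro mult_left_mono) auto
    also have "\<dots> = (\<Sum>j\<in>K. \<bar>b j\<bar>) / 2" using D by simp
    finally have "(\<Sum>j\<in>K. \<bar>b j\<bar>) \<le> (\<Sum>j\<in>K. \<bar>b j\<bar>) / 2" using low[of b] by linarith
    then have "(\<Sum>j\<in>K. \<bar>b j\<bar>) = 0" using sum_nonneg[of K "\<lambda>j. \<bar>b j\<bar>"] by linarith
    then show "\<forall>j\<in>K. b j = 0" using K by (simp add: sum_nonneg_eq_0_iff)
  qed
qed

text \<open>The action as one chart sees it. \<open>f t\<close> is controlled on \<open>V t\<close>,
  the points that \<open>t\<close> keeps in the chart, and the group law holds whenever the
  intermediate point stays there. Parameters live in the covering space, where straight lines are
  one-parameter subgroups.\<close>

locale local_torus_action = local_metric U G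
  for U :: "(real^'n::finite) set" and G :: "real^'n \<Rightarrow> real^'n^'n" +
  fixes r :: nat and V :: "(nat \<Rightarrow> real) \<Rightarrow> (real^'n) set"
    and f :: "(nat \<Rightarrow> real) \<Rightarrow> real^'n \<Rightarrow> real^'n" and X :: "nat \<Rightarrow> real^'n \<Rightarrow> real^'n"
  assumes V: "\<And>t. t \<in> Rspace r \<Longrightarrow> open (V t)" "\<And>t. t \<in> Rspace r \<Longrightarrow> V t \<subseteq> U"
    and f_Ck: "\<And>t k. t \<in> Rspace r \<Longrightarrow> Ck_on k (V t) (f t)"
    and f_im: "\<And>t. t \<in> Rspace r \<Longrightarrow> f t ` V t \<subseteq> U"
    and f_iso: "\<And>t x u v. t \<in> Rspace r \<Longrightarrow> x \<in> V t \<Longrightarrow>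
      bilin (G (f t x)) (frechet_derivative (f t) (at x) u) (frechet_derivative (f t) (at x) v) = bilin (G x) u v"
    and f_add: "\<And>s t x. s \<in> Rspace r \<Longrightarrow> t \<in> Rspace r \<Longrightarrow> x \<in> V t \<Longrightarrow> f t x \<in> V s \<Longrightarrow>
      x \<in> V (\<lambda>i. s i + t i) \<and> f (\<lambda>i. s i + t i) x = f s (f t x)"
    and f_zero: "\<And>x. x \<in> U \<Longrightarrow> x \<in> V (\<lambda>i. 0) \<and> f (\<lambda>i. 0) x = x"
    and V_near: "\<And>a x. a \<in> Rspace r \<Longrightarrow> x \<in> U \<Longrightarrow> \<forall>\<^sub>F \<tau> in nhds 0. x \<in> V (\<lambda>i. \<tau> * a i)"
    and X_Ck: "\<And>i. i < r \<Longrightarrow> Ck_on 2 U (X i)"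
    and f_deriv: "\<And>a x. a \<in> Rspace r \<Longrightarrow> x \<in> U \<Longrightarrow>
      ((\<lambda>\<tau>. f (\<lambda>i. \<tau> * a i) x) has_vector_derivative (\<Sum>i<r. a i *\<^sub>R X i x)) (at 0)"
    and Df_deriv: "\<And>a x h. a \<in> Rspace r \<Longrightarrow> x \<in> U \<Longrightarrow>
      ((\<lambda>\<tau>. frechet_derivative (f (\<lambda>i. \<tau> * a i)) (at x) h) has_vector_derivative
        (\<Sum>i<r. a i *\<^sub>R frechet_derivative (X i) (at x) h)) (at 0)"
begin

text \<open>The fundamental vector field of \<open>a\<close>, seen as an element of the Lie algebra
  of the torus.\<close>

definition gen :: "(nat \<Rightarrow> real) \<Rightarrow> real^'n \<Rightarrow> real^'n" where
  "gen a x = (\<Sum>i<r. a i *\<^sub>R X i x)"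

abbreviation "Df t x \<equiv> frechet_derivative (f t) (at x)"
abbreviation "Dgen a x \<equiv> frechet_derivative (gen a) (at x)"

lemma Rspace_scale: "a \<in> Rspace r \<Longrightarrow> (\<lambda>i. \<tau> * a i) \<in> Rspace r"
  by (auto simp: Rspace_def)

lemma gen_Ck: "Ck_on 2 U (gen a)"
  unfolding gen_def by (intro Ck_on_sum Ck_on_bounded_linear[OF bounded_linear_scaleR_right] X_Ck) auto

lemma gen_has_derivative: "x \<in> U \<Longrightarrow> (gen a has_derivative Dgen a x) (at x)"
  using Ck_on_SucD(1)[OF gen_Ck[unfolded Suc_1[symmetric]]] .

lemma Dgen: "x \<in> U \<Longrightarrow> Dgen a x h = (\<Sum>i<r. a i *\<^sub>R frechet_derivative (X i) (at x) h)"
proof -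
  assume x: "x \<in> U"
  have "(X i has_derivative frechet_derivative (X i) (at x)) (at x)" if "i < r" for i
    using Ck_on_SucD(1)[OF X_Ck[OF that, unfolded Suc_1[symmetric]] x] .
  then have "(gen a has_derivative (\<lambda>h. \<Sum>i<r. a i *\<^sub>R frechet_derivative (X i) (at x) h)) (at x)"
    unfolding gen_def by (intro has_derivative_sum has_derivative_scaleR_right) simp
  from fun_cong[OF frechet_derivative_at[OF this], of h] show ?thesis by simp
qed

lemma f_has_derivative: "t \<in> Rspace r \<Longrightarrow> x \<in> V t \<Longrightarrow> (f t has_derivative Df t x) (at x)"
  using Ck_on_SucD(1)[OF f_Ck] .

lemma f_line_deriv:
  "a \<in> Rspace r \<Longrightarrow> x \<in> U \<Longrightarrow> ((\<lambda>\<tau>. f (\<lambda>i. \<tau> * a i) x) has_vector_derivative gen a x) (at 0)"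
  unfolding gen_def by (rule f_deriv)

lemma Df_line_deriv:
  "a \<in> Rspace r \<Longrightarrow> x \<in> U \<Longrightarrow> ((\<lambda>\<tau>. Df (\<lambda>i. \<tau> * a i) x h) has_vector_derivative Dgen a x h) (at 0)"
  using Df_deriv Dgen by simp

lemma Df_zero: "x \<in> U \<Longrightarrow> Df (\<lambda>i. 0) x = (\<lambda>u. u)"
proof -
  assume x: "x \<in> U"
  have "(f (\<lambda>i. 0) has_derivative (\<lambda>u. u)) (at x)"
    by (rule has_derivative_transform_within_open[OF has_derivative_ident open_U x]) (simp add: f_zero)
  from frechet_derivative_at[OF this] show ?thesis by simp
qed

lemma composed_line_deriv:
  assumes t: "t \<in> Rspace r" and b: "b \<in> Rspace r" and x: "x \<in> V t"
  shows "((\<lambda>s. f t (f (\<lambda>i. s * b i) x)) has_vector_derivative Df t x (gen b x)) (at 0)"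
    and "\<forall>\<^sub>F s in nhds 0. f (\<lambda>i. t i + s * b i) x = f t (f (\<lambda>i. s * b i) x)"
proof -
  have xU: "x \<in> U" using V(2)[OF t] x by blast
  note c = f_line_deriv[OF b xU]
  have c0: "f (\<lambda>i. 0 * b i) x = x" using f_zero[OF xU] by simp
  have "((\<lambda>s. f t (f (\<lambda>i. s * b i) x)) has_derivative (\<lambda>s. Df t x (s *\<^sub>R gen b x))) (at 0)"
    by (rule has_derivative_compose[OF c[unfolded has_vector_derivative_def]])
      (use f_has_derivative[OF t x] c0 in simp)
  then show "((\<lambda>s. f t (f (\<lambda>i. s * b i) x)) has_vector_derivative Df t x (gen b x)) (at 0)"
    using linear_scale[OF has_derivative_linear[OF f_has_derivative[OF t x]]]
    by (simp add: has_vector_derivative_def)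
  have "\<forall>\<^sub>F s in nhds 0. f (\<lambda>i. s * b i) x \<in> V t"
    by (rule eventually_in_open_of_has_vector_derivative[OF c V(1)[OF t]]) (use c0 x in simp)
  then show "\<forall>\<^sub>F s in nhds 0. f (\<lambda>i. t i + s * b i) x = f t (f (\<lambda>i. s * b i) x)"
    using V_near[OF b xU]
  proof (rule eventually_elim2)
    fix s assume "f (\<lambda>i. s * b i) x \<in> V t" "x \<in> V (\<lambda>i. s * b i)"
    then show "f (\<lambda>i. t i + s * b i) x = f t (f (\<lambda>i. s * b i) x)"
      using f_add[OF t Rspace_scale[OF b]] by blast
  qed
qed

text \<open>The torus is abelian: \<open>t\<close> followed by a short motion along \<open>b\<close>
  equals the motion followed by \<open>t\<close>. Differentiation at time 0 shows that the
  generators are invariant.\<close>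

lemma Df_gen:
  assumes t: "t \<in> Rspace r" and b: "b \<in> Rspace r" and x: "x \<in> V t"
  shows "Df t x (gen b x) = gen b (f t x)"
proof -
  have fU: "f t x \<in> U" using f_im[OF t] x by blast
  have "\<forall>\<^sub>F s in nhds 0. f (\<lambda>i. s * b i) (f t x) = f (\<lambda>i. t i + s * b i) x"
    using V_near[OF b fU]
  proof (rule eventually_mono)
    fix s assume "f t x \<in> V (\<lambda>i. s * b i)"
    then show "f (\<lambda>i. s * b i) (f t x) = f (\<lambda>i. t i + s * b i) x"
      using f_add[OF Rspace_scale[OF b] t x] by (simp add: add.commute)
  qed
  then have "\<forall>\<^sub>F s in nhds 0. f (\<lambda>i. s * b i) (f t x) = f t (f (\<lambda>i. s * b i) x)"
    using composed_line_deriv(2)[OF t b x] by (rule eventually_elim2) simp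
  from has_vector_derivative_eventually_cong[OF f_line_deriv[OF b fU] this]
  show ?thesis using composed_line_deriv(1)[OF t b x] vector_derivative_unique_at by blast
qed

text \<open>Invariance of \<open>gen b\<close> under the flow of \<open>a\<close> is differentiated
  at time 0; one side is the chain rule, the other the derivative of \<open>Df\<close> in
  time.\<close>

lemma gen_commuting:
  assumes a: "a \<in> Rspace r" and b: "b \<in> Rspace r"
  shows "commuting_fields (gen a) (gen b)"
  unfolding commuting_fields_def
proof
  fix x assume x: "x \<in> U"
  have c0: "f (\<lambda>i. 0 * a i) x = x" using f_zero[OF x] by simp
  have "((\<lambda>\<tau>. gen b (f (\<lambda>i. \<tau> * a i) x)) has_derivative (\<lambda>s. Dgen b x (s *\<^sub>R gen a x))) (at 0)"
    by (rule has_derivative_compose[OF f_line_deriv[OF a x, unfolded has_vector_derivative_def]])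
      (use gen_has_derivative[OF x] c0 in simp)
  then have "((\<lambda>\<tau>. gen b (f (\<lambda>i. \<tau> * a i) x)) has_vector_derivative Dgen b x (gen a x)) (at 0)"
    using linear_scale[OF has_derivative_linear[OF gen_has_derivative[OF x]]]
    by (simp add: has_vector_derivative_def)
  moreover have "\<forall>\<^sub>F \<tau> in nhds 0. gen b (f (\<lambda>i. \<tau> * a i) x) = Df (\<lambda>i. \<tau> * a i) x (gen b x)"
    using V_near[OF a x] by (rule eventually_mono) (use Df_gen[OF Rspace_scale[OF a] b] in simp)
  ultimately have "((\<lambda>\<tau>. Df (\<lambda>i. \<tau> * a i) x (gen b x)) has_vector_derivative Dgen b x (gen a x)) (at 0)"
    by (rule has_vector_derivative_eventually_cong)
  then show "Dgen a x (gen b x) = Dgen b x (gen a x)"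
    using Df_line_deriv[OF a x, of "gen b x"] vector_derivative_unique_at by blast
qed

text \<open>The isometry equation along \<open>\<tau> a\<close> is constant in \<tau>; its
  derivative at 0 is the Killing equation.\<close>

lemma gen_killing:
  assumes a: "a \<in> Rspace r"
  shows "killing_field (gen a)"
  unfolding killing_field_def
proof (intro conjI gen_Ck ballI allI)
  fix x u v assume x: "x \<in> U"
  have c0: "f (\<lambda>i. 0 * a i) x = x" "Df (\<lambda>i. 0 * a i) x = (\<lambda>u. u)"
    using f_zero[OF x] Df_zero[OF x] by simp_all
  have dM: "((\<lambda>\<tau>. G (f (\<lambda>i. \<tau> * a i) x)) has_derivative (\<lambda>s. dG x (s *\<^sub>R gen a x))) (at 0)"
    by (rule has_derivative_compose[OF f_line_deriv[OF a x, unfolded has_vector_derivative_def]])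
      (use has_derivative_G[OF x] c0 in simp)
  have D: "((\<lambda>\<tau>. bilin (G (f (\<lambda>i. \<tau> * a i) x)) (Df (\<lambda>i. \<tau> * a i) x u) (Df (\<lambda>i. \<tau> * a i) x v)) has_derivative
    (\<lambda>s. bilin (dG x (s *\<^sub>R gen a x)) u v + bilin (G x) (s *\<^sub>R Dgen a x u) v
      + bilin (G x) u (s *\<^sub>R Dgen a x v))) (at 0)"
    using has_derivative_bilin[OF dM Df_line_deriv[OF a x, of u, unfolded has_vector_derivative_def]
        Df_line_deriv[OF a x, of v, unfolded has_vector_derivative_def] refl] unfolding c0 .
  have "\<forall>\<^sub>F \<tau> in nhds 0. bilin (G (f (\<lambda>i. \<tau> * a i) x)) (Df (\<lambda>i. \<tau> * a i) x u) (Df (\<lambda>i. \<tau> * a i) x v) = bilin (G x) u v"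
    using V_near[OF a x] by (rule eventually_mono) (rule f_iso[OF Rspace_scale[OF a]])
  then obtain S where S: "open S" "0 \<in> S"
    "\<And>\<tau>. \<tau> \<in> S \<Longrightarrow> bilin (G (f (\<lambda>i. \<tau> * a i) x)) (Df (\<lambda>i. \<tau> * a i) x u) (Df (\<lambda>i. \<tau> * a i) x v) = bilin (G x) u v"
    unfolding eventually_nhds by metis
  from has_derivative_unique[OF has_derivative_transform_within_open[OF D S] has_derivative_const]
  show "bilin (dG x (gen a x)) u v + bilin (G x) (Dgen a x u) v + bilin (G x) u (Dgen a x v) = 0"
    by (auto dest: fun_cong[of _ _ 1])
qed

text \<open>By the group law the derivatives at \<tau> of the orbit and of \<open>Df\<close> at
  \<open>q\<close> are \<open>Df\<close> applied to \<open>gen a q\<close> and to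
  \<open>Dgen a q h\<close>. Both vanish, so orbit and derivative are constant, with no uniqueness
  theorem for flows.\<close>

lemma stationary_point:
  assumes a: "a \<in> Rspace r" and q: "q \<in> U" "gen a q = 0" "\<And>h. Dgen a q h = 0"
  obtains d where "d > 0" "\<And>\<tau>. \<bar>\<tau>\<bar> < d \<Longrightarrow> q \<in> V (\<lambda>i. \<tau> * a i) \<and> f (\<lambda>i. \<tau> * a i) q = q
    \<and> Df (\<lambda>i. \<tau> * a i) q = (\<lambda>u. u)"
proof -
  obtain d where d: "d > 0" "\<And>\<tau>. \<bar>\<tau>\<bar> < d \<Longrightarrow> q \<in> V (\<lambda>i. \<tau> * a i)"
    using V_near[OF a q(1)] unfolding eventually_nhds_metric by (auto simp: dist_norm)
  have lin: "bounded_linear (Df (\<lambda>i. \<tau> * a i) q)" if "\<bar>\<tau>\<bar> < d" for \<tau>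
    using f_has_derivative[OF Rspace_scale[OF a] d(2)[OF that]] has_derivative_bounded_linear by blast
  have fix_q: "f (\<lambda>i. \<tau> * a i) q = q" if "\<bar>\<tau>\<bar> < d" for \<tau>
  proof -
    have "f (\<lambda>i. \<tau> * a i) q = f (\<lambda>i. 0 * a i) q"
    proof (rule has_vector_derivative_zero_imp_const[OF _ that])
      fix \<tau> assume \<tau>: "\<bar>\<tau>\<bar> < d"
      note c = composed_line_deriv[OF Rspace_scale[OF a] a d(2)[OF \<tau>]]
      have "\<forall>\<^sub>F s in nhds 0. f (\<lambda>i. \<tau> * a i) (f (\<lambda>i. s * a i) q) = f (\<lambda>i. (\<tau> + s) * a i) q"
        using c(2) by (rule eventually_mono) (simp add: distrib_right)
      from has_vector_derivative_eventually_cong[OF c(1) this]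
      show "((\<lambda>s. f (\<lambda>i. (\<tau> + s) * a i) q) has_vector_derivative 0) (at 0)"
        using q(2) linear_0[OF bounded_linear.linear[OF lin[OF \<tau>]]] by simp
    qed
    then show ?thesis using f_zero[OF q(1)] by simp
  qed
  have Df_q: "Df (\<lambda>i. \<tau> * a i) q h = h" if "\<bar>\<tau>\<bar> < d" for \<tau> h
  proof -
    have "Df (\<lambda>i. \<tau> * a i) q h = Df (\<lambda>i. 0 * a i) q h"
    proof (rule has_vector_derivative_zero_imp_const[OF _ that])
      fix \<tau> assume \<tau>: "\<bar>\<tau>\<bar> < d"
      have "((\<lambda>s. Df (\<lambda>i. \<tau> * a i) q (Df (\<lambda>i. s * a i) q h)) has_vector_derivative
          Df (\<lambda>i. \<tau> * a i) q (Dgen a q h)) (at 0)"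
        by (rule bounded_linear.has_vector_derivative[OF lin[OF \<tau>] Df_line_deriv[OF a q(1)]])
      then have 1: "((\<lambda>s. Df (\<lambda>i. \<tau> * a i) q (Df (\<lambda>i. s * a i) q h)) has_vector_derivative 0) (at 0)"
        using q(3) linear_0[OF bounded_linear.linear[OF lin[OF \<tau>]]] by simp
      have "\<forall>\<^sub>F s in nhds 0. \<bar>s\<bar> < d"
        unfolding eventually_nhds_metric using d(1) by (auto simp: dist_norm)
      then have "\<forall>\<^sub>F s in nhds 0. Df (\<lambda>i. \<tau> * a i) q (Df (\<lambda>i. s * a i) q h) = Df (\<lambda>i. (\<tau> + s) * a i) q h"
      proof (rule eventually_mono)
        fix s assume s: "\<bar>s\<bar> < d"
        let ?t = "\<lambda>i. \<tau> * a i" and ?s = "\<lambda>i. s * a i"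
        note R = Rspace_scale[OF a, of \<tau>] Rspace_scale[OF a, of s]
        let ?N = "V ?s \<inter> f ?s -` V ?t"
        have "open ?N"
          using continuous_on_open_vimage[OF V(1)[OF R(2)]] Ck_on_imp_continuous_on[OF f_Ck[OF R(2)]] V(1)[OF R(1)]
          by (metis Int_commute)
        moreover have "q \<in> ?N" using d(2)[OF s] d(2)[OF \<tau>] fix_q[OF s] by simp
        moreover have "((\<lambda>x. f ?t (f ?s x)) has_derivative (\<lambda>h. Df ?t q (Df ?s q h))) (at q)"
          by (rule has_derivative_compose[OF f_has_derivative[OF R(2) d(2)[OF s]]])
            (use f_has_derivative[OF R(1) d(2)[OF \<tau>]] fix_q[OF s] in simp)
        moreover have "f ?t (f ?s x) = f (\<lambda>i. (\<tau> + s) * a i) x" if "x \<in> ?N" for x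
          using f_add[OF R, of x] that by (simp add: distrib_right)
        ultimately have "(f (\<lambda>i. (\<tau> + s) * a i) has_derivative (\<lambda>h. Df ?t q (Df ?s q h))) (at q)"
          using has_derivative_transform_within_open by blast
        from fun_cong[OF frechet_derivative_at[OF this], of h]
        show "Df ?t q (Df ?s q h) = Df (\<lambda>i. (\<tau> + s) * a i) q h" .
      qed
      then show "((\<lambda>s. Df (\<lambda>i. (\<tau> + s) * a i) q h) has_vector_derivative 0) (at 0)"
        by (rule has_vector_derivative_eventually_cong[OF 1])
    qed
    then show ?thesis using Df_zero[OF q(1)] by simp
  qed
  show thesis using that[OF d(1)] d(2) fix_q Df_q by blast
qed

lemma gen_unit: "j < r \<Longrightarrow> gen (\<lambda>i. if i = j then 1 else 0) = X j"
  by (rule ext) (simp add: gen_def if_distrib[of "\<lambda>c. c *\<^sub>R _"] cong: if_cong)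

lemma unit_Rspace: "j < r \<Longrightarrow> (\<lambda>i. if i = j then 1 else 0) \<in> Rspace r"
  by (auto simp: Rspace_def)

text \<open>A maximal family of generators independent somewhere in \<open>B\<close> is the whole family: otherwise a
  combination of generators vanishes to first order at a point.\<close>

lemma exists_free_point:
  assumes B: "open B" "B \<noteq> {}" "B \<subseteq> U"
    and faithful: "\<And>a q. a \<in> Rspace r \<Longrightarrow> q \<in> U \<Longrightarrow> gen a q = 0 \<Longrightarrow> (\<And>h. Dgen a q h = 0) \<Longrightarrow> \<forall>i<r. a i = 0"
  shows "\<exists>q\<in>B. \<forall>b. gen b q = 0 \<longrightarrow> (\<forall>i<r. b i = 0)"
proof -
  define free where "free = (\<lambda>J q. \<forall>b. (\<Sum>j\<in>J. b j *\<^sub>R X j q) = 0 \<longrightarrow> (\<forall>j\<in>J. b j = 0))"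
  define \<F> where "\<F> = {J \<in> Pow {..<r}. \<exists>q\<in>B. free J q}"
  have "finite \<F>" by (simp add: \<F>_def)
  moreover have "{} \<in> \<F>" using B(2) by (auto simp: \<F>_def free_def)
  ultimately obtain J where J: "J \<in> \<F>" "\<And>J'. J' \<in> \<F> \<Longrightarrow> J \<subseteq> J' \<Longrightarrow> J = J'"
    using finite_has_maximal[of \<F>] by blast
  then obtain q where Jr: "J \<subseteq> {..<r}" and q: "q \<in> B" "free J q" by (auto simp: \<F>_def)
  have finJ: "finite J" using Jr finite_subset by blast
  have qU: "q \<in> U" using q(1) B(3) by blast
  have "J = {..<r}"
  proof (rule ccontr)
    assume "J \<noteq> {..<r}"
    then obtain i where i: "i < r" "i \<notin> J" using Jr by auto
    have not_free: "\<not> free (insert i J) q'" if "q' \<in> B" for q'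
    proof
      assume "free (insert i J) q'"
      then have "insert i J \<in> \<F>" using that Jr i(1) by (auto simp: \<F>_def)
      then show False using J(2) i(2) by blast
    qed
    then obtain a0 where a0: "(\<Sum>j\<in>insert i J. a0 j *\<^sub>R X j q) = 0" "\<exists>j\<in>insert i J. a0 j \<noteq> 0"
      using q(1) unfolding free_def by blast
    define a where "a = (\<lambda>j. if j \<in> insert i J then a0 j else 0)"
    have aR: "a \<in> Rspace r" using Jr i(1) by (auto simp: a_def Rspace_def)
    have gen_a: "gen a y = a i *\<^sub>R X i y + (\<Sum>j\<in>J. a j *\<^sub>R X j y)" for y
    proof -
      have "gen a y = (\<Sum>j\<in>insert i J. a j *\<^sub>R X j y)"
        unfolding gen_def using Jr i(1) by (intro sum.mono_neutral_right) (auto simp: a_def)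
      then show ?thesis using finJ i(2) by simp
    qed
    have ga: "gen a q = 0"
      using a0(1) finJ i(2) unfolding gen_a by (simp add: a_def cong: sum.cong)
    have ai: "a i \<noteq> 0"
    proof
      assume "a i = 0"
      then have "\<forall>j\<in>J. a j = 0" using ga q(2) unfolding gen_a free_def by simp
      then show False using a0(2) \<open>a i = 0\<close> by (auto simp: a_def)
    qed
    define L where "L = Dgen a q"
    have dL: "(gen a has_derivative L) (at q)" unfolding L_def by (rule gen_has_derivative[OF qU])
    have linL: "linear L" using dL has_derivative_linear by blast
    have LX: "L (X j q) = 0" if j: "j < r" for j
    proof -
      have "L (X j q) = frechet_derivative (X j) (at q) (gen a q)"
        using gen_commuting[OF aR unit_Rspace[OF j]] qU
        by (simp add: commuting_fields_def gen_unit[OF j] L_def)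
      moreover have "linear (frechet_derivative (X j) (at q))"
        using gen_has_derivative[OF qU, of "\<lambda>i. if i = j then 1 else 0"] has_derivative_linear
        unfolding gen_unit[OF j] by blast
      ultimately show ?thesis using ga linear_0 by simp
    qed
    \<comment> \<open>Once \<open>L Y\<close> lies in the span of the generators, \<open>LX\<close>
      gives \<open>L (L Y) = 0\<close>, and the Killing equation at the zero \<open>q\<close> turns
      this into vanishing length of \<open>L Y\<close>.\<close>
    have "L Y = 0" for Y
    proof -
      have "\<exists>b. L Y = (\<Sum>j\<in>J. b j *\<^sub>R X j q)"
      proof (rule ccontr)
        assume notin: "\<nexists>b. L Y = (\<Sum>j\<in>J. b j *\<^sub>R X j q)"
        \<comment> \<open>If \<open>L Y\<close> were outside the span, this family would be
          independent. The rescaled family \<open>?F s\<close> at \<open>q + s Y\<close> converges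
          to it, so rank beyond that of \<open>J\<close> would occur in \<open>B\<close>, against
          maximality.\<close>
        let ?v = "\<lambda>j. if j = i then L Y else X j q"
        let ?F = "\<lambda>s j. if j = i then (1/s) *\<^sub>R gen a (q + s *\<^sub>R Y) else X j (q + s *\<^sub>R Y)"
        have sumJ: "(\<Sum>j\<in>insert i J. b j *\<^sub>R (if j = i then w else z j)) = b i *\<^sub>R w + (\<Sum>j\<in>J. b j *\<^sub>R z j)"
          for b :: "nat \<Rightarrow> real" and w :: "real^'n" and z
        proof -
          have "(\<Sum>j\<in>J. b j *\<^sub>R (if j = i then w else z j)) = (\<Sum>j\<in>J. b j *\<^sub>R z j)"
            using i(2) by (intro sum.cong) auto
          then show ?thesis using finJ i(2) by simp
        qed
        have line: "((\<lambda>s. q + s *\<^sub>R Y) has_derivative (\<lambda>s. s *\<^sub>R Y)) (at 0)"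
          by (auto intro!: derivative_eq_intros)
        have tq: "((\<lambda>s. q + s *\<^sub>R Y) \<longlongrightarrow> q) (at 0)"
          by (auto intro!: tendsto_eq_intros)
        have indep: "\<forall>j\<in>insert i J. b j = 0" if "(\<Sum>j\<in>insert i J. b j *\<^sub>R ?v j) = 0" for b
        proof -
          have 0: "b i *\<^sub>R L Y + (\<Sum>j\<in>J. b j *\<^sub>R X j q) = 0" using that unfolding sumJ .
          have "b i = 0"
          proof (rule ccontr)
            assume bi: "b i \<noteq> 0"
            have "b i *\<^sub>R L Y = - (\<Sum>j\<in>J. b j *\<^sub>R X j q)" using 0 by (simp add: eq_neg_iff_add_eq_0)
            then have "(1 / b i) *\<^sub>R (b i *\<^sub>R L Y) = (1 / b i) *\<^sub>R - (\<Sum>j\<in>J. b j *\<^sub>R X j q)" by simp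
            then have "L Y = (\<Sum>j\<in>J. (- b j / b i) *\<^sub>R X j q)"
              using bi by (simp add: scaleR_sum_right sum_negf)
            then have "\<exists>b. L Y = (\<Sum>j\<in>J. b j *\<^sub>R X j q)"
              by (intro exI[of _ "\<lambda>j. - b j / b i"])
            then show False by (rule notE[OF notin])
          qed
          then show ?thesis using 0 q(2) by (auto simp: free_def)
        qed
        have lim: "((\<lambda>s. ?F s j) \<longlongrightarrow> ?v j) (at 0)" if "j \<in> insert i J" for j
        proof (cases "j = i")
          case True
          have "((\<lambda>s. gen a (q + s *\<^sub>R Y)) has_derivative (\<lambda>s. L (s *\<^sub>R Y))) (at 0)"
            by (rule has_derivative_compose[OF line]) (use dL in simp)
          then have "((\<lambda>s. norm (gen a (q + s *\<^sub>R Y) - s *\<^sub>R L Y) / norm s) \<longlongrightarrow> 0) (at 0)"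
            unfolding has_derivative_at using ga by (simp add: linear_scale[OF linL])
          moreover have "\<forall>\<^sub>F s in at 0. norm (gen a (q + s *\<^sub>R Y) - s *\<^sub>R L Y) / norm s
              = norm ((1/s) *\<^sub>R gen a (q + s *\<^sub>R Y) - L Y)"
          proof (subst eventually_at_filter, rule always_eventually, intro allI impI)
            fix s :: real assume "s \<noteq> 0"
            then have "(1/s) *\<^sub>R gen a (q + s *\<^sub>R Y) - L Y = (1/s) *\<^sub>R (gen a (q + s *\<^sub>R Y) - s *\<^sub>R L Y)"
              by (simp add: scaleR_diff_right)
            then show "norm (gen a (q + s *\<^sub>R Y) - s *\<^sub>R L Y) / norm s
              = norm ((1/s) *\<^sub>R gen a (q + s *\<^sub>R Y) - L Y)" by simp
          qed
          ultimately have "((\<lambda>s. norm ((1/s) *\<^sub>R gen a (q + s *\<^sub>R Y) - L Y)) \<longlongrightarrow> 0) (at 0)"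
            by (rule Lim_transform_eventually)
          then have "((\<lambda>s. (1/s) *\<^sub>R gen a (q + s *\<^sub>R Y)) \<longlongrightarrow> L Y) (at 0)"
            by (subst Lim_null) (rule tendsto_norm_zero_cancel)
          then show ?thesis using True by simp
        next
          case False
          then have jr: "j < r" using that Jr by auto
          have "isCont (X j) q"
            using gen_has_derivative[OF qU, of "\<lambda>i. if i = j then 1 else 0"] has_derivative_continuous
            unfolding gen_unit[OF jr] by blast
          from isCont_tendsto_compose[OF this tq] show ?thesis using False by simp
        qed
        have "\<forall>\<^sub>F s in at 0. \<forall>b. (\<Sum>j\<in>insert i J. b j *\<^sub>R ?F s j) = 0 \<longrightarrow> (\<forall>j\<in>insert i J. b j = 0)"
          by (rule eventually_independent[of "insert i J" ?v]) (use finJ indep lim in auto)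
        moreover have "\<forall>\<^sub>F s in at 0. q + s *\<^sub>R Y \<in> B"
          using tq B(1) q(1) by (rule topological_tendstoD)
        moreover have "\<forall>\<^sub>F s in at 0. s \<noteq> (0::real)" by (simp add: eventually_at_filter)
        ultimately have "\<forall>\<^sub>F s in at 0. s \<noteq> 0 \<and> q + s *\<^sub>R Y \<in> B \<and>
            (\<forall>b. (\<Sum>j\<in>insert i J. b j *\<^sub>R ?F s j) = 0 \<longrightarrow> (\<forall>j\<in>insert i J. b j = 0))"
          by (simp only: eventually_conj_iff)
        then obtain s where s: "s \<noteq> 0" "q + s *\<^sub>R Y \<in> B"
          "\<forall>b. (\<Sum>j\<in>insert i J. b j *\<^sub>R ?F s j) = 0 \<longrightarrow> (\<forall>j\<in>insert i J. b j = 0)"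
          using eventually_happens'[OF trivial_limit_at[of "0::real"]] by blast
        let ?q = "q + s *\<^sub>R Y"
        have "free (insert i J) ?q"
          unfolding free_def
        proof (intro allI impI)
          fix c assume c: "(\<Sum>j\<in>insert i J. c j *\<^sub>R X j ?q) = 0"
          \<comment> \<open>\<open>X i\<close> is expressed through \<open>gen a\<close> and the
            other generators by dividing by \<open>a i\<close>; the factor \<open>s\<close> undoes
            the rescaling in \<open>?F\<close>.\<close>
          let ?b = "\<lambda>j. if j = i then s * (c i / a i) else c j - (c i / a i) * a j"
          have "(\<Sum>j\<in>insert i J. ?b j *\<^sub>R ?F s j)
              = ?b i *\<^sub>R ((1/s) *\<^sub>R gen a ?q) + (\<Sum>j\<in>J. ?b j *\<^sub>R X j ?q)"
            by (rule sumJ)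
          also have "(\<Sum>j\<in>J. ?b j *\<^sub>R X j ?q) = (\<Sum>j\<in>J. c j *\<^sub>R X j ?q) - (c i / a i) *\<^sub>R (\<Sum>j\<in>J. a j *\<^sub>R X j ?q)"
            unfolding scaleR_sum_right sum_subtractf[symmetric]
            using i(2) by (intro sum.cong) (auto simp: scaleR_diff_left)
          also have "?b i *\<^sub>R ((1/s) *\<^sub>R gen a ?q) = c i *\<^sub>R X i ?q + (c i / a i) *\<^sub>R (\<Sum>j\<in>J. a j *\<^sub>R X j ?q)"
            using s(1) ai unfolding gen_a by (simp add: scaleR_add_right)
          finally have "(\<Sum>j\<in>insert i J. ?b j *\<^sub>R ?F s j) = (\<Sum>j\<in>insert i J. c j *\<^sub>R X j ?q)"
            using finJ i(2) by simp
          then have b0: "\<forall>j\<in>insert i J. ?b j = 0" using s(3)[rule_format, of ?b] c by metis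
          then have "s * (c i / a i) = 0" by (auto dest: bspec[of _ _ i])
          then have ci: "c i = 0" using s(1) ai by simp
          show "\<forall>j\<in>insert i J. c j = 0"
          proof
            fix j assume "j \<in> insert i J"
            then show "c j = 0" using b0[rule_format, of j] ci by (cases "j = i") simp_all
          qed
        qed
        then show False using not_free s(2) by blast
      qed
      then obtain b where b: "L Y = (\<Sum>j\<in>J. b j *\<^sub>R X j q)" by blast
      have "L (L Y) = (\<Sum>j\<in>J. b j *\<^sub>R L (X j q))"
        unfolding b using linL by (simp add: linear_sum linear_scale)
      also have "\<dots> = 0" using LX Jr by (intro sum.neutral) auto
      finally have "L (L Y) = 0" .
      moreover have "bilin (dG q (gen a q)) Y (L Y) + bilin (G q) (L Y) (L Y) + bilin (G q) Y (L (L Y)) = 0"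
        using gen_killing[OF aR] qU unfolding killing_field_def L_def by blast
      moreover have "bilin (dG q 0) Y (L Y) = 0"
        by (simp add: linear_0[OF linear_dG[OF qU]] bilin_expand)
      ultimately have "bilin (G q) (L Y) (L Y) = 0" by (simp add: ga bilin_linear)
      then show ?thesis using G_pos[OF qU, of "L Y"] by force
    qed
    then show False using faithful[OF aR qU ga] ai i(1) unfolding L_def by blast
  qed
  then show ?thesis using q unfolding free_def gen_def by auto
qed

lemma nonpositive_frame:
  assumes q: "q \<in> U" and free: "\<And>b. gen b q = 0 \<Longrightarrow> \<forall>i<r. b i = 0" and r: "2 * r \<ge> CARD('n) + k + 1"
  shows "\<exists>u (e :: nat \<Rightarrow> real^'n). bilin (G q) u u = 1 \<and> (\<forall>i\<in>{1..k}. bilin (G q) u (e i) = 0) \<and>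
    (\<forall>i\<in>{1..k}. \<forall>j\<in>{1..k}. bilin (G q) (e i) (e j) = (if i = j then 1 else 0)) \<and>
    (\<Sum>i=1..k. sectional_curv G q u (e i)) \<le> 0"
proof -
  interpret inner_matrix "G q" by unfold_locales (auto simp: G_sym[OF q] G_pos[OF q])
  have indep: "\<forall>j\<in>{..<r}. b j = 0" if "(\<Sum>j<r. b j *\<^sub>R X j q) = 0" for b
    using free[of b] that by (simp add: gen_def)
  obtain \<kappa> where \<kappa>: "\<And>j. linear (\<kappa> j :: real^'n \<Rightarrow> real)"
    "\<And>i j. i < r \<Longrightarrow> j < r \<Longrightarrow> \<kappa> j (X i q) = (if i = j then 1 else 0)"
    "dim (span ((\<lambda>i. X i q) ` {..<r})) = r"
  proof (rule dual_functionals[of "{..<r}" "\<lambda>i. X i q", OF finite_lessThan indep])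
    fix \<kappa> :: "nat \<Rightarrow> real^'n \<Rightarrow> real"
    assume h: "\<And>j. linear (\<kappa> j)"
      "\<And>i j. i \<in> {..<r} \<Longrightarrow> j \<in> {..<r} \<Longrightarrow> \<kappa> j (X i q) = (if i = j then 1 else 0)"
      "dim (span ((\<lambda>i. X i q) ` {..<r})) = card {..<r}"
    show thesis by (rule that[of \<kappa>, OF h(1)]) (use h(2,3) in auto)
  qed
  define T where "T = span ((\<lambda>i. X i q) ` {..<r})"
  \<comment> \<open>For \<open>x\<close> in \<open>T\<close> these are the coefficients of the
    generator whose value at \<open>q\<close> is \<open>x\<close>; the padding by 0 puts them into
    \<open>Rspace r\<close>.\<close>
  define K where "K = (\<lambda>x i. if i < r then \<kappa> i x else 0)"
  have KR: "K x \<in> Rspace r" for x by (auto simp: K_def Rspace_def)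
  have gen_K: "gen (K x) q = x" if "x \<in> T" for x
  proof -
    have lin: "linear (\<lambda>x. gen (K x) q)"
      unfolding gen_def K_def
      by (auto intro!: linearI simp: linear_add[OF \<kappa>(1)] linear_scale[OF \<kappa>(1)] scaleR_add_left
          sum.distrib scaleR_sum_right)
    have "gen (K (X j q)) q = X j q" if "j < r" for j
    proof -
      have "gen (K (X j q)) q = (\<Sum>i<r. (if j = i then 1 else 0) *\<^sub>R X i q)"
        unfolding gen_def K_def using \<kappa>(2)[OF that] by (intro sum.cong) auto
      then show ?thesis using that by (simp add: if_distrib[of "\<lambda>c. c *\<^sub>R _"] cong: if_cong)
    qed
    then show ?thesis
      using linear_eq_on_span[OF lin linear_id, of "(\<lambda>i. X i q) ` {..<r}" x] that by (auto simp: T_def)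
  qed
  \<comment> \<open>The covariant derivative depends on a field, not on its value alone. The dual
    functionals choose the generator through \<open>y\<close>, which makes \<beta> bilinear on the
    whole space while only \<open>T\<close> carries geometric meaning.\<close>
  define \<beta> where "\<beta> = (\<lambda>x y. \<Sum>j<r. \<kappa> j y *\<^sub>R nabla (X j) q x)"
  have lin_nabla: "linear (nabla (X j) q)" if "j < r" for j
  proof -
    have "linear (frechet_derivative (X j) (at q))"
      using gen_has_derivative[OF q, of "\<lambda>i. if i = j then 1 else 0"] has_derivative_linear
      unfolding gen_unit[OF that] by blast
    then show ?thesis
      unfolding nabla_def by (auto intro!: linearI simp: linear_add linear_scale gam_add_left gam_scaleR_left scaleR_add_right)
  qed
  have \<beta>_eq: "\<beta> x y = nabla (gen (K y)) q x" for x y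
  proof -
    have "gam G q x (\<Sum>j\<in>I. b j *\<^sub>R X j q) = (\<Sum>j\<in>I. b j *\<^sub>R gam G q x (X j q))" for b and I :: "nat set"
    proof (induction I rule: infinite_finite_induct)
      case (insert j I)
      then show ?case by (simp add: gam_add_right gam_scaleR_right)
    qed (use gam_scaleR_right[of G q x 0 0] in simp_all)
    then show ?thesis
      unfolding \<beta>_def nabla_def Dgen[OF q] gen_def K_def
      by (simp add: scaleR_add_right sum.distrib)
  qed
  have "bilinear \<beta>"
    unfolding bilinear_def
  proof (intro conjI allI)
    show "linear (\<beta> x)" for x
      unfolding \<beta>_def by (auto intro!: linearI simp: linear_add[OF \<kappa>(1)] linear_scale[OF \<kappa>(1)]
          scaleR_add_left sum.distrib scaleR_sum_right)
    show "linear (\<lambda>x. \<beta> x y)" for y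
      unfolding \<beta>_def by (intro linear_compose_sum ballI linear_compose_scale_right lin_nabla) simp
  qed
  moreover have \<beta>_gen: "\<beta> x y = nabla (gen (K y)) q (gen (K x) q)" if "x \<in> T" for x y
    using \<beta>_eq gen_K[OF that] by simp
  moreover have "\<beta> x y = \<beta> y x" if "x \<in> T" "y \<in> T" for x y
    using \<beta>_gen that commuting_fields_nabla[OF gen_commuting[OF KR KR] q] by metis
  moreover have "bilin (G q) (\<beta> x y) z = 0" if "x \<in> T" "y \<in> T" "z \<in> T" for x y z
  proof -
    have "bilin (G q) (nabla (gen (K y)) q (gen (K x) q)) (gen (K z) q) = 0"
      by (intro commuting_killing_orthogonal gen_killing gen_commuting KR q)
    then show ?thesis using \<beta>_gen[OF that(1)] gen_K[OF that(3)] by simp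
  qed
  ultimately have "\<exists>u e. u \<in> T \<and> bilin (G q) u u = 1 \<and> (\<forall>i\<in>{1..k}. e i \<in> T \<and> bilin (G q) u (e i) = 0 \<and>
      \<beta> u (e i) = 0 \<and> bilin (G q) (\<beta> u u) (\<beta> (e i) (e i)) \<ge> 0) \<and>
    (\<forall>i\<in>{1..k}. \<forall>j\<in>{1..k}. bilin (G q) (e i) (e j) = (if i = j then 1 else 0))"
    by (intro exists_extremal_frame) (use r \<kappa>(3) in \<open>simp_all add: T_def\<close>)
  then obtain u e where u: "u \<in> T" "bilin (G q) u u = 1"
    and e: "\<And>i. i \<in> {1..k} \<Longrightarrow> e i \<in> T \<and> bilin (G q) u (e i) = 0 \<and> \<beta> u (e i) = 0 \<and>
      bilin (G q) (\<beta> u u) (\<beta> (e i) (e i)) \<ge> 0"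
    and ee: "\<forall>i\<in>{1..k}. \<forall>j\<in>{1..k}. bilin (G q) (e i) (e j) = (if i = j then 1 else 0)"
    by (elim exE conjE) blast
  \<comment> \<open>Because \<open>\<beta> u (e i) = 0\<close>, the Gauss equation keeps only its
    negative term; orthonormality makes the denominator 1.\<close>
  have "sectional_curv G q u (e i) \<le> 0" if i: "i \<in> {1..k}" for i
  proof -
    have "bilin (G q) (riemann_curv G q (gen (K u) q) (gen (K (e i)) q) (gen (K (e i)) q)) (gen (K u) q)
      = bilin (G q) (nabla (gen (K (e i))) q (gen (K u) q)) (nabla (gen (K (e i))) q (gen (K u) q))
        - bilin (G q) (nabla (gen (K u)) q (gen (K u) q)) (nabla (gen (K (e i))) q (gen (K (e i)) q))"
      by (intro commuting_killing_curvature gen_killing gen_commuting KR q)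
    then have "bilin (G q) (riemann_curv G q u (e i) (e i)) u = - bilin (G q) (\<beta> u u) (\<beta> (e i) (e i))"
      using e[OF i] by (simp add: \<beta>_eq[symmetric] gen_K u(1) bilin_linear)
    moreover have "bilin (G q) (e i) (e i) = 1" using ee i by simp
    ultimately show ?thesis unfolding sectional_curv_def using e[OF i] u(2) by simp
  qed
  then have "(\<Sum>i=1..k. sectional_curv G q u (e i)) \<le> 0" by (intro sum_nonpos)
  then show ?thesis using u(2) e ee by blast
qed

end

section \<open>The symmetry rank bound\<close>

lemma torus_exp_carrier: "t \<in> Rspace r \<Longrightarrow> torus_exp t \<in> carrier (torus r)"
  by (auto simp: Rspace_def torus_def torus_exp_def)

lemma torus_exp_add: "torus_exp (\<lambda>i. s i + t i) = torus_exp s \<otimes>\<^bsub>torus r\<^esub> torus_exp t"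
  by (simp add: torus_def torus_exp_def cis_mult)

lemma torus_exp_zero: "torus_exp (\<lambda>i. 0) = \<one>\<^bsub>torus r\<^esub>"
  by (simp add: torus_def torus_exp_def)

lemma cis_eq_1_imp:
  assumes "cis x = 1" "\<bar>x\<bar> < 2 * pi"
  shows "x = 0"
proof -
  have "cos x = 1" using assms(1) by (metis cis.sel(1) one_complex.sel(1))
  then obtain n :: int where n: "x = real_of_int n * 2 * pi" unfolding cos_one_2pi_int by blast
  then have "\<bar>real_of_int n\<bar> < 1" using assms(2) by (simp add: abs_mult)
  then have "n = 0" by linarith
  then show ?thesis using n by simp
qed

section \<open>Limits of orthonormal frames\<close>

lemma common_convergent_subsequence:
  fixes s :: "'i \<Rightarrow> nat \<Rightarrow> 'a::euclidean_space"
  assumes "finite I" "\<And>i. i \<in> I \<Longrightarrow> bounded (range (s i))"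
  shows "\<exists>l \<rho>. strict_mono (\<rho> :: nat \<Rightarrow> nat) \<and> (\<forall>i\<in>I. (\<lambda>n. s i (\<rho> n)) \<longlonglongrightarrow> l i)"
  using assms
proof (induction I rule: finite_induct)
  case empty
  then show ?case by (auto intro: exI[of _ id] simp: strict_mono_id)
next
  case (insert j I)
  then obtain l \<rho> where \<rho>: "strict_mono (\<rho> :: nat \<Rightarrow> nat)" "\<And>i. i \<in> I \<Longrightarrow> (\<lambda>n. s i (\<rho> n)) \<longlonglongrightarrow> l i"
    by auto
  have "bounded (range (\<lambda>n. s j (\<rho> n)))"
    using insert.prems[of j] by (rule bounded_subset) auto
  from bounded_imp_convergent_subsequence[OF this] obtain m \<sigma> where \<sigma>: "strict_mono (\<sigma> :: nat \<Rightarrow> nat)"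
    "(\<lambda>n. s j (\<rho> (\<sigma> n))) \<longlonglongrightarrow> m" by (auto simp: comp_def)
  have "(\<lambda>n. s i (\<rho> (\<sigma> n))) \<longlonglongrightarrow> l i" if "i \<in> I" for i
    using LIMSEQ_subseq_LIMSEQ[OF \<rho>(2)[OF that] \<sigma>(1)] by (simp add: comp_def)
  then show ?case
    using \<sigma>(2) insert.hyps(2) strict_mono_o[OF \<rho>(1) \<sigma>(1), unfolded comp_def]
    by (intro exI[of _ "l(j := m)"] exI[of _ "\<lambda>n. \<rho> (\<sigma> n)"]) auto
qed

text \<open>On a compact ball times the Euclidean unit sphere the metric has a positive minimum
  \<open>m\<close>; scaling bounds vectors of metric length 1 by
  \<open>sqrt (1 / m)\<close>.\<close>

lemma (in local_metric) unit_vectors_locally_bounded: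
  assumes p: "p \<in> U"
  obtains d R where "d > 0" "ball p d \<subseteq> U" "\<And>x u. x \<in> ball p d \<Longrightarrow> bilin (G x) u u = 1 \<Longrightarrow> norm u \<le> R"
proof -
  obtain e where e: "e > 0" "cball p e \<subseteq> U" using open_contains_cball[of U] open_U p by blast
  define C where "C = cball p e \<times> sphere (0::real^'n) 1"
  have "compact C" unfolding C_def by (intro compact_Times compact_cball compact_sphere)
  moreover have "C \<noteq> {}" using e(1) by (auto simp: C_def intro!: exI[of _ "axis undefined 1 :: real^'n"])
  moreover have "continuous_on C (\<lambda>(x, u). bilin (G x) u u)"
  proof -
    have "continuous_on C (\<lambda>z. G (fst z))"
      by (rule continuous_on_compose2[OF Ck_on_imp_continuous_on[OF G_Ck] continuous_on_fst[OF continuous_on_id]])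
        (use e(2) in \<open>auto simp: C_def\<close>)
    then show ?thesis
      unfolding continuous_on_def split_beta by (auto intro!: tendsto_bilin tendsto_snd)
  qed
  ultimately obtain z where z: "z \<in> C" "\<And>w. w \<in> C \<Longrightarrow> bilin (G (fst z)) (snd z) (snd z) \<le> bilin (G (fst w)) (snd w) (snd w)"
    using continuous_attains_inf[of C "\<lambda>(x, u). bilin (G x) u u"] by (auto simp: split_beta)
  define m where "m = bilin (G (fst z)) (snd z) (snd z)"
  have "snd z \<noteq> 0" using z(1) by (auto simp: C_def)
  then have m: "m > 0" unfolding m_def using G_pos[of "fst z"] z(1) e(2) by (auto simp: C_def)
  show thesis
  proof (rule that[OF e(1)])
    show "ball p e \<subseteq> U" using e(2) by auto
    fix x u assume x: "x \<in> ball p e" and u: "bilin (G x) u u = 1"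
    have u0: "u \<noteq> 0" using u by (auto simp: bilin_linear)
    have "(x, (1 / norm u) *\<^sub>R u) \<in> C" using x u0 by (auto simp: C_def)
    from z(2)[OF this] have "m \<le> (1 / norm u) * (1 / norm u)" by (simp add: m_def bilin_linear u)
    then have "(norm u)\<^sup>2 \<le> 1 / m" using m u0 by (simp add: power2_eq_square field_simps)
    then show "norm u \<le> sqrt (1 / m)" by (simp add: real_le_rsqrt)
  qed
qed

text \<open>Frames at points tending to \<open>p\<close> are bounded, hence converge along a
  subsequence; orthonormality and the weak inequality are closed conditions.\<close>

lemma (in local_metric) nonpositive_frame_limit:
  assumes p: "p \<in> U"
    and frames: "\<And>B. open B \<Longrightarrow> p \<in> B \<Longrightarrow> B \<subseteq> U \<Longrightarrow> \<exists>q\<in>B. \<exists>u (e :: nat \<Rightarrow> real^'n). bilin (G q) u u = 1 \<and>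
      (\<forall>i\<in>{1..k}. bilin (G q) u (e i) = 0) \<and>
      (\<forall>i\<in>{1..k}. \<forall>j\<in>{1..k}. bilin (G q) (e i) (e j) = (if i = j then 1 else 0)) \<and>
      (\<Sum>i=1..k. sectional_curv G q u (e i)) \<le> 0"
  shows "\<exists>u (e :: nat \<Rightarrow> real^'n). bilin (G p) u u = 1 \<and> (\<forall>i\<in>{1..k}. bilin (G p) u (e i) = 0) \<and>
      (\<forall>i\<in>{1..k}. \<forall>j\<in>{1..k}. bilin (G p) (e i) (e j) = (if i = j then 1 else 0)) \<and>
      (\<Sum>i=1..k. sectional_curv G p u (e i)) \<le> 0"
proof -
  obtain d R where d: "d > 0" "ball p d \<subseteq> U" "\<And>x u. x \<in> ball p d \<Longrightarrow> bilin (G x) u u = 1 \<Longrightarrow> norm u \<le> R"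
    using unit_vectors_locally_bounded[OF p] by metis
  define Q where "Q = (\<lambda>n q u (e :: nat \<Rightarrow> real^'n). q \<in> ball p (min d (1 / real (Suc n))) \<and> bilin (G q) u u = 1 \<and>
      (\<forall>i\<in>{1..k}. bilin (G q) u (e i) = 0) \<and>
      (\<forall>i\<in>{1..k}. \<forall>j\<in>{1..k}. bilin (G q) (e i) (e j) = (if i = j then 1 else 0)) \<and>
      (\<Sum>i=1..k. sectional_curv G q u (e i)) \<le> 0)"
  have "\<exists>q u e. Q n q u e" for n
  proof -
    have "ball p (min d (1 / real (Suc n))) \<subseteq> U" using d(2) by auto
    moreover have "p \<in> ball p (min d (1 / real (Suc n)))" using d(1) by simp
    ultimately show ?thesis unfolding Q_def using frames[OF open_ball] by blast
  qed
  then obtain q u e where Q: "\<And>n. Q n (q n) (u n) (e n)" by metis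
  have q: "\<And>n. q n \<in> ball p (min d (1 / real (Suc n)))" "\<And>n. bilin (G (q n)) (u n) (u n) = 1"
    "\<And>n i. i \<in> {1..k} \<Longrightarrow> bilin (G (q n)) (u n) (e n i) = 0"
    "\<And>n i j. i \<in> {1..k} \<Longrightarrow> j \<in> {1..k} \<Longrightarrow> bilin (G (q n)) (e n i) (e n j) = (if i = j then 1 else 0)"
    "\<And>n. (\<Sum>i=1..k. sectional_curv G (q n) (u n) (e n i)) \<le> 0"
    using Q unfolding Q_def by blast+
  \<comment> \<open>Frame indices start at 1, so index 0 is free for \<open>u\<close> and one
    extraction serves all vectors.\<close>
  define s where "s = (\<lambda>i n. if i = 0 then u n else e n i)"
  have "bounded (range (s i))" if "i \<in> {0..k}" for i
  proof -
    have "norm (s i n) \<le> R" for n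
    proof (rule d(3))
      show "q n \<in> ball p d" using q(1)[of n] by simp
      show "bilin (G (q n)) (s i n) (s i n) = 1" using q(2) q(4)[of i i n] that by (auto simp: s_def)
    qed
    then show ?thesis by (auto simp: bounded_iff)
  qed
  from common_convergent_subsequence[of "{0..k}" s, OF _ this] obtain l \<rho>
    where \<rho>: "strict_mono (\<rho> :: nat \<Rightarrow> nat)" "\<And>i. i \<in> {0..k} \<Longrightarrow> (\<lambda>n. s i (\<rho> n)) \<longlonglongrightarrow> l i" by blast
  have "q \<longlonglongrightarrow> p"
  proof (rule metric_LIMSEQ_I)
    fix e :: real assume "e > 0"
    then obtain N where N: "1 / real (Suc N) < e" using nat_approx_posE by blast
    have "dist (q n) p < e" if "n \<ge> N" for n
    proof -
      have "dist (q n) p < 1 / real (Suc n)" using q(1)[of n] by (simp add: dist_commute)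
      also have "\<dots> \<le> 1 / real (Suc N)" using that by (simp add: frac_le)
      finally show ?thesis using N by simp
    qed
    then show "\<exists>N. \<forall>n\<ge>N. dist (q n) p < e" by blast
  qed
  then have qp: "(\<lambda>n. q (\<rho> n)) \<longlonglongrightarrow> p"
    using LIMSEQ_subseq_LIMSEQ[OF _ \<rho>(1)] by (simp add: comp_def)
  have Gp: "(\<lambda>n. G (q (\<rho> n))) \<longlonglongrightarrow> G p"
    by (rule isCont_tendsto_compose[OF has_derivative_continuous[OF has_derivative_G[OF p]] qp])
  have lu: "(\<lambda>n. u (\<rho> n)) \<longlonglongrightarrow> l 0" using \<rho>(2)[of 0] by (simp add: s_def)
  have le: "(\<lambda>n. e (\<rho> n) i) \<longlonglongrightarrow> l i" if "i \<in> {1..k}" for i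
    using \<rho>(2)[of i] that by (simp add: s_def)
  have uu: "bilin (G p) (l 0) (l 0) = 1"
    using LIMSEQ_unique[OF tendsto_bilin[OF Gp lu lu]] by (simp add: q(2))
  have ue: "bilin (G p) (l 0) (l i) = 0" if "i \<in> {1..k}" for i
    using LIMSEQ_unique[OF tendsto_bilin[OF Gp lu le[OF that]]] by (simp add: q(3)[OF that])
  have ee: "bilin (G p) (l i) (l j) = (if i = j then 1 else 0)" if "i \<in> {1..k}" "j \<in> {1..k}" for i j
    using LIMSEQ_unique[OF tendsto_bilin[OF Gp le[OF that(1)] le[OF that(2)]], of "if i = j then 1 else 0"]
    unfolding q(4)[OF that] by simp
  have "(\<lambda>n. \<Sum>i=1..k. sectional_curv G (q (\<rho> n)) (u (\<rho> n)) (e (\<rho> n) i))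
      \<longlonglongrightarrow> (\<Sum>i=1..k. sectional_curv G p (l 0) (l i))"
    by (intro tendsto_sum tendsto_sectional_curv[OF p qp lu le]) (simp_all add: uu ue ee)
  then have "(\<Sum>i=1..k. sectional_curv G p (l 0) (l i)) \<le> 0"
    by (rule LIMSEQ_le_const2) (use q(5) in blast)
  then show ?thesis using uu ue ee by (intro exI[of _ "l 0"] exI[of _ l]) simp
qed

lemma torus_rank_bound:
  fixes A :: "('m::{t2_space, second_countable_topology}, 'n::finite) chart set"
  assumes M: "riemannian_manifold A g" and conn: "connected (UNIV :: 'm set)"
    and Ric: "Ric_pos_at A g k p" and act: "effective_isometric_torus_action A g r a"
  shows "2 * r \<le> CARD('n) + k"
proof (rule ccontr)
  assume "\<not> 2 * r \<le> CARD('n) + k"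
  then have r: "2 * r \<ge> CARD('n) + k + 1" by simp
  obtain c where c: "c \<in> A" "p \<in> chart_dom c"
    and pos: "\<And>u (e :: nat \<Rightarrow> real^'n). bilin (g c (chart_map c p)) u u = 1 \<Longrightarrow>
      \<forall>i\<in>{1..k}. bilin (g c (chart_map c p)) u (e i) = 0 \<Longrightarrow>
      \<forall>i\<in>{1..k}. \<forall>j\<in>{1..k}. bilin (g c (chart_map c p)) (e i) (e j) = (if i = j then 1 else 0) \<Longrightarrow>
      (\<Sum>i=1..k. sectional_curv (g c) (chart_map c p) u (e i)) > 0"
    using Ric unfolding Ric_pos_at_def Let_def by blast
  have ga: "faithful_action (torus r) UNIV a" and sm: "smooth_torus_map A r a"
    and isoz: "\<And>z. z \<in> carrier (torus r) \<Longrightarrow> isometry A g (a z)"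
    using act by (auto simp: effective_isometric_torus_action_def)
  interpret fa: faithful_action "torus r" UNIV a by (rule ga)
  note ch = is_chartD[OF riemannian_manifold_chart(1)[OF M c(1)]]
  interpret lm: local_metric "chart_img c" "g c" by (rule riemannian_manifold_chart(2)[OF M c(1)])
  let ?U = "chart_img c"
  have a_add: "a (torus_exp (\<lambda>i. s i + t i)) x = a (torus_exp s) (a (torus_exp t) x)"
    if "s \<in> Rspace r" "t \<in> Rspace r" for s t x
    unfolding torus_exp_add[of s t r] using fa.composition_rule torus_exp_carrier that by auto
  have a_one: "a \<one>\<^bsub>torus r\<^esub> = (\<lambda>x. x)" using fa.id_eq_one by (simp add: restrict_def)
  define V where "V = (\<lambda>t. {x \<in> ?U. a (torus_exp t) (chart_inv c x) \<in> chart_dom c})"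
  define f where "f = (\<lambda>t. coord_rep c c (a (torus_exp t)))"
  define S where "S = {(t, x). t \<in> Rspace r \<and> x \<in> ?U \<and> a (torus_exp t) (chart_inv c x) \<in> chart_dom c}"
  define F where "F = (\<lambda>(t, x). coord_rep c c (a (torus_exp t)) x)"
  have F: "Ck_param_on r 3 S F"
    using sm c(1) unfolding smooth_torus_map_def S_def F_def by blast
  \<comment> \<open>Joint continuity of the action makes the set where the moved point stays in the
    chart relatively open.\<close>
  obtain W where W: "open W" "S = W \<inter> Rspace r \<times> UNIV"
  proof -
    have "continuous_on (Rspace r \<times> UNIV) (\<lambda>(t, q). a (torus_exp t) q)"
      using sm by (simp add: smooth_torus_map_def)
    moreover have "continuous_on (Rspace r \<times> ?U) (\<lambda>z. (fst z, chart_inv c (snd z)))"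
      by (intro continuous_on_Pair continuous_on_fst continuous_on_id
          continuous_on_compose2[OF ch(4) continuous_on_snd[OF continuous_on_id]]) auto
    ultimately have "continuous_on (Rspace r \<times> ?U) (\<lambda>z. (\<lambda>(t, q). a (torus_exp t) q) (fst z, chart_inv c (snd z)))"
      by (rule continuous_on_compose2) auto
    then obtain W0 where W0: "open W0" "W0 \<inter> Rspace r \<times> ?U
        = (\<lambda>z. (\<lambda>(t, q). a (torus_exp t) q) (fst z, chart_inv c (snd z))) -` chart_dom c \<inter> Rspace r \<times> ?U"
      using ch(1) unfolding continuous_on_open_invariant by blast
    have "S = (W0 \<inter> UNIV \<times> ?U) \<inter> Rspace r \<times> UNIV"
      using W0(2) unfolding S_def set_eq_iff by auto
    moreover have "open (W0 \<inter> UNIV \<times> ?U)" using W0(1) ch(2) by (intro open_Int open_Times) auto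
    ultimately show thesis using that by blast
  qed
  have zeroR: "(\<lambda>i. 0) \<in> Rspace r" by (simp add: Rspace_def)
  have S0: "((\<lambda>i. 0), x) \<in> S \<longleftrightarrow> x \<in> ?U" for x
    using ch(9) by (auto simp: S_def zeroR torus_exp_zero[of r] a_one)
  obtain X where X: "\<And>i. i < r \<Longrightarrow> Ck_on 2 ?U (X i)"
    "\<And>b x. b \<in> Rspace r \<Longrightarrow> x \<in> ?U \<Longrightarrow>
      ((\<lambda>\<tau>. F ((\<lambda>i. \<tau> * b i), x)) has_vector_derivative (\<Sum>i<r. b i *\<^sub>R X i x)) (at 0)"
    "\<And>b x h. b \<in> Rspace r \<Longrightarrow> x \<in> ?U \<Longrightarrow>
      ((\<lambda>\<tau>. frechet_derivative (\<lambda>y. F ((\<lambda>i. \<tau> * b i), y)) (at x) h) has_vector_derivative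
        (\<Sum>i<r. b i *\<^sub>R frechet_derivative (X i) (at x) h)) (at 0)"
  proof (rule infinitesimal_generators[OF W F, unfolded S0 Collect_mem_eq], goal_cases)
    case (1 X)
    show ?case by (rule 1(1)[OF 1(2-4)])
  qed
  have Ff: "(\<lambda>y. F (t, y)) = f t" for t by (simp add: F_def f_def)
  note iso = isometry_coord_rep[OF M c(1) isoz[OF torus_exp_carrier]]
  have VV: "chart_map c ` (chart_dom c \<inter> a (torus_exp t) -` chart_dom c) = V t" if "t \<in> Rspace r" for t
    using iso(7)[OF that] by (simp add: V_def)
  have f_eq: "f t x = chart_map c (a (torus_exp t) (chart_inv c x))" for t x
    by (simp add: f_def coord_rep_def)
  interpret local_torus_action ?U "g c" r V f X
  proof unfold_locales
    fix t assume t: "t \<in> Rspace r"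
    show "open (V t)" "V t \<subseteq> ?U" "\<And>k. Ck_on k (V t) (f t)" "f t ` V t \<subseteq> ?U"
      using iso(1-4)[OF t] unfolding VV[OF t] f_def by blast+
    show "bilin (g c (f t x)) (frechet_derivative (f t) (at x) u) (frechet_derivative (f t) (at x) v) = bilin (g c x) u v"
      if "x \<in> V t" for x u v
      using iso(5)[OF t] that unfolding VV[OF t] f_def by blast
  next
    fix s t x assume s: "s \<in> Rspace r" and t: "t \<in> Rspace r" and x: "x \<in> V t" "f t x \<in> V s"
    have y: "chart_inv c (f t x) = a (torus_exp t) (chart_inv c x)"
      using x(1) ch(6) by (simp add: f_eq V_def)
    show "x \<in> V (\<lambda>i. s i + t i) \<and> f (\<lambda>i. s i + t i) x = f s (f t x)"
      using x y by (simp add: V_def f_eq[of s] f_eq[of "\<lambda>i. s i + t i"] a_add[OF s t])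
  next
    fix x assume "x \<in> ?U"
    then show "x \<in> V (\<lambda>i. 0) \<and> f (\<lambda>i. 0) x = x"
      using ch(7,9) by (simp add: V_def f_eq torus_exp_zero[of r] a_one)
  next
    fix b x assume b: "b \<in> Rspace r" and x: "x \<in> ?U"
    have R: "(\<lambda>i. \<tau> * b i) \<in> Rspace r" for \<tau> using b by (auto simp: Rspace_def)
    have "open {\<tau>. ((\<lambda>i. \<tau> * b i), x) \<in> S}"
      by (rule open_param_pullback(1)[OF W _ R]) (auto intro!: continuous_intros)
    moreover have "0 \<in> {\<tau>. ((\<lambda>i. \<tau> * b i), x) \<in> S}" using S0 x by simp
    ultimately have "\<forall>\<^sub>F \<tau> in nhds 0. ((\<lambda>i. \<tau> * b i), x) \<in> S"
      unfolding eventually_nhds by (intro exI[of _ "{\<tau>. ((\<lambda>i. \<tau> * b i), x) \<in> S}"]) blast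
    then show "\<forall>\<^sub>F \<tau> in nhds 0. x \<in> V (\<lambda>i. \<tau> * b i)"
      by (rule eventually_mono) (simp add: S_def V_def)
    show "((\<lambda>\<tau>. f (\<lambda>i. \<tau> * b i) x) has_vector_derivative (\<Sum>i<r. b i *\<^sub>R X i x)) (at 0)"
      using X(2)[OF b x] by (simp add: F_def f_def)
    show "((\<lambda>\<tau>. frechet_derivative (f (\<lambda>i. \<tau> * b i)) (at x) h) has_vector_derivative
        (\<Sum>i<r. b i *\<^sub>R frechet_derivative (X i) (at x) h)) (at 0)" for h
      using X(3)[OF b x] unfolding Ff .
  qed (rule X(1))
  \<comment> \<open>A first-order zero makes a small time \<tau> act as the identity on the manifold
    by rigidity; effectiveness then makes the torus element trivial.\<close>
  have faithful: "\<forall>i<r. b i = 0"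
    if b: "b \<in> Rspace r" and q: "q \<in> ?U" "gen b q = 0" "\<And>h. Dgen b q h = 0" for b q
  proof (intro allI impI)
    fix i assume "i < r"
    obtain d where d: "d > 0" "\<And>\<tau>. \<bar>\<tau>\<bar> < d \<Longrightarrow> q \<in> V (\<lambda>i. \<tau> * b i) \<and> f (\<lambda>i. \<tau> * b i) q = q
      \<and> Df (\<lambda>i. \<tau> * b i) q = (\<lambda>u. u)"
      using stationary_point[OF b q] by metis
    \<comment> \<open>Below \<open>d\<close> the point is stationary; the second bound keeps
      \<open>\<tau> * b i\<close> within one period of \<open>cis\<close>, so a trivial torus
      element forces \<open>b i = 0\<close>.\<close>
    define \<tau> where "\<tau> = min (d / 2) (pi / (\<bar>b i\<bar> + 1))"
    have \<tau>: "\<tau> > 0" "\<tau> < d" "\<tau> \<le> pi / (\<bar>b i\<bar> + 1)" using d(1) by (auto simp: \<tau>_def min_less_iff_disj)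
    let ?t = "\<lambda>i. \<tau> * b i"
    have R: "?t \<in> Rspace r" by (rule Rspace_scale[OF b])
    let ?y = "chart_inv c q"
    have D: "q \<in> V ?t" "f ?t q = q" "Df ?t q = (\<lambda>u. u)" using d(2)[of \<tau>] \<tau> by auto
    have y: "?y \<in> chart_dom c" "chart_map c ?y = q" using ch(7,9) q(1) by auto
    have "a (torus_exp ?t) ?y \<in> chart_dom c" "chart_map c (a (torus_exp ?t) ?y) = chart_map c ?y"
      using D(1,2) y(2) by (auto simp: V_def f_eq)
    then have fy: "a (torus_exp ?t) ?y = ?y" using ch(5) y(1) by (metis inj_onD)
    have "a (torus_exp ?t) = (\<lambda>x. x)"
      by (rule isometry_rigidity[OF M conn c(1) isoz[OF torus_exp_carrier[OF R]] y(1) fy])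
        (use D(3) y(2) in \<open>simp add: f_def\<close>)
    then have "torus_exp ?t = \<one>\<^bsub>torus r\<^esub>"
      using fa.faithful a_one torus_exp_carrier[OF R] torus_exp_carrier[OF zeroR]
      unfolding torus_exp_zero[of r] by (metis inj_onD)
    then have "torus_exp ?t i = 1" by (simp add: torus_def)
    then have "cis (\<tau> * b i) = 1" by (simp add: torus_exp_def)
    moreover have "\<bar>\<tau> * b i\<bar> < 2 * pi"
    proof -
      have "\<bar>\<tau> * b i\<bar> \<le> \<tau> * (\<bar>b i\<bar> + 1)" using \<tau>(1) by (simp add: abs_mult)
      also have "\<dots> \<le> pi" using \<tau>(3) by (simp add: pos_le_divide_eq)
      also have "\<dots> < 2 * pi" by simp
      finally show ?thesis .
    qed
    ultimately have "\<tau> * b i = 0" by (rule cis_eq_1_imp)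
    then show "b i = 0" using \<tau>(1) by simp
  qed
  have "\<exists>u (e :: nat \<Rightarrow> real^'n). bilin (g c (chart_map c p)) u u = 1 \<and>
      (\<forall>i\<in>{1..k}. bilin (g c (chart_map c p)) u (e i) = 0) \<and>
      (\<forall>i\<in>{1..k}. \<forall>j\<in>{1..k}. bilin (g c (chart_map c p)) (e i) (e j) = (if i = j then 1 else 0)) \<and>
      (\<Sum>i=1..k. sectional_curv (g c) (chart_map c p) u (e i)) \<le> 0"
  proof (rule lm.nonpositive_frame_limit)
    show "chart_map c p \<in> ?U" using ch(8) c(2) by blast
    fix B assume B: "open B" "chart_map c p \<in> B" "B \<subseteq> ?U"
    have "\<exists>q\<in>B. \<forall>b. gen b q = 0 \<longrightarrow> (\<forall>i<r. b i = 0)"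
      using B by (intro exists_free_point faithful) auto
    then obtain q where q: "q \<in> B" "\<And>b. gen b q = 0 \<Longrightarrow> \<forall>i<r. b i = 0" by blast
    then show "\<exists>q\<in>B. \<exists>u (e :: nat \<Rightarrow> real^'n). bilin (g c q) u u = 1 \<and>
      (\<forall>i\<in>{1..k}. bilin (g c q) u (e i) = 0) \<and>
      (\<forall>i\<in>{1..k}. \<forall>j\<in>{1..k}. bilin (g c q) (e i) (e j) = (if i = j then 1 else 0)) \<and>
      (\<Sum>i=1..k. sectional_curv (g c) q u (e i)) \<le> 0"
      using nonpositive_frame[OF _ q(2) r] B(3) by blast
  qed
  then obtain u and e :: "nat \<Rightarrow> real^'n" where ue: "bilin (g c (chart_map c p)) u u = 1"
    "\<forall>i\<in>{1..k}. bilin (g c (chart_map c p)) u (e i) = 0"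
    "\<forall>i\<in>{1..k}. \<forall>j\<in>{1..k}. bilin (g c (chart_map c p)) (e i) (e j) = (if i = j then 1 else 0)"
    "(\<Sum>i=1..k. sectional_curv (g c) (chart_map c p) u (e i)) \<le> 0"
    by blast
  from pos[OF ue(1-3)] ue(4) show False by simp
qed

theorem theoremA:
  fixes A :: "('m::{t2_space, second_countable_topology}, 'n::finite) chart set"
    and g :: "('m, 'n) metric"
    and k :: nat and p :: 'm
  assumes "riemannian_manifold A g"
    and "connected (UNIV :: 'm set)"
    and "CARD('n) \<ge> 2"
    and "k \<in> {1..CARD('n) - 1}"
    and "Ric_pos_at A g k p"
  shows "symrank A g \<le> enat ((CARD('n) + k) div 2)"
  unfolding symrank_def
proof (rule SUP_least)
  fix r assume "r \<in> {r. \<exists>a. effective_isometric_torus_action A g r a}"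
  then have "2 * r \<le> CARD('n) + k"
    using torus_rank_bound[OF assms(1,2,5)] by blast
  then show "enat r \<le> enat ((CARD('n) + k) div 2)" by simp
qed

end
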